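(* Let $(\alpha,B)$ and $(\beta,C)$ be tope-admissible pairs of $\mathcal M$, where $\alpha,\beta\in\mathbb N^E$ and $B,C\in\mathcal T(\mathcal M)$. If the three conditions (1) $B=\varepsilon_\beta C$, (2) $(\alpha+\beta,C)$ is tope-admissible, (3) $\kappa_M(\alpha+\beta)=\kappa_M(\alpha)+\kappa_M(\beta)$ all hold, then $$u_{\alpha,B}\smile u_{\beta,C}=u_{\alpha+\beta,C}.$$ Otherwise (if at least one of the three conditions fails), $u_{\alpha,B}\smile u_{\beta,C}=0$.
   Context: Arrangement. Let $E$ be a finite set and let $\mathcal A=\{H_e\}_{e\in E}$ be a finite central real hyperplane arrangement in a finite-dimensional real vector space $V$: the $H_e=\ker\varphi_e$ ($0\neq\varphi_e\in V^*$) are pairwise distinct linear hyperplanes. Its oriented matroid $\mathcal M$ has covector set $\mathcal L(\mathcal M)=\{(\operatorname{sgn}\varphi_e(x))_{e\in E}\mid x\in V\}\subseteq\{+,-,0\}^E$. The topes (chambers) are the covectors with no zero entry; $\mathcal T(\mathcal M)$ is the set of topes. The underlying matroid $M$ on $E$ has rank function $\operatorname{rk}S=\dim\operatorname{span}\{\varphi_e\mid e\in S\}$; it is simple. For a sign vector $X$ and $S\subseteq E$, $X\setminus S$ is obtained from $X$ by replacing the entries indexed by $S$ by $0$, and $\varepsilon_SX$ is obtained by reversing the signs of the entries indexed by $S$. For $\alpha\in\mathbb N^E$ ($\mathbb N$ contains $0$), $\varepsilon_\alpha X:=\varepsilon_{\{e\mid\alpha_e\text{ odd}\}}X$. Tope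 graph. $\mathcal G$ is the graph with vertex set $\mathcal T(\mathcal M)$, two topes being adjacent iff they differ in exactly one coordinate; its path metric is $d(A,B)=|\operatorname{Sep}(A,B)|$ with $\operatorname{Sep}(A,B)=\{e\in E\mid A_e\ne B_e\}$. Crossing-graded magnitude (co)homology over $\mathbb F_2$. A proper $k$-chain is a tuple $\boldsymbol A=(A_0,\dots,A_k)$ of topes with $A_{i-1}\ne A_i$ for all $i$; its crossing vector is $\sum_{i=1}^k\mathbf 1_{\operatorname{Sep}(A_{i-1},A_i)}\in\mathbb N^E$. $\mathrm{MC}_{k,\alpha}(\mathcal G;\mathbb F_2)$ is the $\mathbb F_2$-vector space on proper $k$-chains with crossing vector $\alpha$, with differential $\partial=\sum_{i=1}^{k-1}(-1)^i\partial_i$, where $\partial_i$ deletes $A_i$ if $d(A_{i-1},A_{i+1})=d(A_{i-1},A_i)+d(A_i,A_{i+1})$ and is $0$ otherwise. The subscript $A\to B$ denotes the subcomplex spanned by chains with $A_0=A$, $A_k=B$. Dualizing gives cochain complexes $\mathrm{MC}^{*,\alpha}$ and cohomology $\mathrm{MH}^{*,\alpha}(\mathcal G;\mathbb F_2)$, the direct sum of its fixed-endpoint parts $\mathrm{MH}^{*,\alpha}(\mathcal G;\mathbb F_2)_{A\to B}$. The cup product $\smile:\mathrm{MH}^{p,\alpha}\otimes\mathrm{MH}^{q,\beta}\to\mathrm{MH}^{p+q,\alpha+\beta}$ is induced by $(\varphi\smile\psi)(A_0,\dots,A_{p+q})=\varphi(A_0,\dots,A_p)\,\psi(A_p,\dots,A_{p+q})$.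 Admissibility. For $\alpha\in\mathbb N^E$ put $m(\alpha)=\max_e\alpha_e$, $U_j(\alpha)=\{e\in E\mid\alpha_e\ge j\}$ for $1\le j\le m(\alpha)$, and $\kappa_M(\alpha)=\sum_{j=1}^{m(\alpha)}\operatorname{rk}U_j(\alpha)$, with $\kappa_M(\mathbf 0)=0$. $\alpha$ is $M$-admissible if every nonempty $U_j(\alpha)$ is a flat of $M$. For $B\in\mathcal T(\mathcal M)$ the pair $(\alpha,B)$ is tope-admissible if $\alpha$ is $M$-admissible and $B\setminus U_j(\alpha)\in\mathcal L(\mathcal M)$ for every $j$. Canonical classes. For a tope-admissible pair $(\alpha,B)$, the space $\mathrm{MH}^{\kappa_M(\alpha),\alpha}(\mathcal G;\mathbb F_2)_{\varepsilon_\alpha B\to B}$ is one-dimensional over $\mathbb F_2$, and $u_{\alpha,B}$ denotes its unique nonzero element. *)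

theory Defs
  imports
    "HOL-Analysis.Analysis"
    "HOL-Library.Function_Algebras"
    "HOL-Library.Z2"
begin

section \<open>Linear functionals as vectors\<close>

text \<open>
  Pointwise scaling turns functions into a real vector space (addition is already pointwise), so
  that \<open>span\<close> and \<open>dim\<close> apply to linear functionals.
\<close>

instantiation "fun" :: (type, real_vector) real_vector
begin

definition scaleR_fun :: "real \<Rightarrow> ('a \<Rightarrow> 'b) \<Rightarrow> 'a \<Rightarrow> 'b"
  where "scaleR_fun c f = (\<lambda>x. c *\<^sub>R f x)"

instance
  by standard (auto simp: scaleR_fun_def fun_eq_iff scaleR_right_distrib scaleR_left_distrib)

end


section \<open>Arrangements and their oriented matroids\<close>

definition arrangement :: "'e set \<Rightarrow> ('e \<Rightarrow> 'v::real_vector \<Rightarrow> real) \<Rightarrow> bool"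
  where "arrangement E \<phi> \<longleftrightarrow>
    finite E \<and>
    (\<exists>S :: 'v set. finite S \<and> span S = UNIV) \<and>
    (\<forall>e\<in>E. linear (\<phi> e) \<and> \<phi> e \<noteq> 0) \<and>
    inj_on (\<lambda>e. {x. \<phi> e x = 0}) E"

text \<open>
  A sign vector on \<open>E\<close> has entries \<open>1\<close>, \<open>-1\<close>, \<open>0\<close> (the values of \<^const>\<open>sgn\<close>) and is extended by \<open>0\<close>
  outside \<open>E\<close>. Exponent vectors are likewise extended by \<open>0\<close>; sums of exponent vectors and of
  cochains are the pointwise sums of functions.
\<close>

type_synonym 'e sign_vector = "'e \<Rightarrow> real"

definition covectors :: "'e set \<Rightarrow> ('e \<Rightarrow> 'v::real_vector \<Rightarrow> real) \<Rightarrow> 'e sign_vector set"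
  where "covectors E \<phi> = range (\<lambda>x e. if e \<in> E then sgn (\<phi> e x) else 0)"

definition topes :: "'e set \<Rightarrow> ('e \<Rightarrow> 'v::real_vector \<Rightarrow> real) \<Rightarrow> 'e sign_vector set"
  where "topes E \<phi> = {X \<in> covectors E \<phi>. \<forall>e\<in>E. X e \<noteq> 0}"

definition rk :: "('e \<Rightarrow> 'v::real_vector \<Rightarrow> real) \<Rightarrow> 'e set \<Rightarrow> nat"
  where "rk \<phi> S = dim (span (\<phi> ` S))"

definition flat :: "'e set \<Rightarrow> ('e \<Rightarrow> 'v::real_vector \<Rightarrow> real) \<Rightarrow> 'e set \<Rightarrow> bool"
  where "flat E \<phi> S \<longleftrightarrow> S \<subseteq> E \<and> (\<forall>e \<in> E - S. rk \<phi> S < rk \<phi> (insert e S))"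

definition zero_out :: "'e sign_vector \<Rightarrow> 'e set \<Rightarrow> 'e sign_vector"
  where "zero_out X S = (\<lambda>e. if e \<in> S then 0 else X e)"

definition reorient :: "'e set \<Rightarrow> 'e sign_vector \<Rightarrow> 'e sign_vector"
  where "reorient S X = (\<lambda>e. if e \<in> S then - X e else X e)"

definition exponents :: "'e set \<Rightarrow> ('e \<Rightarrow> nat) set"
  where "exponents E = {\<alpha>. \<forall>e. e \<notin> E \<longrightarrow> \<alpha> e = 0}"

definition flip :: "('e \<Rightarrow> nat) \<Rightarrow> 'e sign_vector \<Rightarrow> 'e sign_vector"
  where "flip \<alpha> X = reorient {e. odd (\<alpha> e)} X"


section \<open>Magnitude cohomology of the tope graph\<close>

definition Sep :: "'e sign_vector \<Rightarrow> 'e sign_vector \<Rightarrow> 'e set"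
  where "Sep A B = {e. A e \<noteq> B e}"

definition tope_adj :: "'e sign_vector set \<Rightarrow> ('e sign_vector \<times> 'e sign_vector) set"
  where "tope_adj T = {(A, B). A \<in> T \<and> B \<in> T \<and> card (Sep A B) = 1}"

definition tope_dist :: "'e sign_vector set \<Rightarrow> 'e sign_vector \<Rightarrow> 'e sign_vector \<Rightarrow> nat"
  where "tope_dist T A B = (LEAST n. (A, B) \<in> tope_adj T ^^ n)"

definition crossing :: "'e sign_vector list \<Rightarrow> 'e \<Rightarrow> nat"
  where "crossing As = (\<lambda>e. \<Sum>i = 1..<length As. indicator (Sep (As ! (i - 1)) (As ! i)) e)"

definition chains :: "'e sign_vector set \<Rightarrow> nat \<Rightarrow> ('e \<Rightarrow> nat) \<Rightarrow> 'e sign_vector list set"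
  where "chains T k \<alpha> = {As. length As = k + 1 \<and> set As \<subseteq> T \<and>
    (\<forall>i\<in>{1..k}. As ! (i - 1) \<noteq> As ! i) \<and> crossing As = \<alpha>}"

definition smooth_at :: "'e sign_vector set \<Rightarrow> 'e sign_vector list \<Rightarrow> nat \<Rightarrow> bool"
  where "smooth_at T As i \<longleftrightarrow>
    tope_dist T (As ! (i - 1)) (As ! (i + 1)) =
      tope_dist T (As ! (i - 1)) (As ! i) + tope_dist T (As ! i) (As ! (i + 1))"

text \<open>
  The differential of a basis chain of degree \<open>k = length As - 1\<close>, as a formal sum of chains, that
  is, as the function assigning to each chain its coefficient.
\<close>

definition boundary :: "'e sign_vector set \<Rightarrow> 'e sign_vector list \<Rightarrow> 'e sign_vector list \<Rightarrow> bit"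
  where "boundary T As = (\<lambda>Ds. \<Sum>i = 1..<length As - 1.
    (- 1) ^ i * (if smooth_at T As i \<and> Ds = take i As @ drop (i + 1) As then 1 else 0))"

text \<open>
  A cochain, being a linear functional on the space with basis \<^term>\<open>chains T k \<alpha>\<close>, is given by its
  values on that basis, extended by \<open>0\<close> to all other lists. The codifferential is the transpose of
  the differential.
\<close>

definition cochains :: "'e sign_vector set \<Rightarrow> nat \<Rightarrow> ('e \<Rightarrow> nat) \<Rightarrow> ('e sign_vector list \<Rightarrow> bit) set"
  where "cochains T k \<alpha> = {f. \<forall>As. As \<notin> chains T k \<alpha> \<longrightarrow> f As = 0}"

definition codiff :: "'e sign_vector set \<Rightarrow> nat \<Rightarrow> ('e \<Rightarrow> nat) \<Rightarrow>
    ('e sign_vector list \<Rightarrow> bit) \<Rightarrow> 'e sign_vector list \<Rightarrow> bit"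
  where "codiff T k \<alpha> f = (\<lambda>As. if As \<in> chains T (k + 1) \<alpha>
    then \<Sum>Ds \<in> chains T k \<alpha>. boundary T As Ds * f Ds else 0)"

definition cocycles :: "'e sign_vector set \<Rightarrow> nat \<Rightarrow> ('e \<Rightarrow> nat) \<Rightarrow> ('e sign_vector list \<Rightarrow> bit) set"
  where "cocycles T k \<alpha> = {f \<in> cochains T k \<alpha>. codiff T k \<alpha> f = 0}"

definition coboundaries :: "'e sign_vector set \<Rightarrow> nat \<Rightarrow> ('e \<Rightarrow> nat) \<Rightarrow> ('e sign_vector list \<Rightarrow> bit) set"
  where "coboundaries T k \<alpha> =
    (case k of 0 \<Rightarrow> {0} | Suc j \<Rightarrow> codiff T j \<alpha> ` cochains T j \<alpha>)"

definition cohomologous :: "'e sign_vector set \<Rightarrow> nat \<Rightarrow> ('e \<Rightarrow> nat) \<Rightarrow>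
    (('e sign_vector list \<Rightarrow> bit) \<times> ('e sign_vector list \<Rightarrow> bit)) set"
  where "cohomologous T k \<alpha> =
    {(f, g). f \<in> cocycles T k \<alpha> \<and> g \<in> cocycles T k \<alpha> \<and> f - g \<in> coboundaries T k \<alpha>}"

definition coh_class :: "'e sign_vector set \<Rightarrow> nat \<Rightarrow> ('e \<Rightarrow> nat) \<Rightarrow>
    ('e sign_vector list \<Rightarrow> bit) \<Rightarrow> ('e sign_vector list \<Rightarrow> bit) set"
  where "coh_class T k \<alpha> f = cohomologous T k \<alpha> `` {f}"

definition MH :: "'e sign_vector set \<Rightarrow> nat \<Rightarrow> ('e \<Rightarrow> nat) \<Rightarrow> ('e sign_vector list \<Rightarrow> bit) set set"
  where "MH T k \<alpha> = cocycles T k \<alpha> // cohomologous T k \<alpha>"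

abbreviation MH_zero :: "'e sign_vector set \<Rightarrow> nat \<Rightarrow> ('e \<Rightarrow> nat) \<Rightarrow> ('e sign_vector list \<Rightarrow> bit) set"
  where "MH_zero T k \<alpha> \<equiv> coh_class T k \<alpha> 0"

text \<open>
  The differential preserves endpoints, so the complex is the direct sum of its fixed-endpoint parts.
  The cohomology of the part from \<open>A\<close> to \<open>B\<close> is taken as a direct summand of \<^const>\<open>MH\<close>: it consists of
  the classes of the cocycles supported on chains from \<open>A\<close> to \<open>B\<close>.
\<close>

definition MH_between :: "'e sign_vector set \<Rightarrow> nat \<Rightarrow> ('e \<Rightarrow> nat) \<Rightarrow>
    'e sign_vector \<Rightarrow> 'e sign_vector \<Rightarrow> ('e sign_vector list \<Rightarrow> bit) set set"
  where "MH_between T k \<alpha> A B = coh_class T k \<alpha> `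
    {f \<in> cocycles T k \<alpha>. \<forall>As. f As \<noteq> 0 \<longrightarrow> hd As = A \<and> last As = B}"

definition cup_cochain :: "nat \<Rightarrow> ('e sign_vector list \<Rightarrow> bit) \<Rightarrow> ('e sign_vector list \<Rightarrow> bit) \<Rightarrow>
    'e sign_vector list \<Rightarrow> bit"
  where "cup_cochain p f g = (\<lambda>As. f (take (p + 1) As) * g (drop p As))"

text \<open>
  On classes, the cup product is the union of the classes of the products of all representatives;
  these classes coincide.
\<close>

definition cup :: "'e sign_vector set \<Rightarrow> nat \<Rightarrow> ('e \<Rightarrow> nat) \<Rightarrow> nat \<Rightarrow> ('e \<Rightarrow> nat) \<Rightarrow>
    ('e sign_vector list \<Rightarrow> bit) set \<Rightarrow> ('e sign_vector list \<Rightarrow> bit) set \<Rightarrow>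
    ('e sign_vector list \<Rightarrow> bit) set"
  where "cup T p \<alpha> q \<beta> x y =
    (\<Union>f\<in>x. \<Union>g\<in>y. coh_class T (p + q) (\<alpha> + \<beta>) (cup_cochain p f g))"


section \<open>Admissibility and canonical classes\<close>

text \<open>Inserting \<open>0\<close> only matters for empty \<open>E\<close>.\<close>

definition max_exp :: "'e set \<Rightarrow> ('e \<Rightarrow> nat) \<Rightarrow> nat"
  where "max_exp E \<alpha> = Max (insert 0 (\<alpha> ` E))"

definition level :: "'e set \<Rightarrow> nat \<Rightarrow> ('e \<Rightarrow> nat) \<Rightarrow> 'e set"
  where "level E j \<alpha> = {e \<in> E. \<alpha> e \<ge> j}"

definition kappa :: "'e set \<Rightarrow> ('e \<Rightarrow> 'v::real_vector \<Rightarrow> real) \<Rightarrow> ('e \<Rightarrow> nat) \<Rightarrow> nat"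
  where "kappa E \<phi> \<alpha> = (\<Sum>j = 1..max_exp E \<alpha>. rk \<phi> (level E j \<alpha>))"

definition admissible :: "'e set \<Rightarrow> ('e \<Rightarrow> 'v::real_vector \<Rightarrow> real) \<Rightarrow> ('e \<Rightarrow> nat) \<Rightarrow> bool"
  where "admissible E \<phi> \<alpha> \<longleftrightarrow>
    (\<forall>j\<in>{1..max_exp E \<alpha>}. level E j \<alpha> \<noteq> {} \<longrightarrow> flat E \<phi> (level E j \<alpha>))"

definition tope_admissible ::
    "'e set \<Rightarrow> ('e \<Rightarrow> 'v::real_vector \<Rightarrow> real) \<Rightarrow> ('e \<Rightarrow> nat) \<Rightarrow> 'e sign_vector \<Rightarrow> bool"
  where "tope_admissible E \<phi> \<alpha> B \<longleftrightarrow>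
    admissible E \<phi> \<alpha> \<and>
    (\<forall>j\<in>{1..max_exp E \<alpha>}. zero_out B (level E j \<alpha>) \<in> covectors E \<phi>)"

definition canonical_class ::
    "'e set \<Rightarrow> ('e \<Rightarrow> 'v::real_vector \<Rightarrow> real) \<Rightarrow> ('e \<Rightarrow> nat) \<Rightarrow> 'e sign_vector \<Rightarrow>
      ('e sign_vector list \<Rightarrow> bit) set"
  where "canonical_class E \<phi> \<alpha> B =
    (THE u. u \<in> MH_between (topes E \<phi>) (kappa E \<phi> \<alpha>) \<alpha> (flip \<alpha> B) B \<and>
      u \<noteq> MH_zero (topes E \<phi>) (kappa E \<phi> \<alpha>) \<alpha>)"

end

theory Submission
  imports Defs
begin

text \<open>
  All chains with a given start \<open>A\<close> and a given crossing vector \<open>\<gamma>\<close>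
  end at \<open>flip \<gamma> A\<close>. The proof computes the cohomology of the complex
  \<open>chains_from A \<gamma>\<close> of these chains, all lengths together; a chain with
  \<open>n\<close> vertices has degree \<open>n - 1\<close>. Over the field with two elements the
  coboundary of a cochain at a chain \<open>x\<close> is the sum of its values over the set
  \<open>faces x\<close> of chains obtained by deleting one vertex that lies on a geodesic between its
  neighbours, so a complex is given by a set with a face relation. Call \<open>U\<close> facial for
  \<open>A\<close> if it is the set of all hyperplanes through some face of \<open>A\<close>, that is,
  if \<open>zero_out A U\<close> is a covector; then \<open>(\<gamma>, A)\<close> is tope-admissible
  iff all levels of \<open>\<gamma>\<close> are facial for \<open>A\<close>
  (\<open>tope_admissible_iff\<close>).

  The cohomology of \<open>chains_from A \<gamma>\<close> is one-dimensional, in degree \<open>kappa E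
  \<phi> \<gamma>\<close>, if \<open>(\<gamma>, A)\<close> is admissible, and zero otherwise
  (\<open>cohomology_of_chains\<close>). There are three steps. If \<open>U\<close> is facial for
  \<open>A\<close> and some crossing is off \<open>U\<close>, the chains whose first step crosses a
  hyperplane of \<open>U\<close> form an exact complex, since before the first vertex \<open>X\<close>
  outside the star of the face one may insert or delete the projection of \<open>X\<close> to the star
  (\<open>exact_meeting\<close>). For geodesics that cross a set \<open>S\<close>, an induction over
  the first step gives the cohomology of a sphere, in degree the rank of \<open>S\<close>, if
  \<open>S\<close> is facial for \<open>A\<close>, and an exact complex otherwise
  (\<open>geodesic_cohomology\<close>). Finally a chain can be cut after its longest initial geodesic;
  only chains for which this geodesic crosses the whole support of \<open>\<gamma>\<close> contribute
  (\<open>exact_uncut_support\<close>), and they form a tensor product of a complex of geodesics with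
  a complex of chains of smaller crossing vector.

  For the product, consider the chains from \<open>A\<close> of crossing vector \<open>\<alpha> +
  \<beta>\<close>. Those that can be cut after crossing \<open>\<alpha>\<close> span a quotient that
  is the tensor product of the complexes for \<open>\<alpha>\<close> and \<open>\<beta>\<close>, and
  on it the cup product is the tensor product of cochains. So the product of generators is a generator
  as soon as the subcomplex of the chains that cannot be cut is exact (\<open>generates_cup\<close>).
  By associativity of the product it suffices to know this when \<open>\<alpha>\<close> is the
  indicator of a facial set \<open>Q\<close> (\<open>product_of_generators\<close>). This case is
  \<open>exact_uncut_flat\<close>: additivity of \<open>kappa\<close> is the equality case of the
  submodular inequality for the rank, applied to each level of the exponents. The modular pairs of
  flats that it provides pass admissibility to the summands (\<open>adm_summand\<close>) and allow an
  induction on \<open>Q\<close>.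

  Conversely, the product vanishes as a cochain if \<open>B \<noteq> flip \<beta> C\<close>, because
  chains of the first factor end at \<open>B\<close> and those of the second start at \<open>flip
  \<beta> C\<close>. If the two topes agree, the product is a cocycle on the chains of crossing vector
  \<open>\<alpha> + \<beta>\<close> in degree \<open>kappa E \<phi> \<alpha> + kappa E \<phi>
  \<beta>\<close>, and it is a coboundary unless the only nonzero cohomology group lies in that degree
  (\<open>cup_canonical\<close>).
\<close>

text \<open>
  The type \<open>bit\<close> is used as a field; its operations should not be rewritten to boolean
  ones.
\<close>

declare add_bit_eq_xor [simp del] mult_bit_eq_and [simp del]

lemma bit_add_self [simp]: "(x::bit) + x = 0"
  by (cases x) auto

lemma bit_add_eq_iff: "(x::bit) + y = z \<longleftrightarrow> x = y + z"
  by (cases x; cases y; cases z) auto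

lemma bit_diff: "(x::bit) - y = x + y"
  by (cases x; cases y) auto

lemma bit_mult_eq_1_iff [simp]: "(x::bit) * y = 1 \<longleftrightarrow> x = 1 \<and> y = 1"
  by (cases x; cases y) auto

section \<open>Complexes with a basis\<close>

text \<open>
  A complex over the field with two elements is given by its basis \<open>I\<close> and a face
  relation \<open>F\<close>: the boundary of \<open>x\<close> is the sum of \<open>F x \<inter>
  I\<close>. Subcomplexes, quotients and subquotients are then subsets of \<open>I\<close> with the
  same \<open>F\<close>. Cochains are functions of which only the values on \<open>I\<close> count,
  and degrees are kept together, since most of the arguments below do not need the grading.
\<close>

definition cobd :: "('i \<Rightarrow> 'i set) \<Rightarrow> 'i set \<Rightarrow> ('i \<Rightarrow> bit) \<Rightarrow> 'i \<Rightarrow> bit"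
  where "cobd F I f x = (\<Sum>y\<in>F x \<inter> I. f y)"

definition cocycle :: "('i \<Rightarrow> 'i set) \<Rightarrow> 'i set \<Rightarrow> ('i \<Rightarrow> bit) \<Rightarrow> bool"
  where "cocycle F I f \<longleftrightarrow> (\<forall>x\<in>I. cobd F I f x = 0)"

definition coboundary :: "('i \<Rightarrow> 'i set) \<Rightarrow> 'i set \<Rightarrow> ('i \<Rightarrow> bit) \<Rightarrow> bool"
  where "coboundary F I f \<longleftrightarrow> (\<exists>g. \<forall>x\<in>I. f x = cobd F I g x)"

definition is_complex :: "('i \<Rightarrow> 'i set) \<Rightarrow> 'i set \<Rightarrow> bool"
  where "is_complex F I \<longleftrightarrow>
    (\<forall>x\<in>I. finite (F x)) \<and> (\<forall>f. \<forall>x\<in>I. cobd F I (cobd F I f) x = 0)"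

definition exact :: "('i \<Rightarrow> 'i set) \<Rightarrow> 'i set \<Rightarrow> bool"
  where "exact F I \<longleftrightarrow> (\<forall>f. cocycle F I f \<longrightarrow> coboundary F I f)"

definition closed_in :: "('i \<Rightarrow> 'i set) \<Rightarrow> 'i set \<Rightarrow> 'i set \<Rightarrow> bool"
  where "closed_in F I J \<longleftrightarrow> J \<subseteq> I \<and> (\<forall>x\<in>J. F x \<inter> I \<subseteq> J)"

abbreviation cut_to :: "'i set \<Rightarrow> ('i \<Rightarrow> bit) \<Rightarrow> 'i \<Rightarrow> bit"
  where "cut_to J f \<equiv> (\<lambda>x. if x \<in> J then f x else 0)"

lemma cobd_add: "cobd F I (\<lambda>x. f x + g x) x = cobd F I f x + cobd F I g x"
  by (simp add: cobd_def sum.distrib)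

lemma cobd_mult: "cobd F I (\<lambda>x. c * f x) x = c * cobd F I f x"
  by (simp add: cobd_def sum_distrib_left)

lemma cobd_cong: "(\<And>y. y \<in> F x \<inter> I \<Longrightarrow> f y = g y) \<Longrightarrow> cobd F I f x = cobd F I g x"
  by (simp add: cobd_def)

lemma cobd_vanish: "(\<And>y. y \<in> F x \<inter> I \<Longrightarrow> f y = 0) \<Longrightarrow> cobd F I f x = 0"
  by (simp add: cobd_def)

lemma cobd_restrict:
  assumes "J \<subseteq> I" "finite (F x)" "\<And>y. y \<in> F x \<inter> I \<Longrightarrow> y \<notin> J \<Longrightarrow> f y = 0"
  shows "cobd F I f x = cobd F J f x"
  unfolding cobd_def using assms by (intro sum.mono_neutral_right) auto

lemma cobd_cut_to:
  assumes "J \<subseteq> I" "finite (F x)"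
  shows "cobd F I (cut_to J f) x = cobd F J f x"
proof -
  have "cobd F I (cut_to J f) x = cobd F J (cut_to J f) x"
    using assms by (intro cobd_restrict) auto
  also have "\<dots> = cobd F J f x" by (rule cobd_cong) auto
  finally show ?thesis .
qed

lemma cobd_closed:
  assumes "closed_in F I J" "x \<in> J"
  shows "cobd F I f x = cobd F J f x"
proof -
  have "F x \<inter> I = F x \<inter> J" using assms by (auto simp: closed_in_def)
  then show ?thesis by (simp add: cobd_def)
qed

lemma cobd_cobd: "is_complex F I \<Longrightarrow> x \<in> I \<Longrightarrow> cobd F I (cobd F I f) x = 0"
  by (simp add: is_complex_def)

lemma finite_faces: "is_complex F I \<Longrightarrow> x \<in> I \<Longrightarrow> finite (F x)"
  by (simp add: is_complex_def)

text \<open>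
  If no sequence of faces leaves \<open>J\<close> and returns, then \<open>J\<close> spans a
  subquotient: of the terms of a double coboundary, those that pass through \<open>I - J\<close>
  vanish.
\<close>

lemma is_complex_convex:
  assumes I: "is_complex F I" and "J \<subseteq> I"
    and conv: "\<And>x y z. x \<in> J \<Longrightarrow> y \<in> F x \<inter> I \<Longrightarrow> z \<in> F y \<inter> J \<Longrightarrow> y \<in> J"
  shows "is_complex F J"
proof -
  have "cobd F J (cobd F J f) x = 0" if x: "x \<in> J" for f x
  proof -
    have xI: "x \<in> I" using x assms by auto
    have "cobd F J (cobd F J f) x = cobd F I (cobd F J f) x"
    proof (rule cobd_restrict[symmetric])
      fix y assume y: "y \<in> F x \<inter> I" "y \<notin> J"
      then have "F y \<inter> J = {}" using conv[OF x] by auto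
      then show "cobd F J f y = 0" by (simp add: cobd_def)
    qed (use finite_faces[OF I xI] assms in auto)
    also have "\<dots> = cobd F I (cobd F I (cut_to J f)) x"
      by (rule cobd_cong) (use finite_faces[OF I] assms(2) in \<open>auto simp: cobd_cut_to\<close>)
    also have "\<dots> = 0" using I xI by (rule cobd_cobd)
    finally show ?thesis .
  qed
  then show ?thesis using I assms(2) by (auto simp: is_complex_def)
qed

lemma is_complex_closed: "is_complex F I \<Longrightarrow> closed_in F I J \<Longrightarrow> is_complex F J"
  by (rule is_complex_convex) (auto simp: closed_in_def)

lemma is_complex_Diff_closed: "is_complex F I \<Longrightarrow> closed_in F I J \<Longrightarrow> is_complex F (I - J)"
  by (erule is_complex_convex) (auto simp: closed_in_def)

lemma exact_empty [simp]: "exact F {}"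
  by (simp add: exact_def coboundary_def)

lemma cocycle_add: "cocycle F I f \<Longrightarrow> cocycle F I g \<Longrightarrow> cocycle F I (\<lambda>x. f x + g x)"
  by (simp add: cocycle_def cobd_add)

lemma cocycle_mult: "cocycle F I f \<Longrightarrow> cocycle F I (\<lambda>x. c * f x)"
  by (simp add: cocycle_def cobd_mult)

lemma cocycle_cobd: "is_complex F I \<Longrightarrow> cocycle F I (cobd F I f)"
  by (simp add: cocycle_def cobd_cobd)

lemma cocycle_closed: "closed_in F I J \<Longrightarrow> cocycle F I f \<Longrightarrow> cocycle F J f"
  using cobd_closed[of F I J _ f] by (force simp: cocycle_def closed_in_def)

text \<open>
  The cochains of the quotient by \<open>J\<close> are the cochains that vanish on \<open>J\<close>.
\<close>

lemma cobd_Diff: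
  assumes "is_complex F I" "closed_in F I J" "x \<in> I" "\<And>y. y \<in> J \<Longrightarrow> f y = 0"
  shows "cobd F I f x = cobd F (I - J) f x"
  using assms finite_faces[OF assms(1,3)] by (intro cobd_restrict) auto

lemma cocycle_Diff:
  assumes "is_complex F I" "closed_in F I J" "\<And>y. y \<in> J \<Longrightarrow> f y = 0"
  shows "cocycle F (I - J) f \<longleftrightarrow> cocycle F I f"
proof -
  have "cobd F I f x = 0" if "x \<in> J" for x
    by (rule cobd_vanish) (use that assms in \<open>auto simp: closed_in_def\<close>)
  then show ?thesis
    using cobd_Diff[where f = f, OF assms(1,2) _ assms(3)] by (simp add: cocycle_def) (metis DiffI DiffD1)
qed

lemma cobd_extend_quotient:
  assumes "is_complex F I" "closed_in F I J" "x \<in> I"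
  shows "cobd F I (cut_to (I - J) f) x = (if x \<in> J then 0 else cobd F (I - J) f x)"
proof (cases "x \<in> J")
  case True
  then have "cobd F I (cut_to (I - J) f) x = 0"
    by (intro cobd_vanish) (use assms in \<open>auto simp: closed_in_def\<close>)
  then show ?thesis using True by simp
next
  case False
  then show ?thesis using cobd_cut_to[of "I - J" I F x f] finite_faces[OF assms(1,3)] by auto
qed

lemma cobd_extend_sub:
  assumes "is_complex F I" "closed_in F I J" "x \<in> J"
  shows "cobd F I (cut_to J f) x = cobd F J f x"
  using assms by (auto simp: closed_in_def intro!: cobd_cut_to finite_faces)

text \<open>
  A cochain on \<open>J\<close> whose coboundary is \<open>f\<close> there can be extended by zero;
  adding the coboundary of this extension moves the cocycle \<open>f\<close> into the quotient.
\<close>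

lemma clear_subcomplex:
  assumes I: "is_complex F I" and J: "closed_in F I J"
    and f: "cocycle F I f" and fJ: "coboundary F J f"
  obtains g where "\<And>x. x \<in> J \<Longrightarrow> f x + cobd F I g x = 0"
    "cocycle F (I - J) (\<lambda>x. f x + cobd F I g x)" "cocycle F I (\<lambda>x. f x + cobd F I g x)"
proof -
  from fJ obtain g where g: "\<And>x. x \<in> J \<Longrightarrow> f x = cobd F J g x" by (auto simp: coboundary_def)
  have 1: "f x + cobd F I (cut_to J g) x = 0" if "x \<in> J" for x
    using g[OF that] cobd_extend_sub[OF I J that] by simp
  have 2: "cocycle F I (\<lambda>x. f x + cobd F I (cut_to J g) x)"
    by (intro cocycle_add f cocycle_cobd I)
  show ?thesis
    using that[of "cut_to J g"] 1 2 cocycle_Diff[OF I J, of "\<lambda>x. f x + cobd F I (cut_to J g) x"] by blast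
qed

text \<open>A cocycle is first cleared on the subcomplex and then bounded in the quotient.\<close>

lemma exact_extension:
  assumes I: "is_complex F I" and J: "closed_in F I J" and "exact F J" "exact F (I - J)"
  shows "exact F I"
  unfolding exact_def
proof (intro allI impI)
  fix f assume f: "cocycle F I f"
  then have "coboundary F J f" using assms(3) cocycle_closed[OF J f] by (simp add: exact_def)
  then obtain g where g: "\<And>x. x \<in> J \<Longrightarrow> f x + cobd F I g x = 0"
    "cocycle F (I - J) (\<lambda>x. f x + cobd F I g x)"
    using clear_subcomplex[OF I J f] by metis
  then obtain h where h: "\<And>x. x \<in> I - J \<Longrightarrow> f x + cobd F I g x = cobd F (I - J) h x"
    using assms(4) by (auto simp: exact_def coboundary_def)
  have "f x = cobd F I (\<lambda>x. g x + cut_to (I - J) h x) x" if "x \<in> I" for x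
    using g(1)[of x] h[of x] that
      cobd_extend_quotient[OF I J that, of h]
      by (cases "x \<in> J") (simp_all add: cobd_add bit_add_eq_iff)
  then show "coboundary F I f" unfolding coboundary_def by blast
qed

text \<open>
  This is the connecting homomorphism: the coboundary of a cocycle of \<open>J\<close>, extended by
  zero, is a cocycle \<open>e\<close> of the quotient. A cochain of the quotient with coboundary
  \<open>e\<close> corrects the extension to a cocycle of \<open>I\<close>.
\<close>

lemma exact_sub:
  assumes I: "is_complex F I" and J: "closed_in F I J" and "exact F I" "exact F (I - J)"
  shows "exact F J"
  unfolding exact_def
proof (intro allI impI)
  fix f assume f: "cocycle F J f"
  define e where "e = cobd F I (cut_to J f)"
  have e0: "e x = 0" if "x \<in> J" for x
    using cobd_extend_sub[OF I J that] f that by (simp add: e_def cocycle_def)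
  have "cocycle F I e" unfolding e_def by (rule cocycle_cobd[OF I])
  then have "cocycle F (I - J) e" using cocycle_Diff[OF I J e0] by simp
  then obtain h where h: "\<And>x. x \<in> I - J \<Longrightarrow> e x = cobd F (I - J) h x"
    using assms(4) by (auto simp: exact_def coboundary_def)
  have "cobd F I (\<lambda>x. cut_to J f x + cut_to (I - J) h x) x = 0" if "x \<in> I" for x
    using that e0[of x] h[of x] unfolding cobd_add cobd_extend_quotient[OF I J that]
    by (auto simp: e_def)
  then have "coboundary F I (\<lambda>x. cut_to J f x + cut_to (I - J) h x)"
    using assms(3) by (auto simp: exact_def cocycle_def)
  then obtain k where k: "\<And>x. x \<in> I \<Longrightarrow> cut_to J f x + cut_to (I - J) h x = cobd F I k x"
    by (auto simp: coboundary_def)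
  have "f x = cobd F J k x" if "x \<in> J" for x
    using k[of x] that J cobd_closed[OF J that, of k] by (auto simp: closed_in_def)
  then show "coboundary F J f" by (auto simp: coboundary_def)
qed

text \<open>
  The elements with \<open>p x = l\<close> are the graded pieces of a filtration. Without a piece for
  which \<open>r l\<close> is maximal the others still form a subcomplex, so that the pieces can be
  split off one by one.
\<close>

lemma exact_filtration:
  fixes p :: "'i \<Rightarrow> 'l" and r :: "'l \<Rightarrow> int"
  assumes "finite I" "is_complex F I"
    and "\<And>x y. x \<in> I \<Longrightarrow> y \<in> F x \<inter> I \<Longrightarrow> p y = p x \<or> r (p y) < r (p x)"
    and "\<And>l. exact F {x \<in> I. p x = l}"
  shows "exact F I"
  using assms
proof (induction "card (p ` I)" arbitrary: I rule: less_induct)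
  case (less I)
  show ?case
  proof (cases "I = {}")
    case False
    then have "finite (p ` I)" "p ` I \<noteq> {}" using less.prems by auto
    then obtain l where l: "l \<in> p ` I" "\<And>l'. l' \<in> p ` I \<Longrightarrow> r l' \<le> r l"
      using Max_in[of "r ` p ` I"] Max_ge[of "r ` p ` I"] by fastforce
    define J where "J = {x \<in> I. p x \<noteq> l}"
    have J: "closed_in F I J"
      unfolding closed_in_def J_def using l(2) less.prems(3) by fastforce
    have "p ` J \<subseteq> p ` I - {l}" unfolding J_def by auto
    then have "p ` J \<subset> p ` I" using l(1) by (metis Diff_iff insertI1 psubsetI subset_iff)
    then have card: "card (p ` J) < card (p ` I)"
      using less.prems(1) by (intro psubset_card_mono) auto
    have "exact F J"
    proof (rule less.hyps[OF card])
      fix l'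
      have "{x \<in> J. p x = l'} = (if l' = l then {} else {x \<in> I. p x = l'})" by (auto simp: J_def)
      then show "exact F {x \<in> J. p x = l'}" using less.prems(4) by simp
    qed (use less.prems is_complex_closed[OF _ J] in \<open>auto simp: J_def\<close>)
    moreover have "I - J = {x \<in> I. p x = l}" by (auto simp: J_def)
    ultimately show ?thesis
      using exact_extension[OF less.prems(2) J] less.prems(4) by auto
  qed simp
qed

text \<open>One edge of an acyclic matching.\<close>

lemma exact_pair:
  assumes "F a \<inter> {a, b} = {}" "F b \<inter> {a, b} = {a}"
  shows "exact F {a, b}"
  unfolding exact_def
proof (intro allI impI)
  fix f assume "cocycle F {a, b} f"
  then have "f a = 0" using assms by (simp add: cocycle_def cobd_def)
  then have "\<forall>x\<in>{a, b}. f x = cobd F {a, b} (\<lambda>_. f b) x"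
    using assms by (auto simp: cobd_def)
  then show "coboundary F {a, b} f" unfolding coboundary_def by blast
qed

text \<open>
  The cohomology, all degrees taken together, is one-dimensional, with the class of \<open>f\<close>
  as generator; as \<open>f\<close> is supported in degree \<open>n\<close>, it is concentrated in
  that degree.
\<close>

definition generates ::
    "('i \<Rightarrow> 'i set) \<Rightarrow> ('i \<Rightarrow> nat) \<Rightarrow> 'i set \<Rightarrow> nat \<Rightarrow> ('i \<Rightarrow> bit) \<Rightarrow> bool"
  where "generates F deg I n f \<longleftrightarrow>
    (\<forall>x. f x \<noteq> 0 \<longrightarrow> x \<in> I \<and> deg x = n) \<and> cocycle F I f \<and> \<not> coboundary F I f \<and>
    (\<forall>g. cocycle F I g \<longrightarrow> (\<exists>c. coboundary F I (\<lambda>x. g x + c * f x)))"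

lemma generates_supp: "generates F deg I n f \<Longrightarrow> f x \<noteq> 0 \<Longrightarrow> x \<in> I \<and> deg x = n"
  by (auto simp: generates_def)

lemma generates_spans:
  assumes "generates F deg I n f" "cocycle F I g"
  obtains c h where "\<And>x. x \<in> I \<Longrightarrow> g x + c * f x = cobd F I h x"
  using assms unfolding generates_def coboundary_def by blast

text \<open>
  An exact subcomplex can be divided out. That \<open>f\<close> does not become a coboundary is seen
  by changing a cochain with coboundary \<open>f\<close> such that it vanishes on \<open>J\<close>.
\<close>

lemma generates_quotient:
  assumes I: "is_complex F I" and J: "closed_in F I J" and "exact F J"
    and f: "generates F deg (I - J) n f"
  shows "generates F deg I n f"
proof -
  have f0: "f x = 0" if "x \<in> J" for x using f that by (auto simp: generates_def)
  have coc: "cocycle F I f" using f cocycle_Diff[OF I J f0] by (simp add: generates_def)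
  have "\<not> coboundary F I f"
  proof
    assume "coboundary F I f"
    then obtain g where g: "\<And>x. x \<in> I \<Longrightarrow> f x = cobd F I g x" by (auto simp: coboundary_def)
    have "cocycle F J g"
      unfolding cocycle_def using g f0 cobd_closed[OF J, of _ g] J
      by (metis closed_in_def subsetD)
    then obtain k where k: "\<And>x. x \<in> J \<Longrightarrow> g x = cobd F J k x"
      using \<open>exact F J\<close> by (auto simp: exact_def coboundary_def)
    define g' where "g' = (\<lambda>x. g x + cobd F I (cut_to J k) x)"
    have g'0: "g' x = 0" if "x \<in> J" for x
      using that k cobd_extend_sub[OF I J that, of k] by (simp add: g'_def)
    have "f x = cobd F (I - J) g' x" if "x \<in> I - J" for x
      using that g[of x] cobd_Diff[OF I J, of x g'] g'0
      by (simp add: g'_def cobd_add cobd_cobd[OF I])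
    then show False using f by (auto simp: generates_def coboundary_def)
  qed
  moreover have "\<exists>c. coboundary F I (\<lambda>x. g x + c * f x)" if g: "cocycle F I g" for g
  proof -
    have "coboundary F J g" using cocycle_closed[OF J g] \<open>exact F J\<close> by (auto simp: exact_def)
    then obtain k where k: "\<And>x. x \<in> J \<Longrightarrow> g x + cobd F I k x = 0"
      "cocycle F (I - J) (\<lambda>x. g x + cobd F I k x)"
      using clear_subcomplex[OF I J g] by metis
    then obtain c h where h: "\<And>x. x \<in> I - J \<Longrightarrow> g x + cobd F I k x + c * f x = cobd F (I - J) h x"
      using generates_spans[OF f k(2)] by blast
    have "g x + c * f x = cobd F I (\<lambda>x. k x + cut_to (I - J) h x) x" if "x \<in> I" for x
      using h[of x] k(1)[of x] f0[of x] that
        cobd_extend_quotient[OF I J that, of h]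
      by (cases "x \<in> J") (simp_all add: cobd_add bit_add_eq_iff)
    then show ?thesis unfolding coboundary_def by blast
  qed
  ultimately show ?thesis using f coc by (auto simp: generates_def)
qed

text \<open>
  If the quotient is exact, the obstruction \<open>e\<close> to extending a cocycle of
  \<open>J\<close> by zero is the coboundary of a cochain \<open>h\<close> of the quotient. The
  extension is corrected by the part \<open>h'\<close> of \<open>h\<close> in degree \<open>n\<close>
  only, which keeps it homogeneous and suffices because \<open>e\<close> lives in degree \<open>n +
  1\<close>.
\<close>

lemma generates_sub:
  assumes I: "is_complex F I" and J: "closed_in F I J" and "exact F (I - J)"
    and f: "generates F deg J n f"
    and deg: "\<And>x y. x \<in> I \<Longrightarrow> y \<in> F x \<inter> I \<Longrightarrow> deg x = Suc (deg y)"
  shows "\<exists>f'. generates F deg I n f'"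
proof -
  have fcut: "cut_to J f = f" using f by (auto simp: generates_def fun_eq_iff)
  define e where "e = cobd F I f"
  have e0: "e x = 0" if "x \<in> J" for x
    using cobd_extend_sub[OF I J that, of f] f that unfolding fcut
    by (simp add: e_def cocycle_def generates_def)
  have "cocycle F I e" unfolding e_def by (rule cocycle_cobd[OF I])
  then have "cocycle F (I - J) e" using cocycle_Diff[OF I J e0] by simp
  then obtain h where h: "\<And>x. x \<in> I - J \<Longrightarrow> e x = cobd F (I - J) h x"
    using assms(3) by (auto simp: exact_def coboundary_def)
  define h' where "h' = (\<lambda>x. if x \<in> I - J \<and> deg x = n then h x else 0)"
  have h': "e x = cobd F (I - J) h' x" if x: "x \<in> I - J" for x
  proof (cases "deg x = Suc n")
    case True
    then have "cobd F (I - J) h x = cobd F (I - J) h' x"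
      by (intro cobd_cong) (use deg x in \<open>auto simp: h'_def\<close>)
    then show ?thesis using h[OF x] by simp
  next
    case False
    then have "cobd F (I - J) h' x = 0"
      by (intro cobd_vanish) (use deg x in \<open>auto simp: h'_def\<close>)
    moreover have "e x = 0" unfolding e_def
      by (intro cobd_vanish) (use deg x False f in \<open>force simp: generates_def\<close>)
    ultimately show ?thesis by simp
  qed
  define f' where "f' = (\<lambda>x. f x + h' x)"
  have h'cut: "cut_to (I - J) h' = h'" by (auto simp: h'_def)
  have dh': "cobd F I h' x = (if x \<in> J then 0 else cobd F (I - J) h' x)" if "x \<in> I" for x
    using cobd_extend_quotient[OF I J that, of h'] unfolding h'cut .
  have coc: "cocycle F I f'"
    unfolding cocycle_def f'_def cobd_add using dh' h' e0 by (auto simp: e_def)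
  have fJ: "f' x = f x" if "x \<in> J" for x using that by (simp add: f'_def h'_def)
  have "\<not> coboundary F I f'"
  proof
    assume "coboundary F I f'"
    then obtain g where "\<And>x. x \<in> I \<Longrightarrow> f' x = cobd F I g x" by (auto simp: coboundary_def)
    then have "\<And>x. x \<in> J \<Longrightarrow> f x = cobd F J g x"
      using fJ cobd_closed[OF J, of _ g] J by (fastforce simp: closed_in_def)
    then show False using f by (auto simp: generates_def coboundary_def)
  qed
  moreover have "\<exists>c. coboundary F I (\<lambda>x. g x + c * f' x)" if g: "cocycle F I g" for g
  proof -
    obtain c where "coboundary F J (\<lambda>x. g x + c * f x)"
      using f cocycle_closed[OF J g] by (auto simp: generates_def)
    then have "coboundary F J (\<lambda>x. g x + c * f' x)" using fJ by (simp add: coboundary_def)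
    moreover have "cocycle F I (\<lambda>x. g x + c * f' x)" by (intro cocycle_add g cocycle_mult coc)
    ultimately obtain k where k: "\<And>x. x \<in> J \<Longrightarrow> g x + c * f' x + cobd F I k x = 0"
      "cocycle F (I - J) (\<lambda>x. g x + c * f' x + cobd F I k x)"
      using clear_subcomplex[OF I J, of "\<lambda>x. g x + c * f' x"] by metis
    then obtain m where m: "\<And>x. x \<in> I - J \<Longrightarrow> g x + c * f' x + cobd F I k x = cobd F (I - J) m x"
      using assms(3) by (auto simp: exact_def coboundary_def)
    have "g x + c * f' x = cobd F I (\<lambda>x. k x + cut_to (I - J) m x) x" if "x \<in> I" for x
      using k(1)[of x] m[of x] that
        cobd_extend_quotient[OF I J that, of m]
      by (cases "x \<in> J") (simp_all add: cobd_add bit_add_eq_iff)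
    then show ?thesis unfolding coboundary_def by blast
  qed
  ultimately have "generates F deg I n f'"
    using f coc J by (auto simp: generates_def f'_def h'_def closed_in_def split: if_splits)
  then show ?thesis by blast
qed

subsection \<open>Isomorphic complexes\<close>

definition face_iso :: "('i \<Rightarrow> 'i set) \<Rightarrow> 'i set \<Rightarrow> ('j \<Rightarrow> 'j set) \<Rightarrow> 'j set \<Rightarrow> ('i \<Rightarrow> 'j) \<Rightarrow> bool"
  where "face_iso F I G J h \<longleftrightarrow>
    bij_betw h I J \<and> (\<forall>x\<in>I. G (h x) \<inter> J = h ` (F x \<inter> I))"

lemma cobd_iso:
  assumes "face_iso F I G J h" "x \<in> I"
  shows "cobd G J f (h x) = cobd F I (f \<circ> h) x"
proof -
  have "inj_on h (F x \<inter> I)" using assms by (auto simp: face_iso_def bij_betw_def inj_on_def)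
  then show ?thesis using assms by (simp add: cobd_def face_iso_def sum.reindex o_def)
qed

lemma cocycle_iso:
  assumes "face_iso F I G J h"
  shows "cocycle G J f \<longleftrightarrow> cocycle F I (f \<circ> h)"
proof -
  have J: "J = h ` I" using assms by (auto simp: face_iso_def bij_betw_def)
  show ?thesis using cobd_iso[OF assms] by (simp add: cocycle_def J)
qed

lemma coboundary_iso:
  assumes iso: "face_iso F I G J h"
  shows "coboundary G J f \<longleftrightarrow> coboundary F I (f \<circ> h)"
proof
  have J: "J = h ` I" using assms by (auto simp: face_iso_def bij_betw_def)
  show "coboundary G J f \<Longrightarrow> coboundary F I (f \<circ> h)"
    unfolding coboundary_def using cobd_iso[OF iso] by (force simp: J)
  assume "coboundary F I (f \<circ> h)"
  then obtain g where g: "\<And>x. x \<in> I \<Longrightarrow> f (h x) = cobd F I g x" by (auto simp: coboundary_def)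
  define g' where "g' = g \<circ> inv_into I h"
  have g': "g' (h x) = g x" if "x \<in> I" for x
    using that iso by (auto simp: g'_def face_iso_def bij_betw_def)
  have "cobd G J g' (h x) = cobd F I g x" if "x \<in> I" for x
    unfolding cobd_iso[OF iso that] by (rule cobd_cong) (simp add: g')
  then show "coboundary G J f" unfolding coboundary_def using g by (auto simp: J intro!: exI[of _ g'])
qed

lemma exact_iso: "face_iso F I G J h \<Longrightarrow> exact F I \<Longrightarrow> exact G J"
  unfolding exact_def using cocycle_iso coboundary_iso by metis

lemma generates_iso:
  assumes iso: "face_iso F I G J h" and f: "generates F deg I n f"
    and deg: "\<And>x. x \<in> I \<Longrightarrow> deg x = n \<Longrightarrow> deg' (h x) = n'"
    and f': "\<And>x. x \<in> I \<Longrightarrow> f' (h x) = f x" "\<And>y. y \<notin> J \<Longrightarrow> f' y = 0"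
  shows "generates G deg' J n' f'"
proof -
  have J: "J = h ` I" using assms by (auto simp: face_iso_def bij_betw_def)
  have eqc: "cocycle F I (f' \<circ> h) \<longleftrightarrow> cocycle F I f"
    unfolding cocycle_def using f'(1) by (auto simp: cobd_def)
  have eqb: "coboundary F I (f' \<circ> h) \<longleftrightarrow> coboundary F I f"
    unfolding coboundary_def using f'(1) by (auto simp: cobd_def)
  have eqs: "coboundary F I ((\<lambda>y. g y + c * f' y) \<circ> h) \<longleftrightarrow> coboundary F I (\<lambda>x. (g \<circ> h) x + c * f x)" for g c
    unfolding coboundary_def using f'(1) by (auto simp: cobd_def)
  have "\<exists>c. coboundary G J (\<lambda>y. g y + c * f' y)" if "cocycle G J g" for g
  proof -
    from f have "\<forall>g. cocycle F I g \<longrightarrow> (\<exists>c. coboundary F I (\<lambda>x. g x + c * f x))"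
      by (simp add: generates_def)
    then show ?thesis using that unfolding cocycle_iso[OF iso] coboundary_iso[OF iso] eqs by blast
  qed
  moreover have "y \<in> J \<and> deg' y = n'" if "f' y \<noteq> 0" for y
  proof -
    have "y \<in> J" by (rule ccontr) (use that f'(2) in simp)
    then obtain x where "x \<in> I" "y = h x" using J by auto
    then show ?thesis using that f' f deg \<open>y \<in> J\<close> by (auto simp: generates_def)
  qed
  ultimately show ?thesis
    using f eqc eqb by (auto simp: generates_def cocycle_iso[OF iso] coboundary_iso[OF iso])
qed

subsection \<open>Tensor products\<close>

text \<open>The boundary of a tensor product of complexes, without signs modulo two.\<close>

definition prod_faces :: "('a \<Rightarrow> 'a set) \<Rightarrow> ('b \<Rightarrow> 'b set) \<Rightarrow> 'a \<times> 'b \<Rightarrow> ('a \<times> 'b) set"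
  where "prod_faces F G = (\<lambda>(x, y). F x \<times> {y} \<union> {x} \<times> G y)"

lemma cobd_prod:
  assumes "x \<in> I" "y \<in> L" "x \<notin> F x" "finite (F x)" "finite (G y)"
  shows "cobd (prod_faces F G) (I \<times> L) f (x, y) =
    cobd F I (\<lambda>x'. f (x', y)) x + cobd G L (\<lambda>y'. f (x, y')) y"
proof -
  have "prod_faces F G (x, y) \<inter> I \<times> L = (\<lambda>x'. (x', y)) ` (F x \<inter> I) \<union> Pair x ` (G y \<inter> L)"
    using assms by (auto simp: prod_faces_def)
  moreover have "(\<lambda>x'. (x', y)) ` (F x \<inter> I) \<inter> Pair x ` (G y \<inter> L) = {}" using assms by auto
  ultimately show ?thesis
    using assms by (simp add: cobd_def sum.union_disjoint sum.reindex inj_on_def)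
qed

lemma is_complex_prod:
  assumes I: "is_complex F I" and L: "is_complex G L" and irr: "\<And>x. x \<in> I \<Longrightarrow> x \<notin> F x"
  shows "is_complex (prod_faces F G) (I \<times> L)"
  unfolding is_complex_def
proof (intro conjI allI ballI)
  fix z assume "z \<in> I \<times> L"
  then show "finite (prod_faces F G z)"
    using assms by (auto simp: prod_faces_def is_complex_def)
next
  fix f z assume "z \<in> I \<times> L"
  then obtain x y where z: "z = (x, y)" "x \<in> I" "y \<in> L" by auto
  have d: "cobd (prod_faces F G) (I \<times> L) f (x, y) =
      cobd F I (\<lambda>x'. f (x', y)) x + cobd G L (\<lambda>y'. f (x, y')) y" if "x \<in> I" "y \<in> L" for f x y
    using that irr finite_faces[OF I] finite_faces[OF L] by (intro cobd_prod) auto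
  have "cobd (prod_faces F G) (I \<times> L) (cobd (prod_faces F G) (I \<times> L) f) (x, y) =
    cobd F I (\<lambda>x'. cobd F I (\<lambda>x''. f (x'', y)) x' + cobd G L (\<lambda>y'. f (x', y')) y) x
    + cobd G L (\<lambda>y'. cobd F I (\<lambda>x'. f (x', y')) x + cobd G L (\<lambda>y''. f (x, y'')) y') y"
    unfolding d[OF z(2,3)]
    by (intro arg_cong2[where f = "(+)"] cobd_cong) (use z in \<open>auto simp: d\<close>)
  also have "\<dots> = cobd F I (\<lambda>x'. cobd G L (\<lambda>y'. f (x', y')) y) x
     + cobd G L (\<lambda>y'. cobd F I (\<lambda>x'. f (x', y')) x) y"
    using z by (simp add: cobd_add cobd_cobd[OF I] cobd_cobd[OF L])
  also have "cobd F I (\<lambda>x'. cobd G L (\<lambda>y'. f (x', y')) y) x = cobd G L (\<lambda>y'. cobd F I (\<lambda>x'. f (x', y')) x) y"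
    unfolding cobd_def by (rule sum.swap)
  finally show "cobd (prod_faces F G) (I \<times> L) (cobd (prod_faces F G) (I \<times> L) f) z = 0"
    using z by simp
qed

text \<open>The pieces of the filtration by the first factor are copies of \<open>L\<close>.\<close>

lemma exact_prod_right:
  assumes I: "is_complex F I" "finite I" and L: "is_complex G L" "finite L" "exact G L"
    and deg: "\<And>x y. x \<in> I \<Longrightarrow> y \<in> F x \<Longrightarrow> deg x = Suc (deg y)"
  shows "exact (prod_faces F G) (I \<times> L)"
proof (rule exact_filtration[where p = fst and r = "\<lambda>x. int (deg x)"])
  show "is_complex (prod_faces F G) (I \<times> L)"
    using deg by (intro is_complex_prod I L) force
  fix x
  show "exact (prod_faces F G) {z \<in> I \<times> L. fst z = x}"
  proof (cases "x \<in> I")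
    case True
    have "x \<notin> F x" using deg[OF True, of x] by auto
    then have "face_iso G L (prod_faces F G) {z \<in> I \<times> L. fst z = x} (Pair x)"
      using True by (auto simp: face_iso_def bij_betw_def inj_on_def prod_faces_def)
    then show ?thesis using L(3) exact_iso by blast
  next
    case False
    then have "{z \<in> I \<times> L. fst z = x} = {}" by auto
    then show ?thesis by (metis exact_empty)
  qed
qed (use I L deg in \<open>auto simp: prod_faces_def\<close>)

lemma exact_prod_left:
  assumes I: "is_complex F I" "finite I" "exact F I" and L: "is_complex G L" "finite L"
    and deg: "\<And>x y. x \<in> L \<Longrightarrow> y \<in> G x \<Longrightarrow> deg x = Suc (deg y)"
  shows "exact (prod_faces F G) (I \<times> L)"
proof -
  have "exact (prod_faces G F) (L \<times> I)"
    using exact_prod_right[OF L I] deg by blast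
  moreover have "face_iso (prod_faces G F) (L \<times> I) (prod_faces F G) (I \<times> L) prod.swap"
    by (force simp: face_iso_def bij_betw_def prod_faces_def image_def)
  ultimately show ?thesis using exact_iso by blast
qed

text \<open>
  The mapping cone of a cocycle \<open>f\<close>: there is one more basis element \<open>None\<close>,
  which occurs in the boundary of \<open>x\<close> with coefficient \<open>f x\<close>. The cone is
  exact if \<open>f\<close> generates the cohomology. In this form a tensor product with a complex of
  one-dimensional cohomology becomes a case of a tensor product with an exact complex.
\<close>

definition star_faces :: "('i \<Rightarrow> 'i set) \<Rightarrow> ('i \<Rightarrow> bit) \<Rightarrow> 'i option \<Rightarrow> 'i option set"
  where "star_faces F f z =
    (case z of None \<Rightarrow> {} | Some x \<Rightarrow> Some ` F x \<union> (if f x = 0 then {} else {None}))"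

lemma cobd_star_None: "cobd (star_faces F f) S g None = 0"
  by (simp add: cobd_def star_faces_def)

lemma cobd_star_Some:
  assumes "finite (F x)"
  shows "cobd (star_faces F f) (insert None (Some ` L)) g (Some x) =
    cobd F L (g \<circ> Some) x + f x * g None"
proof -
  have "star_faces F f (Some x) \<inter> insert None (Some ` L) =
      Some ` (F x \<inter> L) \<union> (if f x = 0 then {} else {None})"
    by (auto simp: star_faces_def)
  then show ?thesis using assms
    by (cases "f x") (simp_all add: cobd_def sum.reindex o_def add.commute)
qed

lemma is_complex_star:
  assumes L: "is_complex F L" and f: "cocycle F L f"
  shows "is_complex (star_faces F f) (insert None (Some ` L))"
  unfolding is_complex_def
proof (intro conjI ballI allI)
  fix z assume "z \<in> insert None (Some ` L)"
  then show "finite (star_faces F f z)"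
    using L by (auto simp: star_faces_def is_complex_def split: option.splits)
next
  fix g z assume z: "z \<in> insert None (Some ` L)"
  let ?D = "cobd (star_faces F f) (insert None (Some ` L))"
  show "?D (?D g) z = 0"
  proof (cases z)
    case (Some x)
    with z have x: "x \<in> L" by auto
    have "cobd F L (?D g \<circ> Some) x = cobd F L (\<lambda>y. cobd F L (g \<circ> Some) y + g None * f y) x"
      by (rule cobd_cong) (use finite_faces[OF L] in \<open>auto simp: cobd_star_Some mult.commute\<close>)
    then show ?thesis
      using Some x finite_faces[OF L x] f
      by (simp add: cobd_star_Some cobd_star_None cobd_add cobd_mult cobd_cobd[OF L] cocycle_def)
  qed (simp add: cobd_star_None)
qed

lemma exact_star:
  assumes L: "is_complex F L" and f: "generates F deg L n f"
  shows "exact (star_faces F f) (insert None (Some ` L))"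
  unfolding exact_def
proof (intro allI impI)
  fix g assume g: "cocycle (star_faces F f) (insert None (Some ` L)) g"
  have *: "cobd F L (g \<circ> Some) x = f x * g None" if "x \<in> L" for x
  proof -
    have "cobd F L (g \<circ> Some) x + f x * g None = 0"
      using g that cobd_star_Some[where F = F, OF finite_faces[OF L that], of f L g] by (simp add: cocycle_def)
    then show ?thesis by (simp add: bit_add_eq_iff)
  qed
  have g0: "g None = 0"
  proof (rule ccontr)
    assume "g None \<noteq> 0"
    then have "\<And>x. x \<in> L \<Longrightarrow> f x = cobd F L (g \<circ> Some) x" using * by simp
    then show False using f by (auto simp: generates_def coboundary_def)
  qed
  then have "cocycle F L (g \<circ> Some)" using * by (simp add: cocycle_def)
  then obtain c h where h: "\<And>x. x \<in> L \<Longrightarrow> g (Some x) + c * f x = cobd F L h x"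
    using generates_spans[OF f, of "g \<circ> Some"] by (metis comp_apply)
  have "g z = cobd (star_faces F f) (insert None (Some ` L)) (case_option c h) z"
    if "z \<in> insert None (Some ` L)" for z
  proof (cases z)
    case (Some x)
    with that have x: "x \<in> L" by auto
    have "cobd F L (case_option c h \<circ> Some) x = cobd F L h x" by (simp add: o_def)
    then show ?thesis
      using Some h[OF x] finite_faces[OF L x] by (simp add: cobd_star_Some bit_add_eq_iff ac_simps)
  qed (simp add: g0 cobd_star_None)
  then show "coboundary (star_faces F f) (insert None (Some ` L)) g"
    unfolding coboundary_def by blast
qed

text \<open>
  The tensor product of \<open>I\<close> with the cone of \<open>g\<close> is exact. A cochain of it
  consists of a cochain \<open>h\<close> of \<open>I \<times> L\<close> and a cochain of
  \<open>I\<close>, its component at \<open>None\<close>. If \<open>h\<close> has coboundary \<open>f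
  \<otimes> g\<close>, then \<open>h\<close> together with \<open>f\<close> is a cocycle, and a
  cochain bounding it exhibits \<open>f\<close> as a coboundary. If \<open>h\<close> is a cocycle,
  then so is \<open>h\<close> together with \<open>0\<close>; the component at \<open>None\<close> of
  a cochain that bounds it is a cocycle of \<open>I\<close>, hence cohomologous to a multiple of
  \<open>f\<close>, and \<open>h\<close> is cohomologous to the same multiple of \<open>f \<otimes>
  g\<close>.
\<close>

lemma generates_prod:
  assumes I: "is_complex F I" "finite I" and L: "is_complex G L" "finite L"
    and f: "generates F deg I n f" and g: "generates G deg' L m g"
    and deg: "\<And>x y. x \<in> I \<Longrightarrow> y \<in> F x \<Longrightarrow> deg x = Suc (deg y)"
  shows "generates (prod_faces F G) (\<lambda>(x, y). deg x + deg' y) (I \<times> L) (n + m) (\<lambda>(x, y). f x * g y)"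
proof -
  let ?S = "insert None (Some ` L)"
  let ?G = "star_faces G g"
  let ?P = "prod_faces F ?G"
  let ?D = "cobd (prod_faces F G) (I \<times> L)"
  have irr: "x \<notin> F x" if "x \<in> I" for x using deg[OF that] by force
  have gc: "cocycle G L g" using g by (simp add: generates_def)
  have fc: "cocycle F I f" using f by (simp add: generates_def)
  have S: "is_complex ?G ?S" by (rule is_complex_star[OF L(1) gc])
  have ex: "exact ?P (I \<times> ?S)"
    using exact_prod_right[where deg = deg, OF I S _ exact_star[OF L(1) g] deg] L(2) by blast
  have d: "?D f (x, y) =
      cobd F I (\<lambda>x'. f (x', y)) x + cobd G L (\<lambda>y'. f (x, y')) y" if "x \<in> I" "y \<in> L" for f x y
    using that irr finite_faces[OF I(1)] finite_faces[OF L(1)] by (intro cobd_prod) auto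
  have dS: "cobd ?P (I \<times> ?S) h (x, Some y) =
      ?D (\<lambda>(x, y). h (x, Some y)) (x, y) + g y * h (x, None)"
    if "x \<in> I" "y \<in> L" for x y h
  proof -
    have "cobd ?P (I \<times> ?S) h (x, Some y) =
      cobd F I (\<lambda>x'. h (x', Some y)) x + cobd ?G ?S (\<lambda>y'. h (x, y')) (Some y)"
      using that irr finite_faces[OF I(1)] finite_faces[OF S] by (intro cobd_prod) auto
    then show ?thesis using that d[of x y "\<lambda>(x, y). h (x, Some y)"] finite_faces[OF L(1)]
      by (simp add: cobd_star_Some o_def add.assoc)
  qed
  have dN: "cobd ?P (I \<times> ?S) h (x, None) = cobd F I (\<lambda>x'. h (x', None)) x" if "x \<in> I" for x h
  proof -
    have "cobd ?P (I \<times> ?S) h (x, None) =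
      cobd F I (\<lambda>x'. h (x', None)) x + cobd ?G ?S (\<lambda>y'. h (x, y')) None"
      using that irr finite_faces[OF I(1)] finite_faces[OF S] by (intro cobd_prod) auto
    then show ?thesis by (simp add: cobd_star_None)
  qed
  let ?fg = "\<lambda>(x, y). f x * g y"
  have coc: "cocycle (prod_faces F G) (I \<times> L) ?fg"
    unfolding cocycle_def
  proof clarify
    fix x y assume xy: "x \<in> I" "y \<in> L"
    have "cobd F I (\<lambda>x'. g y * f x') x = 0" "cobd G L (\<lambda>y'. f x * g y') y = 0"
      unfolding cobd_mult using xy fc gc by (auto simp: cocycle_def)
    then show "?D ?fg (x, y) = 0" using d[OF xy, of ?fg] xy by (simp add: mult.commute)
  qed
  have "\<not> coboundary (prod_faces F G) (I \<times> L) ?fg"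
  proof
    assume "coboundary (prod_faces F G) (I \<times> L) ?fg"
    then obtain h where h: "\<And>x y. x \<in> I \<Longrightarrow> y \<in> L \<Longrightarrow> f x * g y = ?D h (x, y)"
      unfolding coboundary_def by (metis (mono_tags, lifting) SigmaI case_prod_conv)
    define k where "k = (\<lambda>(x, z). case z of None \<Rightarrow> f x | Some y \<Rightarrow> h (x, y))"
    have kS: "(\<lambda>(x, y). k (x, Some y)) = h" by (auto simp: k_def)
    have kN: "(\<lambda>x. k (x, None)) = f" by (auto simp: k_def)
    have "cocycle ?P (I \<times> ?S) k"
      unfolding cocycle_def
    proof clarify
      fix x z assume "x \<in> I" "z \<in> ?S"
      then show "cobd ?P (I \<times> ?S) k (x, z) = 0"
        using fc by (auto simp: dN kN cocycle_def dS kS simp flip: h) (auto simp: k_def mult.commute)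
    qed
    then obtain l where l: "\<And>z. z \<in> I \<times> ?S \<Longrightarrow> k z = cobd ?P (I \<times> ?S) l z"
      using ex unfolding exact_def coboundary_def by blast
    have "f x = cobd F I (\<lambda>x'. l (x', None)) x" if "x \<in> I" for x
      using l[of "(x, None)"] dN[OF that, of l] that by (simp add: k_def)
    then show False using f by (auto simp: generates_def coboundary_def)
  qed
  moreover have "\<exists>c. coboundary (prod_faces F G) (I \<times> L) (\<lambda>z. h z + c * ?fg z)"
    if h: "cocycle (prod_faces F G) (I \<times> L) h" for h
  proof -
    define k where "k = (\<lambda>(x, z). case z of None \<Rightarrow> 0 | Some y \<Rightarrow> h (x, y))"
    have kS: "(\<lambda>(x, y). k (x, Some y)) = h" by (auto simp: k_def)
    have kN: "(\<lambda>x. k (x, None)) = (\<lambda>x. 0)" by (auto simp: k_def)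
    have "cocycle ?P (I \<times> ?S) k"
      unfolding cocycle_def
    proof clarify
      fix x z assume "x \<in> I" "z \<in> ?S"
      then show "cobd ?P (I \<times> ?S) k (x, z) = 0"
        using h by (auto simp: dN kN cocycle_def dS kS cobd_def[of F]) (auto simp: k_def)
    qed
    then obtain l where l: "\<And>z. z \<in> I \<times> ?S \<Longrightarrow> k z = cobd ?P (I \<times> ?S) l z"
      using ex unfolding exact_def coboundary_def by blast
    have "cobd F I (\<lambda>x'. l (x', None)) x = 0" if "x \<in> I" for x
      using l[of "(x, None)"] dN[OF that, of l] that by (simp add: k_def)
    then have "cocycle F I (\<lambda>x'. l (x', None))" by (simp add: cocycle_def)
    then obtain c t where t: "\<And>x. x \<in> I \<Longrightarrow> l (x, None) + c * f x = cobd F I t x"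
      using generates_spans[OF f, of "\<lambda>x. l (x, None)"] by metis
    have "h (x, y) + c * (f x * g y) =
        ?D (\<lambda>z. (\<lambda>(x, y). l (x, Some y)) z + (\<lambda>(x, y). t x * g y) z) (x, y)"
      if xy: "x \<in> I" "y \<in> L" for x y
    proof -
      have 1: "h (x, y) = ?D (\<lambda>(x, y). l (x, Some y)) (x, y) + g y * l (x, None)"
        using l[of "(x, Some y)"] dS[OF xy, of l] xy by (simp add: k_def)
      have "?D (\<lambda>(x, y). t x * g y) (x, y) = cobd F I (\<lambda>x'. g y * t x') x + cobd G L (\<lambda>y'. t x * g y') y"
        using d[OF xy, of "\<lambda>(x, y). t x * g y"] xy by (simp add: mult.commute)
      also have "\<dots> = g y * (l (x, None) + c * f x)"
        unfolding cobd_mult using xy gc t by (simp add: cocycle_def)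
      finally show ?thesis unfolding cobd_add using 1 by (simp add: algebra_simps)
    qed
    then have "coboundary (prod_faces F G) (I \<times> L) (\<lambda>z. h z + c * ?fg z)"
      unfolding coboundary_def by (intro exI) auto
    then show ?thesis by blast
  qed
  ultimately show ?thesis
    using coc generates_supp[OF f] generates_supp[OF g] unfolding generates_def
    by (auto split: prod.split)
qed

section \<open>Linear functionals\<close>

lemma scaleR_fun_apply [simp]: "(c *\<^sub>R f) x = c *\<^sub>R f x"
  by (simp add: scaleR_fun_def)

lemma span_apply_eq:
  fixes B :: "('v \<Rightarrow> real) set"
  assumes "\<psi> \<in> span B" "\<And>b. b \<in> B \<Longrightarrow> b v = c * b w"
  shows "\<psi> v = c * \<psi> w"
  using assms(1)
proof (induction rule: span_induct_alt)
  case (step a x y)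
  then show ?case using assms(2) by (simp add: algebra_simps)
qed simp

lemma span_apply_zero:
  fixes B :: "('v \<Rightarrow> real) set"
  assumes "\<psi> \<in> span B" "\<And>b. b \<in> B \<Longrightarrow> b v = 0"
  shows "\<psi> v = 0"
  using span_apply_eq[OF assms(1), of v 0 v] assms(2) by simp

text \<open>
  If \<open>\<psi>\<close> does not vanish on the common kernel of \<open>B\<close>, it takes a
  nonzero value at some \<open>h\<close> in it. Then also \<open>b h \<noteq> 0\<close>, and a
  multiple of \<open>b\<close> corrects \<open>\<psi>\<close>.
\<close>

lemma in_span_if_annihilates:
  fixes \<psi> :: "'v::real_vector \<Rightarrow> real"
  assumes "finite B" "\<And>b. b \<in> B \<Longrightarrow> linear b" "linear \<psi>"
    "\<And>x. (\<And>b. b \<in> B \<Longrightarrow> b x = 0) \<Longrightarrow> \<psi> x = 0"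
  shows "\<psi> \<in> span B"
  using assms
proof (induction B arbitrary: \<psi> rule: finite_induct)
  case empty
  then have "\<psi> = (\<lambda>x. 0)" by auto
  then show ?case by (simp add: zero_fun_def)
next
  case (insert b B)
  show ?case
  proof (cases "\<forall>x. (\<forall>b\<in>B. b x = 0) \<longrightarrow> \<psi> x = 0")
    case True
    then have "\<psi> \<in> span B" using insert by auto
    then show ?thesis using span_mono[of B "insert b B"] by auto
  next
    case False
    then obtain h where h: "\<forall>b\<in>B. b h = 0" "\<psi> h \<noteq> 0" by auto
    then have bh: "b h \<noteq> 0" using insert.prems(3)[of h] by auto
    have lb: "linear b" using insert.prems by auto
    define c where "c = \<psi> h / b h"
    have lin: "linear (\<psi> - c *\<^sub>R b)"
      using linear_compose_sub[OF insert.prems(2) linear_compose_scale_right[OF lb, of c]]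
      by (simp add: fun_diff_def scaleR_fun_def)
    have "\<psi> - c *\<^sub>R b \<in> span B"
    proof (rule insert.IH[OF _ lin])
      fix x assume x: "\<And>b. b \<in> B \<Longrightarrow> b x = 0"
      define y where "y = x - (b x / b h) *\<^sub>R h"
      have "b' y = 0" if "b' \<in> insert b B" for b'
      proof -
        have "linear b'" using insert.prems that by auto
        then have "b' y = b' x - (b x / b h) * b' h"
          by (simp add: y_def linear_diff linear_scale)
        then show ?thesis using that x h bh by auto
      qed
      then have "\<psi> y = 0" using insert.prems(3) by blast
      moreover have "\<psi> y = \<psi> x - (b x / b h) * \<psi> h"
        using insert.prems(2) by (simp add: y_def linear_diff linear_scale)
      ultimately show "(\<psi> - c *\<^sub>R b) x = 0" by (simp add: c_def)
    qed (use insert in auto)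
    then have "\<psi> - c *\<^sub>R b \<in> span (insert b B)" "c *\<^sub>R b \<in> span (insert b B)"
      using span_mono[of B "insert b B"] by (auto intro: span_scale span_base)
    then have "(\<psi> - c *\<^sub>R b) + c *\<^sub>R b \<in> span (insert b B)" by (rule span_add)
    then show ?thesis by simp
  qed
qed

text \<open>
  A functional that is independent of the others is nonzero somewhere on their common kernel, along
  which its value can be adjusted.
\<close>

lemma independent_prescribed_values:
  fixes B :: "('v::real_vector \<Rightarrow> real) set"
  assumes "finite B" "independent B" "\<And>b. b \<in> B \<Longrightarrow> linear b"
  shows "\<exists>v. \<forall>b\<in>B. b v = c b"
  using assms
proof (induction B rule: finite_induct)
  case (insert b B)
  have ind: "independent B" "b \<notin> span B" using insert by (auto simp: independent_insert)
  then obtain v where v: "\<forall>b\<in>B. b v = c b" using insert by auto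
  obtain h where h: "\<And>b. b \<in> B \<Longrightarrow> b h = 0" "b h \<noteq> 0"
    using in_span_if_annihilates[of B b] insert ind by blast
  have "b' (v + ((c b - b v) / b h) *\<^sub>R h) = c b'" if "b' \<in> insert b B" for b'
  proof -
    have "linear b'" using insert.prems that by auto
    then have "b' (v + ((c b - b v) / b h) *\<^sub>R h) = b' v + ((c b - b v) / b h) * b' h"
      by (simp add: linear_add linear_scale)
    then show ?thesis using that v h by auto
  qed
  then show ?case by blast
qed simp

lemma dim_insert_finite:
  fixes S :: "'w::real_vector set"
  assumes "finite S" "x \<notin> span S"
  shows "dim (insert x S) = Suc (dim S)"
proof -
  obtain B where B: "B \<subseteq> S" "independent B" "S \<subseteq> span B" "card B = dim S"
    using real_vector.basis_exists[of S] by metis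
  have sp: "span B = span S" using B by (simp add: real_vector.span_eq real_vector.span_superset subset_trans)
  have "x \<notin> B" using assms B by (auto intro: span_base)
  have "finite B" using B assms finite_subset by auto
  show ?thesis
  proof (rule real_vector.dim_unique[of "insert x B"])
    show "insert x S \<subseteq> span (insert x B)"
      using B(3) span_mono[of B "insert x B"] by (auto intro: span_base)
    show "independent (insert x B)" using B assms sp by (simp add: independent_insert)
  qed (use B \<open>x \<notin> B\<close> \<open>finite B\<close> in auto)
qed

lemma dim_mono_finite:
  fixes S :: "'w::real_vector set"
  assumes "S \<subseteq> span S'" "finite S'"
  shows "dim S \<le> dim S'"
proof -
  obtain B where B: "B \<subseteq> S'" "independent B" "S' \<subseteq> span B" "card B = dim S'"
    using real_vector.basis_exists[of S'] by metis
  have "span S' = span B"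
    using B by (simp add: real_vector.span_eq real_vector.span_superset subset_trans)
  then show ?thesis
    using real_vector.dim_le_card[of S B] B assms finite_subset[OF B(1)] by auto
qed

text \<open>
  Bases \<open>P\<close> and \<open>Q\<close> of \<open>X\<close> and \<open>Y\<close> that extend a
  common basis \<open>R\<close> of \<open>Z\<close>. Counting \<open>P \<union> Q\<close> and \<open>P
  \<inter> Q\<close> gives submodularity of the dimension together with its equality case.
\<close>

lemma union_basis:
  fixes X Y Z :: "'w::real_vector set"
  assumes "finite X" "finite Y" "Z \<subseteq> X \<inter> Y"
  obtains P Q R where "R \<subseteq> P" "R \<subseteq> Q" "P \<subseteq> X" "Q \<subseteq> Y" "R \<subseteq> Z" "finite (P \<union> Q)"
    "Z \<subseteq> span R" "X \<subseteq> span P" "Y \<subseteq> span Q" "independent P" "independent Q"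
    "card R = dim Z" "card P = dim X" "card Q = dim Y" "dim (X \<union> Y) \<le> card (P \<union> Q)"
    "card (P \<union> Q) + card (P \<inter> Q) = dim X + dim Y" "card R \<le> card (P \<inter> Q)"
proof -
  obtain R where R: "R \<subseteq> Z" "independent R" "Z \<subseteq> span R" "card R = dim Z"
    using real_vector.basis_exists[of Z] by metis
  obtain P where P: "R \<subseteq> P" "P \<subseteq> X" "independent P" "X \<subseteq> span P"
    using real_vector.maximal_independent_subset_extend[of R X] R(1,2) assms(3) by blast
  obtain Q where Q: "R \<subseteq> Q" "Q \<subseteq> Y" "independent Q" "Y \<subseteq> span Q"
    using real_vector.maximal_independent_subset_extend[of R Y] R(1,2) assms(3) by blast
  have fin: "finite P" "finite Q" using P Q assms finite_subset by auto
  have "X \<union> Y \<subseteq> span (P \<union> Q)"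
    using P(4) Q(4) span_mono[of P "P \<union> Q"] span_mono[of Q "P \<union> Q"] by auto
  then have 1: "dim (X \<union> Y) \<le> card (P \<union> Q)"
    using fin by (intro real_vector.dim_le_card) auto
  have c: "card P = dim X" "card Q = dim Y"
    using real_vector.basis_card_eq_dim[OF P(2,4,3)] real_vector.basis_card_eq_dim[OF Q(2,4,3)] by auto
  show ?thesis
    using that[of R P Q] R P Q fin 1 c card_Un_Int[OF fin] card_mono[of "P \<inter> Q" R] by auto
qed

lemma dim_submodular:
  fixes X Y :: "'w::real_vector set"
  assumes "finite X" "finite Y" "Z \<subseteq> X \<inter> Y"
  shows "dim (X \<union> Y) + dim Z \<le> dim X + dim Y"
  by (rule union_basis[OF assms]) linarith

text \<open>
  In the equality case of submodularity the union of the bases of \<open>X\<close> and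
  \<open>Y\<close> is independent, so that values on the two parts can be prescribed separately as
  long as they agree on \<open>Z\<close>.
\<close>

lemma modular_pair_patch:
  fixes X Y Z :: "('v::real_vector \<Rightarrow> real) set"
  assumes fin: "finite X" "finite Y" and Z: "Z \<subseteq> X \<inter> Y"
    and lin: "\<And>f. f \<in> X \<union> Y \<Longrightarrow> linear f"
    and eq: "dim (X \<union> Y) + dim Z = dim X + dim Y"
    and y: "\<And>f. f \<in> Z \<Longrightarrow> f y = 0"
  obtains v where "\<And>f. f \<in> X \<Longrightarrow> f v = 0" "\<And>f. f \<in> Y \<Longrightarrow> f v = - f y"
proof -
  obtain P Q R where PQ: "R \<subseteq> P" "R \<subseteq> Q" "P \<subseteq> X" "Q \<subseteq> Y" "R \<subseteq> Z" "finite (P \<union> Q)"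
    "X \<subseteq> span P" "Y \<subseteq> span Q"
    "card R = dim Z" "dim (X \<union> Y) \<le> card (P \<union> Q)"
    "card (P \<union> Q) + card (P \<inter> Q) = dim X + dim Y" "card R \<le> card (P \<inter> Q)"
    by (rule union_basis[OF fin Z])
  have card: "card (P \<union> Q) = dim (X \<union> Y)" "card (P \<inter> Q) = card R"
    using PQ eq by linarith+
  then have R: "P \<inter> Q = R"
    using PQ card_subset_eq[of "P \<inter> Q" R] by auto
  have sp: "X \<union> Y \<subseteq> span (P \<union> Q)"
    using PQ(7,8) span_mono[of P "P \<union> Q"] span_mono[of Q "P \<union> Q"] by auto
  obtain B where B: "B \<subseteq> P \<union> Q" "independent B" "P \<union> Q \<subseteq> span B" "card B = dim (P \<union> Q)"
    using real_vector.basis_exists[of "P \<union> Q"] by metis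
  have "dim (X \<union> Y) \<le> dim (P \<union> Q)" using sp PQ by (intro dim_mono_finite) auto
  then have "card (P \<union> Q) \<le> card B" using B card by simp
  then have "B = P \<union> Q" using B PQ card_seteq[of "P \<union> Q" B] by auto
  then have ind: "independent (P \<union> Q)" using B by simp
  obtain v where v: "\<And>b. b \<in> P \<union> Q \<Longrightarrow> b v = (if b \<in> P then 0 else - b y)"
    using independent_prescribed_values[OF PQ(6) ind, of "\<lambda>b. if b \<in> P then 0 else - b y"] lin PQ(3,4)
    by blast
  have vQ: "b v = - 1 * b y" if "b \<in> Q" for b
    using v[of b] that R PQ(5) y by (cases "b \<in> P") auto
  have "f v = 0" if "f \<in> X" for f
    using that PQ(7) by (intro span_apply_zero[of f P v]) (auto simp: v)
  moreover have "f v = - f y" if "f \<in> Y" for f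
    using span_apply_eq[of f Q v "- 1" y] that PQ(8) vQ by force
  ultimately show ?thesis using that by blast
qed

lemma dominate:
  fixes a b :: "'e \<Rightarrow> real"
  assumes "finite D" "\<And>e. e \<in> D \<Longrightarrow> a e > 0"
  shows "\<exists>M>0. \<forall>e\<in>D. M * a e + b e > 0"
  using assms
proof (induction D rule: finite_induct)
  case empty
  show ?case by (intro exI[of _ 1]) simp
next
  case (insert e D)
  then obtain M where M: "M > 0" "\<forall>e\<in>D. M * a e + b e > 0" by auto
  define M' where "M' = M + (\<bar>b e\<bar> + 1) / a e"
  have ae: "a e > 0" using insert by auto
  have "M' \<ge> M" using ae by (simp add: M'_def)
  have "M' * a e' + b e' > 0" if "e' \<in> D" for e'
  proof -
    have "M * a e' \<le> M' * a e'" using \<open>M' \<ge> M\<close> that insert by (intro mult_right_mono) (auto simp: less_imp_le)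
    then show ?thesis using M that by fastforce
  qed
  moreover have "M' * a e + b e > 0"
  proof -
    have "M' * a e = M * a e + \<bar>b e\<bar> + 1" using ae by (simp add: M'_def field_simps)
    moreover have "M * a e > 0" using M ae by simp
    ultimately show ?thesis by linarith
  qed
  ultimately show ?case using M \<open>M' \<ge> M\<close> by (intro exI[of _ M']) auto
qed

lemma first_zero:
  fixes a b :: "'e \<Rightarrow> real"
  assumes "finite N" "N \<noteq> {}" "\<And>e. e \<in> N \<Longrightarrow> a e > 0" "\<And>e. e \<in> N \<Longrightarrow> b e < 0"
  obtains t where "t > 0" "\<And>e. e \<in> N \<Longrightarrow> a e + t * b e \<ge> 0" "\<exists>e\<in>N. a e + t * b e = 0"
proof -
  define q where "q e = a e / (- b e)" for e
  define t where "t = Min (q ` N)"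
  have t_in: "t \<in> q ` N" unfolding t_def using assms by (intro Min_in) auto
  have t_le: "t \<le> q e" if "e \<in> N" for e unfolding t_def using assms that by auto
  have "q e > 0" if "e \<in> N" for e
    unfolding q_def using assms that by (intro divide_pos_pos) auto
  then have "t > 0" using t_in by auto
  moreover have "a e + t * b e \<ge> 0" if "e \<in> N" for e
  proof -
    have "- b e > 0" using assms that by simp
    then have "t * (- b e) \<le> a e" using t_le[OF that] unfolding q_def by (simp only: pos_le_divide_eq)
    then show ?thesis by simp
  qed
  moreover obtain e where e: "e \<in> N" "t = q e" using t_in by auto
  then have "a e + t * b e = 0" using assms(4)[of e] by (simp add: q_def)
  ultimately show ?thesis using that e by blast
qed

section \<open>Faces of topes\<close>

locale hyperplanes =
  fixes E :: "'e set" and \<phi> :: "'e \<Rightarrow> 'v::real_vector \<Rightarrow> real"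
  assumes arr: "arrangement E \<phi>"
begin

abbreviation "T \<equiv> topes E \<phi>"

lemma finite_E: "finite E"
  using arr by (simp add: arrangement_def)

lemma finite_sub: "S \<subseteq> E \<Longrightarrow> finite S"
  using finite_E finite_subset by auto

lemma linear_phi: "e \<in> E \<Longrightarrow> linear (\<phi> e)"
  using arr by (simp add: arrangement_def)

lemma phi_add: "e \<in> E \<Longrightarrow> \<phi> e (x + y) = \<phi> e x + \<phi> e y"
  and phi_diff: "e \<in> E \<Longrightarrow> \<phi> e (x - y) = \<phi> e x - \<phi> e y"
  and phi_scale: "e \<in> E \<Longrightarrow> \<phi> e (c *\<^sub>R x) = c * \<phi> e x"
  and phi_zero: "e \<in> E \<Longrightarrow> \<phi> e 0 = 0"
  and phi_minus: "e \<in> E \<Longrightarrow> \<phi> e (- x) = - \<phi> e x"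
  using linear_phi by (simp_all add: linear_add linear_diff linear_scale linear_0 linear_neg)

lemmas phi_simps = phi_add phi_diff phi_scale phi_zero phi_minus

text \<open>
  The point \<open>x\<close> lies in the relative interior of the face of the tope \<open>A\<close>
  that is cut out by \<open>U\<close>.
\<close>

definition face_point :: "'e sign_vector \<Rightarrow> 'e set \<Rightarrow> 'v \<Rightarrow> bool"
  where "face_point A U x \<longleftrightarrow> (\<forall>e\<in>U. \<phi> e x = 0) \<and> (\<forall>e\<in>E - U. A e * \<phi> e x > 0)"

text \<open>These are the flats that correspond to the faces of \<open>A\<close>.\<close>

definition facial :: "'e sign_vector \<Rightarrow> 'e set \<Rightarrow> bool"
  where "facial A U \<longleftrightarrow> U \<subseteq> E \<and> (\<exists>x. face_point A U x)"

definition signs :: "'e sign_vector \<Rightarrow> bool"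
  where "signs A \<longleftrightarrow> (\<forall>e\<in>E. A e = 1 \<or> A e = - 1) \<and> (\<forall>e. e \<notin> E \<longrightarrow> A e = 0)"

lemma signs_pos: "signs A \<Longrightarrow> e \<in> E \<Longrightarrow> A e * r > 0 \<longleftrightarrow> sgn r = A e"
  by (auto simp: signs_def sgn_if)

lemma tope_iff: "A \<in> T \<longleftrightarrow> signs A \<and> facial A {}"
proof
  assume A: "A \<in> T"
  then obtain x where x: "A = (\<lambda>e. if e \<in> E then sgn (\<phi> e x) else 0)" and "\<forall>e\<in>E. A e \<noteq> 0"
    by (auto simp: topes_def covectors_def)
  then have "signs A" by (auto simp: signs_def sgn_if)
  moreover have "face_point A {} x"
    using x \<open>\<forall>e\<in>E. A e \<noteq> 0\<close> by (auto simp: face_point_def sgn_if)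
  ultimately show "signs A \<and> facial A {}" by (auto simp: facial_def)
next
  assume A: "signs A \<and> facial A {}"
  then obtain x where x: "face_point A {} x" by (auto simp: facial_def)
  have "A = (\<lambda>e. if e \<in> E then sgn (\<phi> e x) else 0)"
    using A x signs_pos by (auto simp: face_point_def signs_def fun_eq_iff)
  moreover have "\<forall>e\<in>E. A e \<noteq> 0" using A by (auto simp: signs_def)
  ultimately show "A \<in> T" by (auto simp: topes_def covectors_def)
qed

lemma topes_signs: "A \<in> T \<Longrightarrow> signs A"
  by (simp add: tope_iff)

lemma tope_values: "A \<in> T \<Longrightarrow> e \<in> E \<Longrightarrow> A e = 1 \<or> A e = - 1"
  by (simp add: tope_iff signs_def)

lemma tope_outside: "A \<in> T \<Longrightarrow> e \<notin> E \<Longrightarrow> A e = 0"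
  by (simp add: tope_iff signs_def)

lemma facial_iff:
  assumes "A \<in> T" "U \<subseteq> E"
  shows "zero_out A U \<in> covectors E \<phi> \<longleftrightarrow> facial A U"
proof
  assume "zero_out A U \<in> covectors E \<phi>"
  then obtain x where "zero_out A U = (\<lambda>e. if e \<in> E then sgn (\<phi> e x) else 0)"
    by (auto simp: covectors_def)
  then have x: "e \<in> E \<Longrightarrow> (if e \<in> U then 0 else A e) = sgn (\<phi> e x)" for e
    by (auto simp: zero_out_def fun_eq_iff split: if_splits)
  have "face_point A U x"
    unfolding face_point_def
  proof (intro conjI ballI)
    fix e assume "e \<in> U"
    then show "\<phi> e x = 0" using x[of e] assms by (auto simp: sgn_if split: if_splits)
  next
    fix e assume "e \<in> E - U"
    then show "A e * \<phi> e x > 0" using x[of e] signs_pos[OF topes_signs[OF assms(1)], of e "\<phi> e x"] by simp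
  qed
  then show "facial A U" using assms by (auto simp: facial_def)
next
  assume "facial A U"
  then obtain x where x: "face_point A U x" by (auto simp: facial_def)
  have "zero_out A U = (\<lambda>e. if e \<in> E then sgn (\<phi> e x) else 0)"
    using x signs_pos[OF topes_signs[OF assms(1)]] tope_outside[OF assms(1)] assms(2)
    by (auto simp: zero_out_def face_point_def fun_eq_iff)
  then show "zero_out A U \<in> covectors E \<phi>" by (auto simp: covectors_def)
qed

lemma facial_sub_E: "facial A U \<Longrightarrow> U \<subseteq> E"
  by (simp add: facial_def)

lemma facial_empty: "A \<in> T \<Longrightarrow> facial A {}"
  by (simp add: tope_iff)

lemma facial_cong:
  assumes "facial A U" "\<And>e. e \<in> E - U \<Longrightarrow> X e = A e"
  shows "facial X U"
  using assms by (auto simp: facial_def face_point_def)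

text \<open>
  A point in the relative interior of a face, moved slightly in the direction of \<open>v\<close>,
  enters a larger face.
\<close>

lemma facial_refine:
  assumes "facial X U" "V \<subseteq> U" "\<And>e. e \<in> V \<Longrightarrow> \<phi> e v = 0" "\<And>e. e \<in> U - V \<Longrightarrow> X e * \<phi> e v > 0"
  shows "facial X V"
proof -
  obtain x where x: "face_point X U x" and U: "U \<subseteq> E" using assms(1) by (auto simp: facial_def)
  obtain M where M: "M > 0" "\<forall>e\<in>E - U. M * (X e * \<phi> e x) + X e * \<phi> e v > 0"
    using dominate[of "E - U" "\<lambda>e. X e * \<phi> e x" "\<lambda>e. X e * \<phi> e v"] x finite_E
    by (auto simp: face_point_def)
  have "face_point X V (M *\<^sub>R x + v)"
    unfolding face_point_def
  proof (intro conjI ballI)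
    fix e assume "e \<in> V"
    then have "e \<in> E" "e \<in> U" using assms U by auto
    then show "\<phi> e (M *\<^sub>R x + v) = 0"
      using assms(3)[OF \<open>e \<in> V\<close>] x by (simp add: phi_simps face_point_def)
  next
    fix e assume e: "e \<in> E - V"
    show "X e * \<phi> e (M *\<^sub>R x + v) > 0"
    proof (cases "e \<in> U")
      case True
      then show ?thesis using e assms x by (auto simp: phi_simps face_point_def)
    next
      case False
      then show ?thesis using e M by (auto simp: phi_simps algebra_simps)
    qed
  qed
  then show ?thesis using U assms(2) by (auto simp: facial_def)
qed

text \<open>
  A point of the face of \<open>A\<close> that is cut out by \<open>V\<close>, or its negative, is the
  direction of a small displacement.
\<close>

lemma facial_sub:
  assumes "facial X U" "V \<subseteq> U" "facial A V"
    and "(\<forall>e\<in>U. X e = A e) \<or> (\<forall>e\<in>U. X e = - A e)"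
  shows "facial X V"
proof -
  have U: "U \<subseteq> E" using assms(1) facial_sub_E by auto
  obtain v where v: "face_point A V v" using assms(3) by (auto simp: facial_def)
  show ?thesis
  proof (cases "\<forall>e\<in>U. X e = A e")
    case True
    then show ?thesis
      using v U assms(2) by (intro facial_refine[OF assms(1,2), of v]) (auto simp: face_point_def)
  next
    case False
    then have "\<forall>e\<in>U. X e = - A e" using assms(4) by auto
    then show ?thesis
      using v U assms(2)
      by (intro facial_refine[OF assms(1,2), of "- v"]) (auto simp: face_point_def phi_simps)
  qed
qed

text \<open>
  The sum of points of two faces lies in the relative interior of the least face that contains both.
\<close>

lemma facial_Int:
  assumes "facial A U" "facial A S"
  shows "facial A (U \<inter> S)"
proof -
  obtain x y where "face_point A U x" "face_point A S y" "U \<subseteq> E" "S \<subseteq> E"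
    using assms by (auto simp: facial_def)
  then have "face_point A (U \<inter> S) (x + y)"
    unfolding face_point_def
    by (auto simp: phi_simps algebra_simps)
       (metis (no_types, lifting) Diff_iff add.right_neutral add_pos_pos mult_eq_0_iff add.left_neutral)+
  then show ?thesis using \<open>U \<subseteq> E\<close> by (auto simp: facial_def)
qed

text \<open>
  The composition, in the sense of oriented matroids, of the face of \<open>A\<close> that is cut out
  by \<open>U\<close> with \<open>X\<close>. It is the projection of \<open>X\<close> to the star of
  this face.
\<close>

definition proj :: "'e set \<Rightarrow> 'e sign_vector \<Rightarrow> 'e sign_vector \<Rightarrow> 'e sign_vector"
  where "proj U A X = (\<lambda>e. if e \<in> U then X e else A e)"

lemma proj_tope:
  assumes "A \<in> T" "X \<in> T" "facial A U"
  shows "proj U A X \<in> T"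
proof -
  obtain v where v: "face_point X {} v" using assms(2) by (auto simp: tope_iff facial_def)
  have "facial (proj U A X) {}"
  proof (rule facial_refine)
    show "facial (proj U A X) U" using assms(3) by (rule facial_cong) (auto simp: proj_def)
    show "proj U A X e * \<phi> e v > 0" if "e \<in> U - {}" for e
      using that v facial_sub_E[OF assms(3)] by (auto simp: proj_def face_point_def)
  qed auto
  moreover have "signs (proj U A X)"
    using assms topes_signs unfolding signs_def proj_def by auto
  ultimately show ?thesis by (simp add: tope_iff)
qed

lemma signs_reorient: "signs A \<Longrightarrow> S \<subseteq> E \<Longrightarrow> signs (reorient S A)"
  by (auto simp: signs_def reorient_def)

text \<open>
  A point of the face cut out by \<open>S\<close> is displaced by the negative of a point of the
  larger face cut out by \<open>U\<close>.
\<close>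

lemma facial_opposite:
  assumes A: "A \<in> T" and S: "facial A S" and U: "facial A U" and US: "U \<subseteq> S"
  shows "reorient (S - U) A \<in> T" "facial (reorient (S - U) A) U"
proof -
  let ?X = "reorient (S - U) A"
  have E: "S \<subseteq> E" using S by (rule facial_sub_E)
  obtain x where x: "face_point A U x" using U by (auto simp: facial_def)
  obtain a where a: "face_point A {} a" using facial_empty[OF A] by (auto simp: facial_def)
  have "facial ?X S" using S by (rule facial_cong) (auto simp: reorient_def)
  then show fX: "facial ?X U"
    by (rule facial_refine[of _ _ _ "- x"])
       (use US E x in \<open>auto simp: reorient_def face_point_def phi_simps\<close>)
  have "facial ?X {}"
    by (rule facial_refine[OF fX, of _ a])
       (use US E a in \<open>auto simp: reorient_def face_point_def\<close>)
  then show "?X \<in> T" using A E by (auto simp: tope_iff intro!: signs_reorient)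
qed

text \<open>
  At this time \<open>t\<close> the first of the finitely many functionals that decrease along
  \<open>h\<close> vanishes.
\<close>

lemma first_contact:
  assumes A: "A \<in> T" and S: "S \<subseteq> E"
    and f: "\<And>e. e \<in> S - U \<Longrightarrow> A e * \<phi> e f > 0" "\<And>e. e \<in> S \<inter> U \<Longrightarrow> \<phi> e f = 0"
    and h: "\<And>e. e \<in> S \<inter> U \<Longrightarrow> \<phi> e h = 0" "e0 \<in> S" "A e0 * \<phi> e0 h < 0"
  obtains t where "t > 0" "\<And>e. e \<in> S \<Longrightarrow> A e * \<phi> e (f + t *\<^sub>R h) \<ge> 0"
    "\<exists>e\<in>S - U. \<phi> e (f + t *\<^sub>R h) = 0"
proof -
  define N where "N = {e\<in>S. A e * \<phi> e h < 0}"
  have fin: "finite N" "N \<noteq> {}" using h finite_sub[OF S] by (auto simp: N_def)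
  have N: "N \<subseteq> S - U" "\<And>e. e \<in> N \<Longrightarrow> A e * \<phi> e h < 0" using h(1) by (auto simp: N_def)
  obtain t where t: "t > 0" "\<And>e. e \<in> N \<Longrightarrow> A e * \<phi> e f + t * (A e * \<phi> e h) \<ge> 0"
    "\<exists>e\<in>N. A e * \<phi> e f + t * (A e * \<phi> e h) = 0"
    using first_zero[OF fin, of "\<lambda>e. A e * \<phi> e f" "\<lambda>e. A e * \<phi> e h"] f(1) N by blast
  have y: "A e * \<phi> e (f + t *\<^sub>R h) = A e * \<phi> e f + t * (A e * \<phi> e h)" if "e \<in> S" for e
    using that S by (auto simp: phi_simps algebra_simps)
  have "A e * \<phi> e (f + t *\<^sub>R h) \<ge> 0" if e: "e \<in> S" for e
  proof (cases "e \<in> N")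
    case True
    then show ?thesis using t(2) y[OF e] by simp
  next
    case False
    then have "A e * \<phi> e h \<ge> 0" using e by (auto simp: N_def)
    moreover have "A e * \<phi> e f \<ge> 0" using f e by (cases "e \<in> U") (auto simp: less_imp_le)
    ultimately show ?thesis using t(1) y[OF e] by simp
  qed
  moreover have "\<exists>e\<in>S - U. \<phi> e (f + t *\<^sub>R h) = 0"
  proof -
    obtain e where e: "e \<in> N" "A e * \<phi> e f + t * (A e * \<phi> e h) = 0" using t(3) by blast
    have SU: "e \<in> S - U" using e(1) N(1) by blast
    then have "A e * \<phi> e (f + t *\<^sub>R h) = 0" using y[of e] e(2) by simp
    moreover have "e \<in> E" using SU S by blast
    ultimately have "\<phi> e (f + t *\<^sub>R h) = 0" using tope_values[OF A, of e] by auto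
    then show ?thesis using SU by blast
  qed
  ultimately show ?thesis using that t(1) by blast
qed

text \<open>
  Let \<open>f\<close> and \<open>g\<close> be points of the two faces. Moving from \<open>f\<close>
  in the direction of \<open>g\<close>, one can only cross hyperplanes of \<open>Sep A X\<close>. At
  the first contact one is still in a face of \<open>A\<close>, and the hyperplanes of
  \<open>S\<close> through this point are those of \<open>U \<inter> S\<close> and at least one of
  \<open>Sep A X\<close>.
\<close>

lemma facial_exchange:
  assumes A: "A \<in> T" and X: "X \<in> T" and U: "facial A U" and S: "S \<subseteq> E"
    and D: "Sep A X \<subseteq> S - U" "Sep A X \<noteq> {}"
    and F: "facial X (S - Sep A X)"
  obtains U' where "facial A U'" "U \<inter> S \<subset> U'" "U' \<subseteq> S" "U' \<subseteq> U \<union> Sep A X"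
proof -
  let ?D = "Sep A X"
  obtain f where f: "face_point A U f" using U by (auto simp: facial_def)
  obtain g where g: "face_point X (S - ?D) g" using F by (auto simp: facial_def)
  have DE: "?D \<subseteq> E" using D(1) S by blast
  have gD: "A e * \<phi> e g < 0" if e: "e \<in> ?D" for e
  proof -
    have "e \<in> E - (S - ?D)" "A e \<noteq> X e" using e DE by (auto simp: Sep_def)
    moreover from this have "X e * \<phi> e g > 0" using g by (simp add: face_point_def)
    ultimately show ?thesis using tope_values[OF A, of e] tope_values[OF X, of e] by auto
  qed
  have fS: "A e * \<phi> e f > 0" if "e \<in> S - U" for e using f that S by (auto simp: face_point_def)
  obtain e0 where e0: "e0 \<in> ?D" using D(2) by blast
  obtain t where t: "t > 0" "\<And>e. e \<in> S \<Longrightarrow> A e * \<phi> e (f + t *\<^sub>R g) \<ge> 0"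
    "\<exists>e\<in>S - U. \<phi> e (f + t *\<^sub>R g) = 0"
  proof (rule first_contact[OF A S, of U f g e0])
    show "\<phi> e g = 0" if "e \<in> S \<inter> U" for e using that g D(1) by (auto simp: face_point_def)
    show "\<phi> e f = 0" if "e \<in> S \<inter> U" for e using that f by (auto simp: face_point_def)
  qed (use fS gD[OF e0] e0 D(1) in auto)
  define y where "y = f + t *\<^sub>R g"
  have ySD: "\<phi> e y = \<phi> e f" if "e \<in> S - ?D" for e
    using that g S by (auto simp: y_def phi_simps face_point_def)
  have yO: "A e * \<phi> e y > 0" if e: "e \<in> E - S" for e
  proof -
    have "e \<notin> ?D" "e \<in> E - (S - ?D)" using e D by auto
    then have "A e * \<phi> e g > 0" using g by (auto simp: face_point_def Sep_def)
    moreover have "A e * \<phi> e f \<ge> 0" using f e by (cases "e \<in> U") (auto simp: face_point_def less_imp_le)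
    ultimately show ?thesis using e t(1) by (simp add: y_def phi_simps distrib_left mult.left_commute add_nonneg_pos)
  qed
  define U' where "U' = {e \<in> S. \<phi> e y = 0}"
  have "A e * \<phi> e y > 0" if e: "e \<in> E - U'" for e
  proof (cases "e \<in> S")
    case True
    then have "A e * \<phi> e y \<noteq> 0" using e tope_values[OF A, of e] by (auto simp: U'_def)
    then show ?thesis using t(2)[OF True] by (simp add: y_def less_le)
  qed (use e yO in auto)
  then have "face_point A U' y" by (auto simp: face_point_def U'_def)
  then have "facial A U'" using S by (auto simp: facial_def U'_def)
  moreover have "U \<inter> S \<subseteq> U'"
  proof
    fix e assume e: "e \<in> U \<inter> S"
    then have "\<phi> e y = \<phi> e f" using D ySD[of e] by auto
    then show "e \<in> U'" using e f by (auto simp: U'_def face_point_def)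
  qed
  moreover have "U' \<noteq> U \<inter> S" using t(3) by (auto simp: U'_def y_def)
  moreover have "U' \<subseteq> U \<union> ?D"
  proof
    fix e assume e: "e \<in> U'"
    show "e \<in> U \<union> ?D"
    proof (rule ccontr)
      assume n: "e \<notin> U \<union> ?D"
      then have "\<phi> e f = 0" using e ySD[of e] by (auto simp: U'_def)
      then show False using fS[of e] n e by (auto simp: U'_def)
    qed
  qed
  ultimately show ?thesis using that[of U'] by (auto simp: U'_def)
qed

subsection \<open>Ranks\<close>

abbreviation "rnk S \<equiv> rk \<phi> S"

lemma rank_dim: "rnk S = dim (\<phi> ` S)"
  by (simp add: rk_def)

lemma rank_empty [simp]: "rnk {} = 0"
  unfolding rank_dim by (rule real_vector.dim_unique[of "{}"]) (auto simp: real_vector.independent_empty)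

lemma rank_mono: "S \<subseteq> S' \<Longrightarrow> S' \<subseteq> E \<Longrightarrow> rnk S \<le> rnk S'"
  unfolding rank_dim
  by (rule dim_mono_finite) (use finite_sub[of S'] in \<open>auto intro: span_base\<close>)

lemma rank_submodular:
  assumes "P \<subseteq> E" "Q \<subseteq> E"
  shows "rnk (P \<union> Q) + rnk (P \<inter> Q) \<le> rnk P + rnk Q"
  unfolding rank_dim image_Un
  by (rule dim_submodular) (use finite_sub assms in auto)

lemma rank_insert_facial:
  assumes "facial A U" "S \<subseteq> U" "e \<in> E - U"
  shows "rnk (insert e S) = Suc (rnk S)"
proof -
  obtain x where x: "face_point A U x" "U \<subseteq> E" using assms(1) by (auto simp: facial_def)
  have "\<phi> e \<notin> span (\<phi> ` S)"
  proof
    assume "\<phi> e \<in> span (\<phi> ` S)"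
    then have "\<phi> e x = 0" by (rule span_apply_zero) (use x assms in \<open>auto simp: face_point_def\<close>)
    then show False using x assms by (force simp: face_point_def)
  qed
  then show ?thesis
    unfolding rank_dim using finite_sub[of S] assms x by (auto simp: dim_insert_finite)
qed

text \<open>
  Let \<open>f\<close> be a point of the face cut out by \<open>U\<close>. If \<open>h\<close> is in
  the common kernel of \<open>U\<close> and moving from \<open>f\<close> along \<open>h\<close> leaves
  the tope, then at the first contact all of \<open>S\<close> vanishes by maximality. So on
  \<open>S\<close> every such \<open>h\<close> is proportional to \<open>f\<close>, and one functional
  of \<open>S - U\<close> spans \<open>S\<close> together with \<open>U\<close>.
\<close>

lemma rank_maximal_face:
  assumes A: "A \<in> T" and S: "facial A S" and U: "facial A U" "U \<subset> S"
    and max: "\<And>U'. facial A U' \<Longrightarrow> U \<subset> U' \<Longrightarrow> U' \<subseteq> S \<Longrightarrow> U' = S"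
  shows "rnk S = Suc (rnk U)"
proof -
  have SE: "S \<subseteq> E" using S by (rule facial_sub_E)
  obtain f where f: "face_point A U f" using U by (auto simp: facial_def)
  obtain z where z: "face_point A S z" using S by (auto simp: facial_def)
  obtain e0 where e0: "e0 \<in> S - U" using U by auto
  have Af: "A e * \<phi> e f > 0" if "e \<in> S - U" for e using f that SE by (auto simp: face_point_def)
  have prop_neg: "\<exists>c. \<forall>e\<in>S. \<phi> e h = c * \<phi> e f"
    if h: "\<forall>e\<in>U. \<phi> e h = 0" "e \<in> S" "A e * \<phi> e h < 0" for h e
  proof -
    obtain t where t: "t > 0" "\<And>e. e \<in> S \<Longrightarrow> A e * \<phi> e (f + t *\<^sub>R h) \<ge> 0"
      "\<exists>e\<in>S - U. \<phi> e (f + t *\<^sub>R h) = 0"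
    proof (rule first_contact[OF A SE, of U f h e])
      show "\<phi> e f = 0" if "e \<in> S \<inter> U" for e using that f by (auto simp: face_point_def)
    qed (use Af h in auto)
    define U' where "U' = {e\<in>S. \<phi> e (f + t *\<^sub>R h) = 0}"
    have "facial A U'"
    proof (rule facial_refine[OF S, of _ "f + t *\<^sub>R h"])
      fix e assume e: "e \<in> S - U'"
      then have "A e * \<phi> e (f + t *\<^sub>R h) \<noteq> 0" using tope_values[OF A, of e] SE by (auto simp: U'_def)
      then show "A e * \<phi> e (f + t *\<^sub>R h) > 0" using t(2)[of e] e by (simp add: less_le)
    qed (auto simp: U'_def)
    moreover have "U \<subset> U'" using U f h t(3) SE by (auto simp: U'_def phi_simps face_point_def)
    ultimately have "U' = S" by (intro max) (auto simp: U'_def)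
    then have "\<phi> e h = (- 1 / t) * \<phi> e f" if "e \<in> S" for e
    proof -
      have "\<phi> e (f + t *\<^sub>R h) = 0" using that \<open>U' = S\<close> by (auto simp: U'_def)
      then have "\<phi> e f + t * \<phi> e h = 0" using that SE by (auto simp: phi_simps)
      then show ?thesis using t(1) by (simp add: field_simps)
    qed
    then show ?thesis by blast
  qed
  have proportional: "\<exists>c. \<forall>e\<in>S. \<phi> e h = c * \<phi> e f" if h: "\<forall>e\<in>U. \<phi> e h = 0" for h
  proof (cases "\<exists>e\<in>S. A e * \<phi> e h < 0")
    case True then show ?thesis using prop_neg h by auto
  next
    case nonneg: False
    show ?thesis
    proof (cases "\<exists>e\<in>S. A e * \<phi> e (- h) < 0")
      case True
      then obtain c where "\<forall>e\<in>S. \<phi> e (- h) = c * \<phi> e f"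
        using prop_neg[of "- h"] h U(2) SE by (force simp: phi_simps)
      then have "\<forall>e\<in>S. \<phi> e h = (- c) * \<phi> e f"
        using SE by (metis minus_minus mult_minus_left phi_minus subsetD)
      then show ?thesis by blast
    next
      case False
      have "\<phi> e h = 0" if "e \<in> S" for e
      proof -
        have "e \<in> E" using that SE by auto
        then have "A e * \<phi> e h = 0" using nonneg False that by (force simp: phi_simps)
        then show ?thesis using tope_values[OF A \<open>e \<in> E\<close>] by auto
      qed
      then show ?thesis by (intro exI[of _ 0]) simp
    qed
  qed
  have fe0: "\<phi> e0 f \<noteq> 0" using Af[OF e0] by auto
  have "\<phi> e \<in> span (\<phi> ` insert e0 U)" if e: "e \<in> S" for e
  proof -
    define c where "c = \<phi> e f / \<phi> e0 f"
    have lin: "linear (\<phi> e - c *\<^sub>R \<phi> e0)"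
      using linear_compose_sub[OF linear_phi linear_compose_scale_right[OF linear_phi, of e0 c], of e] e e0 SE
      by (auto simp: fun_diff_def scaleR_fun_def)
    have "\<phi> e - c *\<^sub>R \<phi> e0 \<in> span (\<phi> ` U)"
    proof (rule in_span_if_annihilates[OF _ _ lin])
      fix h assume "\<And>b. b \<in> \<phi> ` U \<Longrightarrow> b h = 0"
      then obtain d where d: "\<forall>e\<in>S. \<phi> e h = d * \<phi> e f" using proportional[of h] by auto
      then show "(\<phi> e - c *\<^sub>R \<phi> e0) h = 0" using e e0 fe0 by (simp add: c_def)
    qed (use U SE linear_phi finite_sub[of U] in auto)
    then have "\<phi> e - c *\<^sub>R \<phi> e0 \<in> span (\<phi> ` insert e0 U)" "c *\<^sub>R \<phi> e0 \<in> span (\<phi> ` insert e0 U)"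
      using span_mono[of "\<phi> ` U" "\<phi> ` insert e0 U"] by (auto intro: span_scale span_base)
    then have "(\<phi> e - c *\<^sub>R \<phi> e0) + c *\<^sub>R \<phi> e0 \<in> span (\<phi> ` insert e0 U)" by (rule span_add)
    then show ?thesis by simp
  qed
  then have "rnk S \<le> rnk (insert e0 U)"
    unfolding rank_dim by (intro dim_mono_finite) (use U SE finite_sub[of U] in auto)
  moreover have "rnk (insert e0 U) \<le> rnk S" using e0 U SE by (intro rank_mono) auto
  moreover have "rnk (insert e0 U) = Suc (rnk U)" using rank_insert_facial[OF U(1), of U e0] e0 SE by auto
  ultimately show ?thesis by simp
qed

end

section \<open>Chains and their smooth faces\<close>

abbreviation ind :: "'e set \<Rightarrow> 'e \<Rightarrow> nat"
  where "ind S \<equiv> indicator S"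

fun crs :: "'e sign_vector list \<Rightarrow> 'e \<Rightarrow> nat"
  where
    "crs (a # b # q) = ind (Sep a b) + crs (b # q)"
  | "crs _ = 0"

text \<open>
  Deletions of one interior vertex that lies on a geodesic between its neighbours. In a proper chain
  the deletions of different vertices are different (see \<open>inj_on_del\<close>), so modulo two the
  boundary is the sum over this set.
\<close>

fun faces :: "'e sign_vector list \<Rightarrow> 'e sign_vector list set"
  where
    "faces (a # b # c # q) =
      (if Sep a b \<inter> Sep b c = {} then {a # c # q} else {}) \<union> Cons a ` faces (b # c # q)"
  | "faces _ = {}"

text \<open>The crossing vectors of the initial segments of a chain.\<close>

fun initials :: "'e sign_vector list \<Rightarrow> ('e \<Rightarrow> nat) set"
  where
    "initials (a # b # q) = insert 0 ((+) (ind (Sep a b)) ` initials (b # q))"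
  | "initials [a] = {0}"
  | "initials [] = {}"

lemma ind_add: "S \<inter> S' = {} \<Longrightarrow> ind S + ind S' = ind (S \<union> S')"
  by (auto simp: fun_eq_iff indicator_def)

lemma ind_eq_iff [simp]: "ind S = ind S' \<longleftrightarrow> S = S'"
  by (auto simp: fun_eq_iff indicator_def split: if_splits)

lemma ind_empty [simp]: "ind {} = 0"
  by (auto simp: fun_eq_iff)

lemma ind_eq_0_iff [simp]: "ind S = 0 \<longleftrightarrow> S = {}"
  by (auto simp: fun_eq_iff indicator_def)

lemma fun_add_eq_0_iff [simp]: "(\<alpha> :: 'e \<Rightarrow> nat) + \<beta> = 0 \<longleftrightarrow> \<alpha> = 0 \<and> \<beta> = 0"
  by (auto simp: fun_eq_iff)

lemma Sep_commute: "Sep a b = Sep b a"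
  by (auto simp: Sep_def)

lemma Sep_empty_iff [simp]: "Sep a b = {} \<longleftrightarrow> a = b"
  by (auto simp: Sep_def fun_eq_iff)

lemma Sep_self [simp]: "Sep a a = {}"
  by simp

lemma Sep_smooth: "Sep a b \<inter> Sep b c = {} \<Longrightarrow> Sep a c = Sep a b \<union> Sep b c"
proof (intro set_eqI)
  fix e assume "Sep a b \<inter> Sep b c = {}"
  then have "\<not> (e \<in> Sep a b \<and> e \<in> Sep b c)" by blast
  then show "e \<in> Sep a c \<longleftrightarrow> e \<in> Sep a b \<union> Sep b c" unfolding Sep_def by auto
qed

lemma ind_smooth: "Sep a b \<inter> Sep b c = {} \<Longrightarrow> ind (Sep a c) = ind (Sep a b) + ind (Sep b c)"
  by (metis Sep_smooth ind_add)

lemma smooth_neq: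
  assumes "Sep a b \<inter> Sep b c = {}" "a \<noteq> b"
  shows "a \<noteq> c"
proof
  assume "a = c"
  then have "Sep b c = Sep a b" by (simp only: Sep_commute)
  then have "Sep a b = {}" using assms(1) by (simp only: Int_absorb)
  then show False using assms(2) by (simp only: Sep_empty_iff)
qed

lemma finite_faces_list [simp]: "finite (faces x)"
  by (induction x rule: faces.induct) auto

lemma faces_short [simp]: "faces [a] = {}" "faces [a, b] = {}"
  by auto

text \<open>
  Deleting a smooth vertex merges two disjoint separating sets. Hence the crossing vector is kept, and
  the initial segments can only become fewer.
\<close>

lemma faces_basic:
  assumes "y \<in> faces x"
  shows "length x = Suc (length y)" "hd y = hd x" "last y = last x" "set y \<subseteq> set x"
    "y \<noteq> []" "x \<noteq> []" "crs y = crs x" "initials y \<subseteq> initials x" "tl y \<noteq> []"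
proof -
  have "length x = Suc (length y) \<and> hd y = hd x \<and> last y = last x \<and> set y \<subseteq> set x \<and>
      y \<noteq> [] \<and> x \<noteq> [] \<and> crs y = crs x \<and> initials y \<subseteq> initials x \<and> tl y \<noteq> []"
    using assms
  proof (induction x arbitrary: y rule: faces.induct)
    case (1 a b c q)
    show ?case
    proof (cases "y = a # c # q \<and> Sep a b \<inter> Sep b c = {}")
      case True
      then show ?thesis by (auto simp: ind_smooth add.assoc)
    next
      case False
      then obtain z where z: "y = a # z" "z \<in> faces (b # c # q)" using 1 by (auto split: if_splits)
      then obtain w where "z = b # w" using 1(1)[OF z(2)] by (cases z) auto
      then show ?thesis using 1(1)[OF z(2)] z(1) by auto
    qed
  qed auto
  then show "length x = Suc (length y)" "hd y = hd x" "last y = last x" "set y \<subseteq> set x"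
    "y \<noteq> []" "x \<noteq> []" "crs y = crs x" "initials y \<subseteq> initials x" "tl y \<noteq> []" by auto
qed

lemma faces_proper:
  assumes "y \<in> faces x" "distinct_adj x"
  shows "distinct_adj y"
  using assms
proof (induction x arbitrary: y rule: faces.induct)
  case (1 a b c q)
  show ?case
  proof (cases "y = a # c # q \<and> Sep a b \<inter> Sep b c = {}")
    case True
    then show ?thesis using 1 smooth_neq[of a b c] by (cases q) auto
  next
    case False
    then obtain z where z: "y = a # z" "z \<in> faces (b # c # q)" using 1 by (auto split: if_splits)
    then obtain w where "z = b # w" using faces_basic[OF z(2)] by (cases z) auto
    then show ?thesis using 1(1)[OF z(2)] 1 z(1) by auto
  qed
qed auto

lemma faces_delete:
  assumes "y \<in> faces x"
  obtains u b v where "x = u @ b # v" "y = u @ v" "u \<noteq> []" "v \<noteq> []"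
    "Sep (last u) b \<inter> Sep b (hd v) = {}"
proof -
  have "\<exists>u b v. x = u @ b # v \<and> y = u @ v \<and> u \<noteq> [] \<and> v \<noteq> [] \<and> Sep (last u) b \<inter> Sep b (hd v) = {}"
    using assms
  proof (induction x arbitrary: y rule: faces.induct)
    case (1 a b c q)
    show ?case
    proof (cases "y = a # c # q \<and> Sep a b \<inter> Sep b c = {}")
      case True
      then show ?thesis by (intro exI[of _ "[a]"] exI[of _ b] exI[of _ "c # q"]) auto
    next
      case False
      then obtain z where z: "y = a # z" "z \<in> faces (b # c # q)" using 1 by (auto split: if_splits)
      then obtain u d v where "b # c # q = u @ d # v" "z = u @ v" "u \<noteq> []" "v \<noteq> []"
        "Sep (last u) d \<inter> Sep d (hd v) = {}" using 1(1) by blast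
      then show ?thesis using z by (intro exI[of _ "a # u"] exI[of _ d] exI[of _ v]) auto
    qed
  qed auto
  then show ?thesis using that by blast
qed

lemma faces_deleteI:
  assumes "u \<noteq> []" "v \<noteq> []" "Sep (last u) b \<inter> Sep b (hd v) = {}"
  shows "u @ v \<in> faces (u @ b # v)"
  using assms
proof (induction u rule: induct_list012)
  case (2 a)
  then show ?case by (cases v) auto
next
  case (3 a a' u)
  then have "(a' # u) @ v \<in> faces ((a' # u) @ b # v)" by simp
  moreover obtain c r where "u @ b # v = c # r" by (cases u) auto
  ultimately show ?case using 3 by (auto simp: image_iff)
qed simp

lemma rev_faces: "y \<in> faces x \<Longrightarrow> rev y \<in> faces (rev x)"
proof -
  assume "y \<in> faces x"
  then obtain u b v where u: "x = u @ b # v" "y = u @ v" "u \<noteq> []" "v \<noteq> []"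
    "Sep (last u) b \<inter> Sep b (hd v) = {}" by (rule faces_delete)
  then have "rev v @ rev u \<in> faces (rev v @ b # rev u)"
    by (intro faces_deleteI) (auto simp: last_rev hd_rev Sep_commute)
  then show ?thesis using u by simp
qed

lemma faces_rev: "faces (rev x) = rev ` faces x"
proof (intro set_eqI iffI)
  fix y assume "y \<in> faces (rev x)"
  then have "rev y \<in> faces x" using rev_faces[of y "rev x"] by simp
  then show "y \<in> rev ` faces x" by (metis image_eqI rev_rev_ident)
qed (auto simp: rev_faces)

text \<open>
  The last term deletes the common vertex; it is the only face of a concatenation that is not a
  concatenation at the same place.
\<close>

lemma faces_append:
  "faces (p @ b # q) = (\<lambda>y. y @ q) ` faces (p @ [b]) \<union> (\<lambda>z. p @ z) ` faces (b # q) \<union>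
    (if p \<noteq> [] \<and> q \<noteq> [] \<and> Sep (last p) b \<inter> Sep b (hd q) = {} then {p @ q} else {})"
proof (induction p rule: induct_list012)
  case (2 a)
  then show ?case by (cases q) auto
next
  case (3 a a' p)
  obtain c r where c: "p @ b # q = c # r" "p @ [b] = c # (if p = [] then [] else tl p @ [b])"
    by (cases p) auto
  obtain r' where c': "p @ [b] = c # r'" using c by auto
  have r: "r = r' @ q" using c(1) c' by (cases p) auto
  define X where "X = (if Sep a a' \<inter> Sep a' c = {} then {a # c # r'} else {})"
  have 1: "faces ((a # a' # p) @ b # q) = (\<lambda>y. y @ q) ` X \<union> Cons a ` faces ((a' # p) @ b # q)"
    unfolding append_Cons c(1) by (simp add: X_def r)
  have 2: "faces ((a # a' # p) @ [b]) = X \<union> Cons a ` faces ((a' # p) @ [b])"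
    unfolding append_Cons c' by (simp add: X_def)
  show ?case unfolding 1 2 3(2) by (simp add: image_Un image_image Un_assoc)
qed auto

lemma crs_append: "crs (p @ b # q) = crs (p @ [b]) + crs (b # q)"
  by (induction p rule: induct_list012) (auto simp: add.assoc)

lemma crs_rev: "crs (rev x) = crs x"
proof (induction x rule: induct_list012)
  case (3 a b q)
  have "crs (rev (a # b # q)) = crs (rev q @ [b]) + crs [b, a]"
    using crs_append[of "rev q" b "[a]"] by simp
  then show ?case using 3 by (simp add: Sep_commute add.commute)
qed auto

lemma crs_eq_0_iff: "distinct_adj x \<Longrightarrow> crs x = 0 \<longleftrightarrow> length x \<le> 1"
  by (induction x rule: induct_list012) auto

lemma initials_iff: "\<beta> \<in> initials x \<longleftrightarrow> (\<exists>p b q. x = p @ b # q \<and> crs (p @ [b]) = \<beta>)"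
proof (induction x arbitrary: \<beta> rule: induct_list012)
  case (2 a)
  have "([a] = p @ b # q) = (p = [] \<and> b = a \<and> q = [])" for p b q by (cases p) auto
  then show ?case by simp
next
  case (3 a a' x)
  show ?case
  proof
    assume "\<beta> \<in> initials (a # a' # x)"
    then have "\<beta> = 0 \<or> (\<exists>\<beta>'. \<beta> = ind (Sep a a') + \<beta>' \<and> \<beta>' \<in> initials (a' # x))" by auto
    then consider "\<beta> = 0" | \<beta>' where "\<beta> = ind (Sep a a') + \<beta>'" "\<beta>' \<in> initials (a' # x)" by blast
    then show "\<exists>p b q. a # a' # x = p @ b # q \<and> crs (p @ [b]) = \<beta>"
    proof cases
      case 1
      then have "a # a' # x = [] @ a # a' # x \<and> crs ([] @ [a]) = \<beta>" by simp
      then show ?thesis by blast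
    next
      case 2
      then obtain p b q where p: "a' # x = p @ b # q" "crs (p @ [b]) = \<beta>'" using 3(2) by blast
      then have "crs ((a # p) @ [b]) = \<beta>" using 2 by (cases p) auto
      moreover have "a # a' # x = (a # p) @ b # q" using p by simp
      ultimately show ?thesis by blast
    qed
  next
    assume "\<exists>p b q. a # a' # x = p @ b # q \<and> crs (p @ [b]) = \<beta>"
    then obtain p b q where p: "a # a' # x = p @ b # q" "crs (p @ [b]) = \<beta>" by blast
    show "\<beta> \<in> initials (a # a' # x)"
    proof (cases p)
      case Nil
      then show ?thesis using p by auto
    next
      case (Cons a'' p')
      then have "a' # x = p' @ b # q" and \<beta>: "\<beta> = ind (Sep a a') + crs (p' @ [b])"
        using p by (auto simp: Cons_eq_append_conv)
      then have "crs (p' @ [b]) \<in> initials (a' # x)" using 3(2) by blast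
      then show ?thesis using \<beta> by simp
    qed
  qed
qed auto

lemma initials_rev: "\<beta> \<in> initials (rev x) \<longleftrightarrow> (\<exists>\<alpha>\<in>initials x. \<alpha> + \<beta> = crs x)"
proof -
  have dir: "\<exists>\<alpha>\<in>initials x. \<alpha> + \<beta> = crs x" if b: "\<beta> \<in> initials (rev x)" for x \<beta>
  proof -
    from b obtain p b q where "rev x = p @ b # q" "crs (p @ [b]) = \<beta>" by (auto simp: initials_iff)
    then have "rev (rev x) = rev (p @ b # q)" by simp
    then have x: "x = rev q @ b # rev p" by simp
    have "crs (b # rev p) = \<beta>"
      using \<open>crs (p @ [b]) = \<beta>\<close> crs_rev[of "p @ [b]"] by simp
    then have "crs (rev q @ [b]) + \<beta> = crs x"
      using crs_append[of "rev q" b "rev p"] x by simp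
    moreover have "crs (rev q @ [b]) \<in> initials x" unfolding initials_iff x by blast
    ultimately show ?thesis by blast
  qed
  moreover have "\<beta> \<in> initials (rev x)" if "\<alpha> \<in> initials x" "\<alpha> + \<beta> = crs x" for \<alpha>
  proof -
    have "\<alpha> \<in> initials (rev (rev x))" using that by simp
    then obtain \<gamma> where "\<gamma> \<in> initials (rev x)" "\<gamma> + \<alpha> = crs x"
      using dir[of \<alpha> "rev x"] by (metis crs_rev)
    then have "\<gamma> = \<beta>" using that by (metis add.commute add_left_imp_eq)
    then show ?thesis using \<open>\<gamma> \<in> initials (rev x)\<close> by simp
  qed
  ultimately show ?thesis by blast
qed

text \<open>
  Between two cuts with equal crossing vectors no hyperplane is crossed, so in a proper chain they
  coincide.
\<close>

lemma cut_unique: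
  assumes "p @ b # q = p' @ b' # q'" "distinct_adj (p @ b # q)" "crs (p @ [b]) = crs (p' @ [b'])"
  shows "p = p' \<and> b = b' \<and> q = q'"
proof -
  have *: False if e: "p @ b # q = p' @ b' # q'" and d: "distinct_adj (p @ b # q)"
    and c: "crs (p @ [b]) = crs (p' @ [b'])" and l: "length p < length p'"
    for p b q p' b' q'
  proof -
    have "p' = take (length p') (p @ b # q)" using e by simp
    also have "\<dots> = p @ b # take (length p' - length p - 1) q" using l by (cases "length p' - length p") auto
    finally obtain r where r: "p' = p @ b # r" by blast
    then have "crs (p' @ [b']) = crs (p @ [b]) + crs (b # r @ [b'])"
      using crs_append[of p b "r @ [b']"] by simp
    then have "crs (b # r @ [b']) = 0" using c by simp
    moreover have "distinct_adj (b # r @ [b'])"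
      using d e r by (auto simp: distinct_adj_append_iff distinct_adj_Cons hd_append split: if_splits)
    ultimately show False by (simp add: crs_eq_0_iff)
  qed
  have "length p = length p'"
    using *[of p b q p' b' q'] *[of p' b' q' p b q] assms by (metis linorder_neqE_nat)
  then show ?thesis using assms by simp
qed

subsection \<open>The differential squares to zero\<close>

text \<open>
  Two deletions can be made in either order. This is clear unless the vertices are neighbours, and for
  neighbours \<open>b\<close>, \<open>c\<close> in \<open>a, b, c, d\<close> both orders are smooth
  iff \<open>Sep a b\<close>, \<open>Sep b c\<close> and \<open>Sep c d\<close> are pairwise disjoint
  (\<open>s_assoc\<close>).
\<close>

lemma faces_complex: "is_complex faces {x :: 'e sign_vector list. distinct_adj x}"
proof -
  define D :: "('e sign_vector list \<Rightarrow> bit) \<Rightarrow> 'e sign_vector list \<Rightarrow> bit"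
    where "D f x = (\<Sum>y\<in>faces x. f y)" for f x
  define s :: "'e sign_vector \<Rightarrow> 'e sign_vector \<Rightarrow> 'e sign_vector \<Rightarrow> bit"
    where "s a b c = (if Sep a b \<inter> Sep b c = {} then 1 else 0)" for a b c
  have Dshort: "D f [a] = 0" "D f [a, b] = 0" for f a b by (simp_all add: D_def)
  have Drec: "D f (a # b # c # q) = s a b c * f (a # c # q) + D (\<lambda>y. f (a # y)) (b # c # q)"
    if "b \<noteq> c" for f a b c q
  proof -
    have "a # c # q \<notin> Cons a ` faces (b # c # q)"
      using that faces_basic(2)[of "c # q" "b # c # q"] by auto
    then show ?thesis by (auto simp: D_def s_def sum.reindex)
  qed
  have Dadd: "D (\<lambda>y. f y + g y) x = D f x + D g x" for f g x by (simp add: D_def sum.distrib)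
  have Dcong: "D f x = D g x" if "\<And>y. y \<in> faces x \<Longrightarrow> f y = g y" for f g x
    using that by (simp add: D_def)
  have Dmult: "D (\<lambda>y. c * f y) x = c * D f x" for c f x by (simp add: D_def sum_distrib_left)
  have s_assoc: "s b c d * s a b d = s a b c * s a c d" for a b c d
    using Sep_smooth[of b c d] Sep_smooth[of a b c] by (auto simp: s_def)
  have "D (D f) x = 0" if "distinct_adj x" for f x
    using that
  proof (induction x arbitrary: f rule: faces.induct)
    case (1 a b c q)
    have bc: "b \<noteq> c" "distinct_adj (b # c # q)" using 1 by auto
    have "D (D f) (a # b # c # q) = s a b c * D f (a # c # q) + D (\<lambda>y. D f (a # y)) (b # c # q)"
      by (rule Drec[OF bc(1)])
    also have "D (\<lambda>y. D f (a # y)) (b # c # q) =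
        D (\<lambda>y. s a b (hd (tl y)) * f (a # tl y) + D (\<lambda>z. f (a # z)) y) (b # c # q)"
    proof (rule Dcong)
      fix y assume y: "y \<in> faces (b # c # q)"
      then obtain d r where "y = b # d # r"
        using faces_basic[OF y] by (metis hd_Cons_tl list.sel(1))
      moreover have "distinct_adj y" using y bc(2) by (rule faces_proper)
      ultimately show "D f (a # y) = s a b (hd (tl y)) * f (a # tl y) + D (\<lambda>z. f (a # z)) y"
        by (simp add: Drec)
    qed
    also have "\<dots> = D (\<lambda>y. s a b (hd (tl y)) * f (a # tl y)) (b # c # q)"
      unfolding Dadd using 1(1)[OF bc(2), of "\<lambda>z. f (a # z)"] by simp
    also have "\<dots> = s a b c * D f (a # c # q)"
    proof (cases q)
      case Nil
      then show ?thesis by (simp add: Dshort)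
    next
      case (Cons d r)
      have cd: "c \<noteq> d" using bc Cons by auto
      have "D (\<lambda>y. s a b (hd (tl y)) * f (a # tl y)) (b # c # q) =
          s b c d * (s a b d * f (a # d # r)) + D (\<lambda>z. s a b (hd z) * f (a # z)) (c # d # r)"
        unfolding Cons by (subst Drec[OF cd]) simp
      also have "D (\<lambda>z. s a b (hd z) * f (a # z)) (c # d # r) = D (\<lambda>z. s a b c * f (a # z)) (c # d # r)"
        by (rule Dcong) (use faces_basic(2) in fastforce)
      also have "s b c d * (s a b d * f (a # d # r)) = s a b c * (s a c d * f (a # d # r))"
        using s_assoc[of b c d a] by (simp flip: mult.assoc)
      finally show ?thesis unfolding Cons by (simp add: Drec[OF cd] Dmult distrib_left)
    qed
    finally show ?case by simp
  qed (auto simp: D_def)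
  then have DD: "D (D f) x = 0" if "distinct_adj x" for f x using that by blast
  have c: "cobd faces {x. distinct_adj x} f x = D f x" if "distinct_adj x" for f x
  proof -
    have "faces x \<inter> {x. distinct_adj x} = faces x" using faces_proper that by auto
    then show ?thesis by (simp add: cobd_def D_def)
  qed
  have "cobd faces {x. distinct_adj x} (cobd faces {x. distinct_adj x} f) x = 0"
    if x: "distinct_adj x" for f :: "'e sign_vector list \<Rightarrow> bit" and x
  proof -
    have "cobd faces {x. distinct_adj x} (cobd faces {x. distinct_adj x} f) x = D (D f) x"
      unfolding c[OF x] by (rule Dcong) (use c faces_proper x in blast)
    then show ?thesis using DD[OF x] by simp
  qed
  then show ?thesis unfolding is_complex_def by simp
qed

section \<open>Complexes of chains of topes\<close>

lemma distinct_adj_split: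
  "distinct_adj (p @ b # q) \<longleftrightarrow> distinct_adj (p @ [b]) \<and> distinct_adj (b # q)"
  by (induction p rule: induct_list012) auto

lemma flip_add: "flip (\<alpha> + \<beta>) A = flip \<beta> (flip \<alpha> A)"
  by (auto simp: flip_def reorient_def fun_eq_iff)

lemma flip_ind [simp]: "flip (ind S) A = reorient S A"
  by (auto simp: flip_def reorient_def fun_eq_iff indicator_def)

lemma flip_0 [simp]: "flip 0 A = A"
  by (auto simp: flip_def reorient_def)

lemma flip_flip [simp]: "flip \<alpha> (flip \<alpha> A) = A"
  by (auto simp: flip_def reorient_def)

lemma face_iso_restrict:
  assumes "face_iso F I G J h" "I' \<subseteq> I"
  shows "face_iso F I' G (h ` I') h"
proof -
  have inj: "inj_on h I" and J: "J = h ` I" using assms by (auto simp: face_iso_def bij_betw_def)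
  have "G (h x) \<inter> h ` I' = h ` (F x \<inter> I')" if x: "x \<in> I'" for x
  proof -
    have "G (h x) \<inter> J = h ` (F x \<inter> I)" using assms x by (auto simp: face_iso_def)
    then have "G (h x) \<inter> h ` I' = h ` (F x \<inter> I) \<inter> h ` I'" using assms(2) J by blast
    also have "\<dots> = h ` (F x \<inter> I \<inter> I')"
      using inj_on_image_Int[OF inj, of "F x \<inter> I" I'] assms(2) by auto
    finally show ?thesis using assms(2) by (simp add: Int_assoc Int_absorb1)
  qed
  then show ?thesis
    using inj assms(2) by (auto simp: face_iso_def bij_betw_def intro: inj_on_subset)
qed

context hyperplanes
begin

lemma finite_T: "finite T"
proof -
  have "T \<subseteq> {f. \<forall>e. (e \<in> E \<longrightarrow> f e \<in> {1, - 1}) \<and> (e \<notin> E \<longrightarrow> f e = 0)}"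
    using tope_values tope_outside by blast
  moreover have "finite {f. \<forall>e. (e \<in> E \<longrightarrow> f e \<in> {1, - 1 :: real}) \<and> (e \<notin> E \<longrightarrow> f e = 0)}"
    by (rule finite_set_of_finite_funs) (use finite_E in auto)
  ultimately show ?thesis by (rule finite_subset)
qed

lemma Sep_sub_E: "A \<in> T \<Longrightarrow> X \<in> T \<Longrightarrow> Sep A X \<subseteq> E"
  using tope_outside[of A] tope_outside[of X] by (force simp: Sep_def)

lemma reorient_Sep: "A \<in> T \<Longrightarrow> X \<in> T \<Longrightarrow> reorient (Sep A X) A = X"
proof
  fix e assume "A \<in> T" "X \<in> T"
  then show "reorient (Sep A X) A e = X e"
    using tope_values[of A e] tope_values[of X e] tope_outside[of A e] tope_outside[of X e]
    by (cases "e \<in> E") (auto simp: reorient_def Sep_def)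
qed

lemma Sep_reorient: "A \<in> T \<Longrightarrow> S \<subseteq> E \<Longrightarrow> Sep A (reorient S A) = S"
  using tope_values[of A] by (force simp: reorient_def Sep_def)

text \<open>
  Chains of all lengths. Their common end is determined by \<open>A\<close> and
  \<open>\<gamma>\<close> (\<open>chains_from_last\<close>).
\<close>

definition chains_from :: "'e sign_vector \<Rightarrow> ('e \<Rightarrow> nat) \<Rightarrow> 'e sign_vector list set"
  where "chains_from A \<gamma> = {x. x \<noteq> [] \<and> hd x = A \<and> set x \<subseteq> T \<and> distinct_adj x \<and> crs x = \<gamma>}"

lemma chains_from_tope: "x \<in> chains_from A \<gamma> \<Longrightarrow> A \<in> T"
  by (cases x) (auto simp: chains_from_def)

lemma chains_from_single [simp]: "[X] \<in> chains_from A \<gamma> \<longleftrightarrow> X = A \<and> A \<in> T \<and> \<gamma> = 0"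
  by (auto simp: chains_from_def)

lemma chains_from_Cons:
  "a # X # q \<in> chains_from A \<gamma> \<longleftrightarrow> a = A \<and> A \<in> T \<and> A \<noteq> X \<and>
    (\<exists>\<delta>. \<gamma> = ind (Sep A X) + \<delta> \<and> X # q \<in> chains_from X \<delta>)"
  by (auto simp: chains_from_def)

lemma chains_from_zero: "A \<in> T \<Longrightarrow> chains_from A 0 = {[A]}"
proof -
  assume "A \<in> T"
  have "x = [A]" if "x \<in> chains_from A 0" for x
  proof -
    have "length x \<le> 1" "hd x = A" "x \<noteq> []" using that crs_eq_0_iff[of x] by (auto simp: chains_from_def)
    then show ?thesis by (cases x) auto
  qed
  then show ?thesis using \<open>A \<in> T\<close> by auto
qed

lemma chains_from_split:
  "p @ b # q \<in> chains_from A (\<beta> + \<alpha>) \<and> crs (p @ [b]) = \<beta> \<longleftrightarrow>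
    p @ [b] \<in> chains_from A \<beta> \<and> b # q \<in> chains_from b \<alpha>"
proof -
  have "hd (p @ b # q) = hd (p @ [b])" by (cases p) auto
  then show ?thesis
    using crs_append[of p b q] distinct_adj_split[of p b q] by (auto simp: chains_from_def)
qed

lemma chains_from_induct [consumes 1, case_names single Cons]:
  assumes "x \<in> chains_from A \<gamma>"
    and "\<And>A. A \<in> T \<Longrightarrow> P A 0 [A]"
    and "\<And>A X q \<delta>. A \<in> T \<Longrightarrow> X \<in> T \<Longrightarrow> A \<noteq> X \<Longrightarrow> X # q \<in> chains_from X \<delta> \<Longrightarrow> P X \<delta> (X # q) \<Longrightarrow>
      P A (ind (Sep A X) + \<delta>) (A # X # q)"
  shows "P A \<gamma> x"
  using assms(1)
proof (induction x arbitrary: A \<gamma> rule: induct_list012)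
  case 1
  then show ?case by (simp add: chains_from_def)
next
  case (3 a X q)
  then obtain \<delta> where "a = A" "A \<in> T" "A \<noteq> X" "\<gamma> = ind (Sep A X) + \<delta>" "X # q \<in> chains_from X \<delta>"
    by (auto simp: chains_from_Cons)
  then show ?case using 3(2) assms(3) chains_from_tope by blast
qed (use assms(2) in auto)

lemma chains_from_last:
  "x \<in> chains_from A \<gamma> \<Longrightarrow> last x = flip \<gamma> A \<and> flip \<gamma> A \<in> T"
  by (induction rule: chains_from_induct)
    (auto simp: reorient_Sep flip_0[unfolded zero_fun_def] flip_add[unfolded plus_fun_def])

lemma chains_from_length: "x \<in> chains_from A \<gamma> \<Longrightarrow> length x \<le> Suc (\<Sum>e\<in>E. \<gamma> e)"
proof (induction rule: chains_from_induct)
  case (Cons A X q \<delta>)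
  obtain e where e: "e \<in> Sep A X" using \<open>A \<noteq> X\<close> Sep_empty_iff[of A X] by blast
  then have "e \<in> E" using Sep_sub_E Cons by auto
  then have "(1::nat) \<le> (\<Sum>e\<in>E. indicator (Sep A X) e)"
    using member_le_sum[of e E "indicator (Sep A X) :: _ \<Rightarrow> nat"] e finite_E by simp
  then show ?case using Cons by (simp add: sum.distrib)
qed simp

lemma finite_chains_from: "finite (chains_from A \<gamma>)"
proof -
  have "chains_from A \<gamma> \<subseteq> {x. set x \<subseteq> T \<and> length x \<le> Suc (\<Sum>e\<in>E. \<gamma> e)}"
    using chains_from_length by (auto simp: chains_from_def)
  then show ?thesis using finite_lists_length_le[OF finite_T] finite_subset by blast
qed

lemma finite_chains_sub: "I \<subseteq> chains_from A \<gamma> \<Longrightarrow> finite I"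
  by (rule finite_subset[OF _ finite_chains_from])

lemma chains_from_faces: "x \<in> chains_from A \<gamma> \<Longrightarrow> y \<in> faces x \<Longrightarrow> y \<in> chains_from A \<gamma>"
  using faces_basic[of y x] faces_proper[of y x] by (auto simp: chains_from_def)

lemma complex_chains_from: "is_complex faces (chains_from A \<gamma>)"
proof (rule is_complex_closed[OF faces_complex])
  have "chains_from A \<gamma> \<subseteq> {x. distinct_adj x}" by (auto simp: chains_from_def)
  then show "closed_in faces {x. distinct_adj x} (chains_from A \<gamma>)"
    unfolding closed_in_def using chains_from_faces by blast
qed

lemma closed_chains_fromI:
  assumes "\<And>x y. x \<in> chains_from A \<gamma> \<Longrightarrow> y \<in> faces x \<Longrightarrow> P x \<Longrightarrow> P y"
  shows "closed_in faces (chains_from A \<gamma>) {x \<in> chains_from A \<gamma>. P x}"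
  using assms chains_from_faces by (auto simp: closed_in_def)

subsection \<open>Concatenation\<close>

abbreviation join :: "'e sign_vector list \<times> 'e sign_vector list \<Rightarrow> 'e sign_vector list"
  where "join \<equiv> (\<lambda>(x, y). x @ tl y)"

text \<open>
  Deleting the vertex at which a chain is cut makes it impossible to cut the chain with the same
  crossing vector.
\<close>

lemma cut_not_initial:
  assumes "p \<noteq> []" "q \<noteq> []" "Sep (last p) b \<inter> Sep b (hd q) = {}" "distinct_adj (p @ b # q)"
  shows "crs (p @ [b]) \<notin> initials (p @ q)"
proof
  assume "crs (p @ [b]) \<in> initials (p @ q)"
  then obtain p1 c q1 where c: "p @ q = p1 @ c # q1" "crs (p1 @ [c]) = crs (p @ [b])"
    by (auto simp: initials_iff)
  then consider r where "p = p1 @ c # r" | r where "p1 = p @ r" "q = r @ c # q1"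
    by (auto simp: append_eq_append_conv2 Cons_eq_append_conv append_eq_Cons_conv)
  then show False
  proof cases
    case 1
    then have "p @ b # q = p1 @ c # (r @ b # q)" by simp
    then have "p = p1" using cut_unique[OF _ assms(4)] c by metis
    then show False using 1 by simp
  next
    case 2
    have "hd (r @ [c]) = hd q" using 2 by (cases r) auto
    then have "p @ (r @ [c]) \<in> faces (p @ b # (r @ [c]))"
      using assms by (intro faces_deleteI) auto
    then have "crs (p @ b # r @ [c]) = crs (p @ [b])"
      using faces_basic(7) c 2 by fastforce
    moreover have "p @ b # q = (p @ b # r) @ c # q1" using 2 by simp
    ultimately have "p = p @ b # r" using cut_unique[OF _ assms(4)] by (metis append.assoc append_Cons)
    then show False by simp
  qed
qed

lemma join_cases:
  assumes "x \<in> chains_from A \<beta>" "y \<in> chains_from (flip \<beta> A) \<alpha>"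
  obtains p b q where "x = p @ [b]" "y = b # q" "b = flip \<beta> A" "x @ tl y = p @ b # q"
proof -
  have "last x = flip \<beta> A" "x \<noteq> []" using chains_from_last assms by (auto simp: chains_from_def)
  moreover have "hd y = flip \<beta> A" "y \<noteq> []" using assms by (auto simp: chains_from_def)
  ultimately show ?thesis
    using that[of "butlast x" "flip \<beta> A" "tl y"] by (metis append.assoc append_Cons append_Nil append_butlast_last_id list.collapse)
qed

lemma join_mem:
  assumes "x \<in> chains_from A \<beta>" "y \<in> chains_from (flip \<beta> A) \<alpha>"
  shows "x @ tl y \<in> chains_from A (\<beta> + \<alpha>)" "\<beta> \<in> initials (x @ tl y)"
proof -
  obtain p b q where b: "x = p @ [b]" "y = b # q" "b = flip \<beta> A" "x @ tl y = p @ b # q"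
    using join_cases[OF assms] by blast
  have "p @ b # q \<in> chains_from A (\<beta> + \<alpha>) \<and> crs (p @ [b]) = \<beta>"
    using assms b chains_from_split by blast
  then show "x @ tl y \<in> chains_from A (\<beta> + \<alpha>)" "\<beta> \<in> initials (x @ tl y)"
    using b by (auto simp: initials_iff)
qed

lemma cut_mem:
  assumes "z \<in> chains_from A (\<beta> + \<alpha>)" "\<beta> \<in> initials z"
  obtains p b q where "z = p @ b # q" "p @ [b] \<in> chains_from A \<beta>" "b # q \<in> chains_from (flip \<beta> A) \<alpha>"
proof -
  obtain p b q where z: "z = p @ b # q" "crs (p @ [b]) = \<beta>" using assms by (auto simp: initials_iff)
  then have m: "p @ [b] \<in> chains_from A \<beta>" "b # q \<in> chains_from b \<alpha>"
    using chains_from_split[of p b q A \<beta> \<alpha>] assms(1) by auto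
  then have "b = flip \<beta> A" using chains_from_last[OF m(1)] by simp
  then show ?thesis using that z m by auto
qed

lemma join_inj:
  assumes "x \<in> chains_from A \<beta>" "y \<in> chains_from (flip \<beta> A) \<alpha>"
    and "x' \<in> chains_from A \<beta>" "y' \<in> chains_from (flip \<beta> A) \<alpha>"
    and eq: "x @ tl y = x' @ tl y'"
  shows "x = x' \<and> y = y'"
proof -
  obtain p b q where b: "x = p @ [b]" "y = b # q" "x @ tl y = p @ b # q"
    using join_cases[OF assms(1,2)] by blast
  obtain p' b' q' where b': "x' = p' @ [b']" "y' = b' # q'" "x' @ tl y' = p' @ b' # q'"
    using join_cases[OF assms(3,4)] by blast
  have "distinct_adj (p @ b # q)" using join_mem(1)[OF assms(1,2)] b by (auto simp: chains_from_def)
  moreover have "crs (p @ [b]) = crs (p' @ [b'])" using assms b b' by (auto simp: chains_from_def)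
  ultimately show ?thesis using cut_unique[of p b q p' b' q'] eq b b' by auto
qed

text \<open>
  A face of a concatenation is a concatenation, unless the common vertex is deleted; then it cannot be
  cut after \<open>\<beta>\<close> any more.
\<close>

lemma join_iso:
  "face_iso (prod_faces faces faces) (chains_from A \<beta> \<times> chains_from (flip \<beta> A) \<alpha>)
     faces {z \<in> chains_from A (\<beta> + \<alpha>). \<beta> \<in> initials z} join"
  (is "face_iso _ ?I _ ?K _")
  unfolding face_iso_def
proof (intro conjI ballI)
  have "inj_on join ?I" by (rule inj_onI; clarsimp; metis join_inj)
  moreover have "join ` ?I = ?K"
  proof (intro set_eqI iffI)
    fix z assume "z \<in> ?K"
    then obtain p b q where z: "z = p @ b # q" "p @ [b] \<in> chains_from A \<beta>" "b # q \<in> chains_from (flip \<beta> A) \<alpha>"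
      using cut_mem by blast
    then have "z = join (p @ [b], b # q)" by simp
    then show "z \<in> join ` ?I" using z by blast
  qed (use join_mem in auto)
  ultimately show "bij_betw join ?I ?K" by (simp add: bij_betw_def)
next
  fix w assume "w \<in> ?I"
  then obtain x y where w: "w = (x, y)" and x: "x \<in> chains_from A \<beta>" and y: "y \<in> chains_from (flip \<beta> A) \<alpha>"
    by auto
  obtain p b q where b: "x = p @ [b]" "y = b # q" "x @ tl y = p @ b # q"
    using join_cases[OF x y] by blast
  have "(\<lambda>y'. y' @ q) ` faces x = join ` (faces x \<times> {y})" by (auto simp: b image_iff)
  moreover have "(\<lambda>z. p @ z) ` faces y = join ` ({x} \<times> faces y)"
  proof -
    have "p @ z = join (x, z)" if "z \<in> faces y" for z
      using faces_basic(2,5)[OF that] b by (cases z) auto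
    then show ?thesis by (force simp: image_iff)
  qed
  ultimately have f: "faces (join w) = join ` prod_faces faces faces w \<union>
      (if p \<noteq> [] \<and> q \<noteq> [] \<and> Sep (last p) b \<inter> Sep b (hd q) = {} then {p @ q} else {})"
    using faces_append[of p b q] b by (simp add: w prod_faces_def image_Un)
  have dist: "distinct_adj (p @ b # q)" using join_mem(1)[OF x y] b by (auto simp: chains_from_def)
  have "p @ q \<notin> ?K" if "p \<noteq> [] \<and> q \<noteq> [] \<and> Sep (last p) b \<inter> Sep b (hd q) = {}"
    using cut_not_initial[of p q b] that dist x b by (auto simp: chains_from_def)
  then have "faces (join w) \<inter> ?K = join ` prod_faces faces faces w \<inter> ?K" unfolding f by auto
  also have pI: "prod_faces faces faces w \<subseteq> ?I"
    using x y chains_from_faces by (auto simp: w prod_faces_def)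
  then have "join ` prod_faces faces faces w \<inter> ?K = join ` prod_faces faces faces w"
    using join_mem by fastforce
  finally show "faces (join w) \<inter> ?K = join ` (prod_faces faces faces w \<inter> ?I)"
    using pI by (simp add: Int_absorb2)
qed

lemma join_iso_sub:
  assumes "I \<subseteq> chains_from A \<beta>" "L \<subseteq> chains_from (flip \<beta> A) \<alpha>"
  shows "face_iso (prod_faces faces faces) (I \<times> L) faces (join ` (I \<times> L)) join"
  by (rule face_iso_restrict[OF join_iso[of A \<beta> \<alpha>]]) (use assms in auto)

lemma exact_join_left:
  assumes "I \<subseteq> chains_from A \<beta>" "L \<subseteq> chains_from (flip \<beta> A) \<alpha>"
    "is_complex faces I" "is_complex faces L" "exact faces I"
  shows "exact faces (join ` (I \<times> L))"
  by (rule exact_iso[OF join_iso_sub[OF assms(1,2)]], rule exact_prod_left[where deg = length])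
     (use assms finite_chains_sub faces_basic(1) in blast)+

lemma exact_join_right:
  assumes "I \<subseteq> chains_from A \<beta>" "L \<subseteq> chains_from (flip \<beta> A) \<alpha>"
    "is_complex faces I" "is_complex faces L" "exact faces L"
  shows "exact faces (join ` (I \<times> L))"
  by (rule exact_iso[OF join_iso_sub[OF assms(1,2)]], rule exact_prod_right[where deg = length])
     (use assms finite_chains_sub faces_basic(1) in blast)+

text \<open>
  The chains that can be cut after crossing \<open>\<beta>\<close> span the quotient by this
  subcomplex, and by \<open>join_iso\<close> this quotient is a tensor product. The results of the
  following sections say when the subcomplex is exact.
\<close>

definition uncut :: "'e sign_vector \<Rightarrow> ('e \<Rightarrow> nat) \<Rightarrow> ('e \<Rightarrow> nat) \<Rightarrow> 'e sign_vector list set"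
  where "uncut A \<gamma> \<beta> = {x \<in> chains_from A \<gamma>. \<beta> \<notin> initials x}"

lemma closed_uncut: "closed_in faces (chains_from A \<gamma>) (uncut A \<gamma> \<beta>)"
  unfolding uncut_def by (rule closed_chains_fromI) (use faces_basic(8) in blast)

lemma chains_minus_uncut:
  "chains_from A (\<beta> + \<alpha>) - uncut A (\<beta> + \<alpha>) \<beta> = join ` (chains_from A \<beta> \<times> chains_from (flip \<beta> A) \<alpha>)"
  using join_iso[of A \<beta> \<alpha>] by (auto simp: uncut_def face_iso_def bij_betw_def)

subsection \<open>Chains whose first step crosses a hyperplane through a face\<close>

definition meets :: "'e set \<Rightarrow> 'e sign_vector list \<Rightarrow> bool"
  where "meets U x \<longleftrightarrow> (\<exists>a b q. x = a # b # q \<and> Sep a b \<inter> U \<noteq> {})"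

lemma meets_Cons [simp]: "meets U (a # b # q) \<longleftrightarrow> Sep a b \<inter> U \<noteq> {}"
  by (auto simp: meets_def)

lemma meets_single [simp]: "\<not> meets U [a]"
  by (simp add: meets_def)

lemma meets_faces:
  assumes "y \<in> faces x" "meets U x"
  shows "meets U y"
proof -
  obtain a b q where x: "x = a # b # q" "Sep a b \<inter> U \<noteq> {}" using assms by (auto simp: meets_def)
  then obtain c r where q: "q = c # r" using assms(1) by (cases q) auto
  show ?thesis
  proof (cases "y = a # c # r \<and> Sep a b \<inter> Sep b c = {}")
    case True
    then show ?thesis using x Sep_smooth[of a b c] by auto
  next
    case False
    then obtain z where z: "y = a # z" "z \<in> faces (b # c # r)" using assms(1) x q by (auto split: if_splits)
    then obtain w where "z = b # w" using faces_basic[OF z(2)] by (cases z) auto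
    then show ?thesis using x z by auto
  qed
qed

definition meeting :: "'e sign_vector \<Rightarrow> ('e \<Rightarrow> nat) \<Rightarrow> 'e set \<Rightarrow> 'e sign_vector list set"
  where "meeting A \<gamma> U = {x \<in> chains_from A \<gamma>. meets U x}"

lemma closed_meeting: "closed_in faces (chains_from A \<gamma>) (meeting A \<gamma> U)"
  unfolding meeting_def by (rule closed_chains_fromI) (use meets_faces in blast)

lemma dropWhile_faces:
  assumes "y \<in> faces x"
  shows "dropWhile P y = dropWhile P x \<or> length (dropWhile P y) < length (dropWhile P x)"
  using assms
proof (induction x arbitrary: y rule: faces.induct)
  case (1 a b c q)
  show ?case
  proof (cases "P a")
    case False
    then show ?thesis
      using faces_basic(1)[OF 1(2)] length_dropWhile_le[of P y] by auto
  next
    case True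
    show ?thesis
    proof (cases "y = a # c # q")
      case True
      then show ?thesis using \<open>P a\<close> length_dropWhile_le[of P "c # q"] by auto
    next
      case False
      then obtain z where z: "y = a # z" "z \<in> faces (b # c # q)" using 1 by (auto split: if_splits)
      show ?thesis using 1(1)[OF z(2)] z(1) True by auto
    qed
  qed
qed auto

text \<open>
  If the crossings do not stay inside \<open>U\<close>, let \<open>X\<close> be the first vertex that
  differs from \<open>A\<close> off \<open>U\<close>. The vertices before \<open>X\<close> are in the
  star of the face cut out by \<open>U\<close>, and there is a geodesic from each of them to
  \<open>X\<close> through \<open>proj U A X\<close>. So this vertex can be inserted before
  \<open>X\<close> or deleted. The only chains that would be left unmatched are those in which
  \<open>A\<close> itself is this vertex and is followed by \<open>X\<close>; their first step does
  not cross \<open>U\<close>. The acyclic matching is expressed by two filtrations, first by the part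
  of the chain from \<open>X\<close> on and then by the part before \<open>X\<close>, without its last
  vertex if that is the projection of \<open>X\<close>.
\<close>

lemma exact_meeting:
  assumes A: "A \<in> T" and U: "facial A U" and e0: "e0 \<notin> U" "\<gamma> e0 \<noteq> 0"
  shows "exact faces (meeting A \<gamma> U)"
proof -
  let ?I = "meeting A \<gamma> U"
  define P where "P X \<longleftrightarrow> (\<forall>e. e \<notin> U \<longrightarrow> X e = A e)" for X :: "'e sign_vector"
  have PA: "P A" by (simp add: P_def)
  have Pproj: "P (proj U A X)" for X by (simp add: P_def proj_def)
  have cI: "is_complex faces ?I" by (rule is_complex_closed[OF complex_chains_from closed_meeting])
  have finI: "finite ?I" using finite_chains_sub[of ?I A \<gamma>] by (auto simp: meeting_def)
  have not_all: "dropWhile P x \<noteq> []" if "x \<in> ?I" for x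
  proof
    assume "dropWhile P x = []"
    then have all: "\<forall>X\<in>set x. P X" by (simp add: dropWhile_eq_Nil_conv)
    have "crs x e0 = 0" if "\<forall>X\<in>set x. X e0 = A e0" for x
      using that by (induction x rule: induct_list012) (auto simp: Sep_def)
    then show False using all \<open>x \<in> ?I\<close> e0 by (auto simp: P_def meeting_def chains_from_def)
  qed
  show ?thesis
  proof (rule exact_filtration[OF finI cI, where p = "dropWhile P" and r = "\<lambda>s. int (length s)"])
    fix s
    define J where "J = {x \<in> ?I. dropWhile P x = s}"
    show "exact faces {x \<in> ?I. dropWhile P x = s}"
    proof (cases "J = {}")
      case True then show ?thesis unfolding J_def by (metis exact_empty)
    next
      case False
      then obtain X s' where s: "s = X # s'" using not_all by (cases s) (auto simp: J_def)
      obtain x where "dropWhile P x = s" using False by (auto simp: J_def)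
      then have nP: "\<not> P X" using s hd_dropWhile[of P x] by simp
      define FX where "FX = proj U A X"
      have PFX: "P FX" by (simp add: FX_def Pproj)
      have J_iff: "x \<in> J \<longleftrightarrow> x \<in> ?I \<and> (\<exists>p. x = p @ s \<and> p \<noteq> [] \<and> (\<forall>Z\<in>set p. P Z))" for x
      proof
        assume x: "x \<in> J"
        then have "x = takeWhile P x @ s" by (metis (mono_tags) J_def mem_Collect_eq takeWhile_dropWhile_id)
        moreover have "takeWhile P x \<noteq> []"
        proof -
          have "hd x = A" "x \<noteq> []" using x by (auto simp: J_def meeting_def chains_from_def)
          then show ?thesis using PA by (cases x) auto
        qed
        ultimately show "x \<in> ?I \<and> (\<exists>p. x = p @ s \<and> p \<noteq> [] \<and> (\<forall>Z\<in>set p. P Z))"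
          using x set_takeWhileD[of _ P x] unfolding J_def by blast
      next
        assume "x \<in> ?I \<and> (\<exists>p. x = p @ s \<and> p \<noteq> [] \<and> (\<forall>Z\<in>set p. P Z))"
        then show "x \<in> J" using nP s by (auto simp: J_def dropWhile_append)
      qed
      define t where "t x = (let p = takeWhile P x in if last p = FX then butlast p else p)" for x
      have tw: "takeWhile P (p @ s) = p" if "\<forall>Z\<in>set p. P Z" for p
        using that nP s by (simp add: takeWhile_append)
      have t_app: "t (p @ s) = (if last p = FX then butlast p else p)" if "\<forall>Z\<in>set p. P Z" for p
        using tw[OF that] by (simp add: t_def)
      have cJ: "is_complex faces J"
      proof (rule is_complex_convex[OF cI])
        fix x y z assume "x \<in> J" "y \<in> faces x \<inter> ?I" "z \<in> faces y \<inter> J"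
        then show "y \<in> J"
          using dropWhile_faces[of y x P] dropWhile_faces[of z y P] by (auto simp: J_def)
      qed (auto simp: J_def)
      have toggle: "p @ s \<in> ?I \<longleftrightarrow> (p @ [FX]) @ s \<in> ?I"
        if p: "p \<noteq> []" "\<forall>Z\<in>set p. P Z" "last p \<noteq> FX" for p
      proof -
        define l where "l = last p"
        have Pl: "P l" using p by (auto simp: l_def)
        have sep: "Sep l FX \<inter> Sep FX X = {}" "Sep l X \<inter> U = Sep l FX \<inter> U"
          using Pl by (auto simp: Sep_def FX_def proj_def P_def)
        have sub: "p @ s \<in> faces ((p @ [FX]) @ s)"
          using faces_deleteI[of p s FX] p sep s by (simp add: l_def)
        have dist: "distinct_adj ((p @ [FX]) @ s) \<longleftrightarrow> distinct_adj (p @ s)"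
          using p PFX nP s by (auto simp: distinct_adj_append_iff distinct_adj_Cons)
        have hd: "hd ((p @ [FX]) @ s) = hd (p @ s)" using p by (cases p) auto
        have mt: "meets U ((p @ [FX]) @ s) \<longleftrightarrow> meets U (p @ s)"
        proof (cases p)
          case (Cons a p')
          then show ?thesis using sep(2) s by (cases p') (auto simp: l_def)
        qed (use p in simp)
        have "FX \<in> T" if "p @ s \<in> ?I"
          using that proj_tope[OF A _ U, of X] s by (auto simp: FX_def meeting_def chains_from_def)
        then show ?thesis
          using dist hd mt faces_basic(7)[OF sub] by (auto simp: meeting_def chains_from_def)
      qed
      have "exact faces J"
      proof (rule exact_filtration[OF _ cJ, where p = t and r = "\<lambda>p. int (length p)"])
        show "finite J" using finI by (auto simp: J_def)
      next
        fix x y assume "x \<in> J" "y \<in> faces x \<inter> J"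
        then obtain p p' where x: "x = p @ s" "p \<noteq> []" "\<forall>Z\<in>set p. P Z"
          and y: "y = p' @ s" "p' \<noteq> []" "\<forall>Z\<in>set p'. P Z" and yx: "y \<in> faces x"
          by (auto simp: J_iff)
        have len: "length p = Suc (length p')" using faces_basic(1)[OF yx] x y by simp
        \<comment> \<open>If the projection disappears from the end of the first part, it is the vertex that was
          deleted.\<close>
        show "t y = t x \<or> int (length (t y)) < int (length (t x))"
        proof (cases "last p = FX \<and> last p' \<noteq> FX")
          case False
          then show ?thesis using x y len by (auto simp: t_app)
        next
          case True
          obtain u b v where u: "x = u @ b # v" "y = u @ v" "u \<noteq> []" "v \<noteq> []"
            using faces_delete[OF yx] by blast
          have "p' = butlast p"
          proof -
            have "p @ s = u @ b # v" using u(1) x(1) by simp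
            then consider w where "p = u @ b # w" "v = w @ s" | w where "u = p @ w" "s = w @ b # v"
              unfolding append_eq_append_conv2 by (metis append_Nil2 append_eq_Cons_conv append_Nil)
            then show ?thesis
            proof cases
              case 1
              then have "p' = u @ w" using u(2) y(1) by auto
              then show ?thesis using 1 True by (cases "w = []") (auto simp: butlast_append)
            next
              case 2
              have "p' @ s = p @ (w @ v)" using 2 u y by simp
              then have "take (length p) (p' @ s) = p" by simp
              then have "p' @ [X] = p" using len s by simp
              then show ?thesis by auto
            qed
          qed
          then show ?thesis using True x y by (simp add: t_app)
        qed
      next
        fix p0
        show "exact faces {x \<in> J. t x = p0}"
        proof (cases "{x \<in> J. t x = p0} = {}")
          case False
          then obtain x p where x: "x = p @ s" "p \<noteq> []" "\<forall>Z\<in>set p. P Z" "x \<in> ?I" "t x = p0"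
            by (auto simp: J_iff)
          have dp: "distinct_adj p" "hd p = A"
            using x by (auto simp: meeting_def chains_from_def distinct_adj_append_iff)
          have p0: "p0 \<noteq> []" "\<forall>Z\<in>set p0. P Z" "last p0 \<noteq> FX" "p = p0 \<or> p = p0 @ [FX]"
          proof -
            show "p = p0 \<or> p = p0 @ [FX]"
              using x t_app[OF x(3)] by (metis append_butlast_last_id)
            show "\<forall>Z\<in>set p0. P Z" using x(3,5) t_app[OF x(3)] x(1) in_set_butlastD[of _ p] by (metis (full_types))
            show "p0 \<noteq> []"
            proof
              assume "p0 = []"
              then have "p = [FX]" using \<open>p = p0 \<or> p = p0 @ [FX]\<close> x by auto
              then have "FX = A" using dp by simp
              then have "Sep A X \<inter> U = {}" by (auto simp: FX_def proj_def Sep_def fun_eq_iff) metis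
              then show False using x \<open>p = [FX]\<close> \<open>FX = A\<close> s by (auto simp: meeting_def)
            qed
            show "last p0 \<noteq> FX"
            proof
              assume l: "last p0 = FX"
              have "last p = FX" using \<open>p = p0 \<or> p = p0 @ [FX]\<close> l by auto
              then have "p = p0 @ [FX]" using x t_app[OF x(3)] by (metis append_butlast_last_id)
              then show False using dp l \<open>p0 \<noteq> []\<close> by (auto simp: distinct_adj_append_iff)
            qed
          qed
          let ?a = "p0 @ s" and ?b = "(p0 @ [FX]) @ s"
          have "?a \<in> ?I \<or> ?b \<in> ?I" using p0(4) x(1,4) by metis
          then have ab: "?a \<in> ?I" "?b \<in> ?I" using toggle[OF p0(1-3)] by blast+
          have "{x \<in> J. t x = p0} = {?a, ?b}"
          proof (intro set_eqI iffI)
            fix z assume "z \<in> {x \<in> J. t x = p0}"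
            then obtain p' where p': "z = p' @ s" "p' \<noteq> []" "\<forall>Z\<in>set p'. P Z" "t z = p0" by (auto simp: J_iff)
            then have "p' = p0 \<or> p' = p0 @ [FX]" using t_app[OF p'(3)] by (metis append_butlast_last_id)
            then show "z \<in> {?a, ?b}" using p' by auto
          next
            fix z assume "z \<in> {?a, ?b}"
            moreover have "?a \<in> J" "t ?a = p0" using ab p0 t_app[of p0] by (auto simp: J_iff)
            moreover have "?b \<in> J" "t ?b = p0"
              using ab p0 t_app[of "p0 @ [FX]"] PFX unfolding J_iff by fastforce+
            ultimately show "z \<in> {x \<in> J. t x = p0}" by auto
          qed
          moreover have "exact faces {?a, ?b}"
          proof (rule exact_pair)
            show "faces ?a \<inter> {?a, ?b} = {}" using faces_basic(1)[of _ ?a] by fastforce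
            have "Sep (last p0) FX \<inter> Sep FX X = {}"
              using p0 by (auto simp: Sep_def FX_def proj_def P_def)
            then have "?a \<in> faces ?b" using faces_deleteI[of p0 s FX] p0 s by simp
            then show "faces ?b \<inter> {?a, ?b} = {?a}" using faces_basic(1)[of _ ?b] by fastforce
          qed
          ultimately show ?thesis by simp
        qed (metis exact_empty)
      qed
      then show ?thesis by (simp add: J_def)
    qed
  qed (use dropWhile_faces[of _ _ P] in force)
qed

section \<open>Geodesic chains\<close>

abbreviation second :: "'b list \<Rightarrow> 'b"
  where "second x \<equiv> hd (tl x)"

lemma second_faces:
  assumes "y \<in> faces (a # x)" "distinct_adj (a # x)"
  shows "second y = hd x \<or> Sep a (hd x) \<subset> Sep a (second y)"
proof -
  obtain b c q where x: "x = b # c # q" using assms(1) by (cases x rule: faces.cases) (auto elim: faces.elims)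
  have bc: "b \<noteq> c" using assms(2) x by simp
  show ?thesis
  proof (cases "y = a # c # q \<and> Sep a b \<inter> Sep b c = {}")
    case True
    have "Sep b c \<noteq> {}" using bc by simp
    then have "Sep a b \<subset> Sep a c" using Sep_smooth[of a b c] True by blast
    then show ?thesis using x True by simp
  next
    case False
    then obtain z where z: "y = a # z" "z \<in> faces (b # c # q)" using assms(1) x by (auto split: if_splits)
    then show ?thesis using faces_basic(2)[OF z(2)] x by auto
  qed
qed

lemma chains_from_nonzero:
  assumes "x \<in> chains_from A \<gamma>" "\<gamma> \<noteq> 0"
  shows "\<exists>X q. x = A # X # q"
proof (cases x)
  case (Cons a y)
  then show ?thesis using assms by (cases y) (auto simp: chains_from_def)
qed (use assms in \<open>auto simp: chains_from_def\<close>)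

text \<open>
  Of the faces of a chain that starts with \<open>A\<close>, \<open>X\<close>, only the deletion of
  \<open>X\<close> does not come from a face of the rest; it changes the second vertex.
\<close>

lemma Cons_iso:
  assumes "A \<in> T" "A \<noteq> X"
  shows "face_iso faces (chains_from X \<delta>) faces
    {x \<in> chains_from A (ind (Sep A X) + \<delta>). second x = X} (Cons A)" (is "face_iso _ ?I _ ?K _")
  unfolding face_iso_def
proof (intro conjI ballI)
  have "Cons A ` ?I = ?K"
  proof (intro set_eqI iffI)
    fix x assume "x \<in> Cons A ` ?I"
    then obtain y where y: "x = A # y" "y \<in> ?I" by blast
    then obtain q where "y = X # q" by (cases y) (auto simp: chains_from_def)
    then have q: "x = A # X # q" "X # q \<in> ?I" using y by auto
    then show "x \<in> ?K" using assms by (auto simp: chains_from_Cons)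
  next
    fix x assume x: "x \<in> ?K"
    then have "x \<noteq> []" "hd x = A" by (auto simp: chains_from_def)
    moreover have "tl x \<noteq> []"
    proof
      assume "tl x = []"
      then have "x = [A]" using \<open>x \<noteq> []\<close> \<open>hd x = A\<close> by (cases x) auto
      then have "ind (Sep A X) + \<delta> = 0" using x by (auto simp: chains_from_def)
      then have "ind (Sep A X) = 0" by (simp only: fun_add_eq_0_iff)
      then show False using assms by simp
    qed
    ultimately obtain q where q: "x = A # X # q" using x by (metis (mono_tags, lifting) list.collapse mem_Collect_eq)
    then show "x \<in> Cons A ` ?I" using x by (auto simp: chains_from_Cons)
  qed
  then show "bij_betw (Cons A) ?I ?K" by (simp add: bij_betw_def)
next
  fix y assume y: "y \<in> ?I"
  then obtain q where q: "y = X # q" by (cases y) (auto simp: chains_from_def)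
  have fI: "faces y \<subseteq> ?I" using y chains_from_faces by auto
  have inK: "Cons A z \<in> ?K" if "z \<in> faces y" for z
  proof -
    have "z \<in> ?I" "hd z = X" "z \<noteq> []" using fI that faces_basic[OF that] q by auto
    then obtain r where "z = X # r" "X # r \<in> ?I" by (cases z) auto
    then show ?thesis using assms by (auto simp: chains_from_Cons)
  qed
  show "faces (A # y) \<inter> ?K = Cons A ` (faces y \<inter> ?I)"
  proof (cases q)
    case Nil
    then show ?thesis using q by simp
  next
    case (Cons c r)
    have "X \<noteq> c" using y q Cons by (auto simp: chains_from_def)
    then have "A # c # r \<notin> ?K" by auto
    then have "faces (A # y) \<inter> ?K = Cons A ` faces y" using inK Cons q by auto
    then show ?thesis using fI by (simp add: Int_absorb2)
  qed
qed

text \<open>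
  Passing to a face can only enlarge the set of hyperplanes crossed by the first step.
\<close>

lemma exact_first_steps:
  assumes K: "K \<subseteq> chains_from A \<gamma>" "is_complex faces K" and "\<gamma> \<noteq> 0"
    and fibers: "\<And>X. exact faces {x \<in> K. second x = X}"
  shows "exact faces K"
proof (rule exact_filtration[where p = second and r = "\<lambda>X. - int (card (Sep A X))", OF _ K(2) _ fibers])
  show "finite K" using K(1) by (rule finite_chains_sub)
  fix x y assume x: "x \<in> K" and y: "y \<in> faces x \<inter> K"
  obtain X q where X: "x = A # X # q" using chains_from_nonzero x K(1) \<open>\<gamma> \<noteq> 0\<close> by blast
  obtain Z r where Z: "y = A # Z # r" using chains_from_nonzero y K(1) \<open>\<gamma> \<noteq> 0\<close> by blast
  have "distinct_adj x" "y \<in> chains_from A \<gamma>" using x y K(1) by (auto simp: chains_from_def)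
  then have "Z = X \<or> Sep A X \<subset> Sep A Z" "A \<in> T" "Z \<in> T"
    using second_faces[of y A "X # q"] y X Z by (auto simp: chains_from_def)
  moreover from this have "finite (Sep A Z)" using Sep_sub_E finite_sub by blast
  ultimately show "second y = second x \<or> - int (card (Sep A (second y))) < - int (card (Sep A (second x)))"
    using X Z psubset_card_mono[of "Sep A Z" "Sep A X"] by auto
qed

lemma ind_plus_eq:
  assumes "ind S = ind D + \<delta>"
  shows "D \<subseteq> S" "\<delta> = ind (S - D)"
proof -
  have e: "indicator S e = indicator D e + \<delta> e" for e
    using assms by (metis plus_fun_apply)
  have "e \<in> S" if "e \<in> D" for e using e[of e] that by (cases "e \<in> S") simp_all
  then show "D \<subseteq> S" by auto
  show "\<delta> = ind (S - D)"
  proof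
    fix x show "\<delta> x = ind (S - D) x"
      using e[of x] \<open>D \<subseteq> S\<close> by (cases "x \<in> S"; cases "x \<in> D") auto
  qed
qed

lemma ind_plus_Diff: "D \<subseteq> S \<Longrightarrow> ind D + ind (S - D) = ind S"
  by (auto simp: fun_eq_iff indicator_def)

lemma generates_point: "A \<in> T \<Longrightarrow> generates faces length (chains_from A 0) 1 (\<lambda>x. if x = [A] then 1 else 0)"
proof -
  assume A: "A \<in> T"
  have "\<exists>c. coboundary faces {[A]} (\<lambda>x. g x + c * (if x = [A] then 1 else 0))" for g
    by (rule exI[of _ "g [A]"]) (auto simp: coboundary_def cobd_def)
  then show ?thesis
    by (auto simp: chains_from_zero[OF A] generates_def cocycle_def coboundary_def cobd_def)
qed

text \<open>
  The chains from \<open>A\<close> that cross each hyperplane of \<open>S\<close> once, and no other.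
  Choose \<open>U\<close> facial for \<open>A\<close> and not containing \<open>S\<close> such that
  \<open>U \<inter> S\<close> is as large as possible. The chains whose first step crosses
  \<open>U\<close> are exact by \<open>exact_meeting\<close>. The others are filtered by their first
  step from \<open>A\<close> to \<open>X\<close>, the pieces being complexes of the same kind for
  \<open>X\<close> and \<open>S - Sep A X\<close>. By induction such a piece is exact unless \<open>S
  - Sep A X\<close> is facial for \<open>X\<close>. In that case \<open>facial_exchange\<close>
  provides a facial set for \<open>A\<close> between \<open>U \<inter> S\<close> and \<open>S\<close>.
  By maximality it is \<open>S\<close>, so \<open>S\<close> is facial, and \<open>Sep A X = S -
  U\<close> determines \<open>X\<close>. The remaining piece belongs to the face cut out by \<open>U
  \<inter> S\<close>, whose rank is one less than that of \<open>S\<close>.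
\<close>

theorem geodesic_cohomology:
  assumes "A \<in> T" "S \<subseteq> E"
  shows "(facial A S \<longrightarrow> (\<exists>f. generates faces length (chains_from A (ind S)) (Suc (rk \<phi> S)) f)) \<and>
    (\<not> facial A S \<longrightarrow> exact faces (chains_from A (ind S)))"
  using assms
proof (induction "card S" arbitrary: A S rule: less_induct)
  case less
  note A = less.prems(1) and S = less.prems(2)
  show ?case
  proof (cases "S = {}")
    case True
    then show ?thesis using generates_point[OF A] facial_empty[OF A] by auto
  next
    case False
    let ?I = "chains_from A (ind S)"
    let ?C = "{U. facial A U \<and> \<not> S \<subseteq> U}"
    have "\<exists>U. U \<in> ?C \<and> (\<forall>U'. U' \<in> ?C \<longrightarrow> card (U' \<inter> S) \<le> card (U \<inter> S))"
    proof (rule ex_has_greatest_nat[where b = "Suc (card S)"])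
      show "{} \<in> ?C" using facial_empty[OF A] False by simp
      show "\<forall>U. U \<in> ?C \<longrightarrow> card (U \<inter> S) < Suc (card S)"
        using finite_sub[OF S] by (auto simp: less_Suc_eq_le intro: card_mono)
    qed
    then obtain U where U: "facial A U" "\<not> S \<subseteq> U"
      and U_max: "\<And>U'. facial A U' \<Longrightarrow> \<not> S \<subseteq> U' \<Longrightarrow> card (U' \<inter> S) \<le> card (U \<inter> S)" by auto
    have max: "U' = S" if "facial A U'" "U \<inter> S \<subset> U'" "U' \<subseteq> S" for U'
    proof (rule ccontr)
      assume "U' \<noteq> S"
      then have "card (U' \<inter> S) \<le> card (U \<inter> S)" using U_max that by auto
      moreover have "card (U \<inter> S) < card (U' \<inter> S)"
        using that finite_sub[OF S] by (intro psubset_card_mono) auto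
      ultimately show False by simp
    qed
    define W where "W = meeting A (ind S) U"
    obtain e0 where e0: "e0 \<in> S" "e0 \<notin> U" using U by auto
    have W: "closed_in faces ?I W" "exact faces W"
      using closed_meeting exact_meeting[OF A U(1) e0(2)] e0(1) by (auto simp: W_def)
    define K where "K = ?I - W"
    have cK: "is_complex faces K" unfolding K_def by (rule is_complex_Diff_closed[OF complex_chains_from W(1)])
    define Xs where "Xs = reorient (S - U) A"
    have elim: "\<exists>X q. x = A # X # q \<and> X \<in> T \<and> A \<noteq> X \<and> Sep A X \<subseteq> S - U" if "x \<in> K" for x
    proof -
      have "x \<in> ?I" using that by (simp add: K_def)
      then obtain X q where x: "x = A # X # q"
        using chains_from_nonzero[of x A "ind S"] False by auto
      then have "A \<noteq> X" "Sep A X \<subseteq> S"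
        using \<open>x \<in> ?I\<close> ind_plus_eq(1) by (auto simp: chains_from_Cons)
      moreover have "Sep A X \<inter> U = {}" using that x by (auto simp: K_def W_def meeting_def)
      moreover have "X \<in> T" using \<open>x \<in> ?I\<close> x by (auto simp: chains_from_def)
      ultimately show ?thesis using x by auto
    qed
    have fiber: "{x \<in> K. second x = X} = {x \<in> chains_from A (ind (Sep A X) + ind (S - Sep A X)). second x = X}"
      if "Sep A X \<subseteq> S - U" "A \<noteq> X" for X
    proof -
      have e: "ind (Sep A X) + ind (S - Sep A X) = ind S" using that by (intro ind_plus_Diff) auto
      have "x \<notin> W" if "x \<in> ?I" "second x = X" for x
        using that \<open>Sep A X \<subseteq> S - U\<close> by (auto simp: W_def meeting_def meets_def chains_from_def)
      then show ?thesis unfolding e K_def by auto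
    qed
    have iso: "face_iso faces (chains_from X (ind (S - Sep A X))) faces {x \<in> K. second x = X} (Cons A)"
      if "Sep A X \<subseteq> S - U" "A \<noteq> X" for X
      unfolding fiber[OF that] by (rule Cons_iso[OF A that(2)])
    have smaller: "card (S - Sep A X) < card S" if "Sep A X \<subseteq> S - U" "A \<noteq> X" for X
    proof -
      have "Sep A X \<noteq> {}" using that by simp
      then have "S - Sep A X \<subset> S" using that by blast
      then show ?thesis using finite_sub[OF S] by (intro psubset_card_mono) auto
    qed
    have crit: "facial A S \<and> Sep A X = S - U \<and> X = Xs"
      if X: "Sep A X \<subseteq> S - U" "A \<noteq> X" "X \<in> T" "facial X (S - Sep A X)" for X
    proof -
      have "Sep A X \<noteq> {}" using X(2) by simp
      then obtain U' where U': "facial A U'" "U \<inter> S \<subset> U'" "U' \<subseteq> S" "U' \<subseteq> U \<union> Sep A X"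
        using facial_exchange[OF A X(3) U(1) S X(1) _ X(4)] by blast
      have "U' = S" using max[OF U'(1-3)] .
      then have "Sep A X = S - U" using U'(4) X(1) by auto
      then show ?thesis using U'(1) \<open>U' = S\<close> reorient_Sep[OF A X(3)] by (auto simp: Xs_def)
    qed
    have fiber_exact: "exact faces {x \<in> K. second x = X}" if "\<not> (facial A S \<and> X = Xs)" for X
    proof (cases "{x \<in> K. second x = X} = {}")
      case False
      then obtain X' q where x: "A # X' # q \<in> K" "X' = X" "X \<in> T" "A \<noteq> X" "Sep A X \<subseteq> S - U"
        using elim by force
      then have "\<not> facial X (S - Sep A X)" using crit that by blast
      then have "exact faces (chains_from X (ind (S - Sep A X)))"
        using less.hyps[OF smaller[OF x(5,4)] x(3)] S by blast
      then show ?thesis using exact_iso[OF iso[OF x(5,4)]] by blast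
    qed (metis exact_empty)
    have indS: "ind S \<noteq> 0" and KI: "K \<subseteq> ?I" using False by (auto simp: K_def)
    show ?thesis
    proof (cases "facial A S")
      case fS: False
      have "exact faces K"
        by (rule exact_first_steps[OF KI cK indS]) (use fiber_exact fS in auto)
      then have "exact faces ?I"
        using exact_extension[OF complex_chains_from W] by (simp add: K_def)
      then show ?thesis using fS by simp
    next
      case fS: True
      define V where "V = U \<inter> S"
      have V: "facial A V" "V \<subset> S" using facial_Int[OF U(1) fS] U(2) by (auto simp: V_def)
      have SV: "S - V = S - U" by (auto simp: V_def)
      have Xs: "Xs \<in> T" "facial Xs V"
        using facial_opposite[OF A fS V(1)] V(2) by (auto simp: Xs_def SV)
      have SepXs: "Sep A Xs = S - U" unfolding Xs_def using A S by (intro Sep_reorient) auto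
      then have nXs: "A \<noteq> Xs" using U(2) by auto
      have SD: "S - Sep A Xs = V" using SepXs by (auto simp: V_def)
      have sub: "Sep A Xs \<subseteq> S - U" using SepXs by simp
      define J where "J = {x \<in> K. second x = Xs}"
      \<comment> \<open>First steps grow under faces, and the first step to \<open>Xs\<close> is the largest.\<close>
      have J: "closed_in faces K J"
        unfolding closed_in_def
      proof (intro conjI ballI subsetI)
        fix x y assume x: "x \<in> J" and y: "y \<in> faces x \<inter> K"
        obtain q where q: "x = A # Xs # q" using elim[of x] x by (auto simp: J_def)
        have "distinct_adj x" using x by (simp add: J_def K_def chains_from_def)
        moreover have "Sep A (second y) \<subseteq> S - U" using elim[of y] y by auto
        ultimately have "second y = Xs"
          using second_faces[of y A "Xs # q"] y q SepXs by auto
        then show "y \<in> J" using y by (auto simp: J_def)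
      qed (auto simp: J_def)
      have "exact faces (K - J)"
      proof (rule exact_first_steps[OF _ is_complex_Diff_closed[OF cK J] indS])
        show "K - J \<subseteq> ?I" using KI by auto
        fix X
        show "exact faces {x \<in> K - J. second x = X}"
        proof (cases "X = Xs")
          case True
          then have "{x \<in> K - J. second x = X} = {}" by (auto simp: J_def)
          then show ?thesis by (metis exact_empty)
        next
          case False
          then have "{x \<in> K - J. second x = X} = {x \<in> K. second x = X}" by (auto simp: J_def)
          then show ?thesis using fiber_exact[of X] False by simp
        qed
      qed
      moreover have "\<exists>f. generates faces length J (Suc (rk \<phi> S)) f"
      proof -
        have "rk \<phi> S = Suc (rk \<phi> V)"
          by (rule rank_maximal_face[OF A fS V]) (use max in \<open>auto simp: V_def\<close>)
        moreover obtain f where f: "generates faces length (chains_from Xs (ind V)) (Suc (rk \<phi> V)) f"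
          using less.hyps[of V Xs] smaller[OF sub nXs] Xs V S SD by auto
        have i: "face_iso faces (chains_from Xs (ind V)) faces J (Cons A)"
          using iso[OF sub nXs] by (simp add: SD J_def)
        define f' where "f' x = (if x \<in> J then f (tl x) else 0)" for x
        have "generates faces length J (Suc (Suc (rk \<phi> V))) f'"
        proof (rule generates_iso[OF i f])
          fix x assume "x \<in> chains_from Xs (ind V)"
          then have "A # x \<in> J" using i by (auto simp: face_iso_def bij_betw_def)
          then show "f' (A # x) = f x" by (simp add: f'_def)
        qed (auto simp: f'_def)
        ultimately show ?thesis by auto
      qed
      ultimately have "\<exists>f. generates faces length K (Suc (rk \<phi> S)) f"
        using generates_sub[OF cK J] faces_basic(1) by blast
      then show ?thesis
        using generates_quotient[OF complex_chains_from W] fS by (auto simp: K_def)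
    qed
  qed
qed

section \<open>Splitting off the support\<close>

text \<open>
  The hyperplanes crossed by the longest initial segment that crosses none of them twice and none of
  \<open>V\<close>, together with \<open>V\<close>.
\<close>

fun greedy :: "'b set \<Rightarrow> 'b sign_vector list \<Rightarrow> 'b set"
  where
    "greedy V (a # b # q) = (if Sep a b \<inter> V = {} then greedy (V \<union> Sep a b) (b # q) else V)"
  | "greedy V _ = V"

lemma greedy_increasing: "V \<subseteq> greedy V x"
  by (induction V x rule: greedy.induct) auto

lemma greedy_faces: "y \<in> faces x \<Longrightarrow> greedy V y \<subseteq> greedy V x"
proof (induction x arbitrary: y V rule: faces.induct)
  case (1 a b c q)
  show ?case
  proof (cases "y = a # c # q \<and> Sep a b \<inter> Sep b c = {}")
    case True
    then have ac: "Sep a c = Sep a b \<union> Sep b c" using Sep_smooth[of a b c] by blast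
    show ?thesis
    proof (cases "Sep a c \<inter> V = {}")
      case T: True
      then have "Sep a b \<inter> V = {}" "Sep b c \<inter> (V \<union> Sep a b) = {}" using True ac by auto
      then show ?thesis using True T by (simp add: ac Un_assoc)
    next
      case False
      then have "greedy V y = V" using True by simp
      then show ?thesis using greedy_increasing by metis
    qed
  next
    case False
    then obtain z where z: "y = a # z" "z \<in> faces (b # c # q)" using 1 by (auto split: if_splits)
    then obtain w where w: "z = b # w" using faces_basic[OF z(2)] by (cases z) auto
    show ?thesis using 1(1)[OF z(2), of "V \<union> Sep a b"] z w by auto
  qed
qed auto

lemma greedy_split:
  "x \<noteq> [] \<Longrightarrow> \<exists>p b q. x = p @ b # q \<and> crs (p @ [b]) = ind (greedy V x - V) \<and>
    (q = [] \<or> meets (greedy V x) (b # q))"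
proof (induction V x rule: greedy.induct)
  case (1 V a b q)
  show ?case
  proof (cases "Sep a b \<inter> V = {}")
    case False
    then have "a # b # q = [] @ a # (b # q) \<and> crs ([] @ [a]) = ind (greedy V (a # b # q) - V) \<and>
      meets (greedy V (a # b # q)) (a # (b # q))" by auto
    then show ?thesis by blast
  next
    case True
    let ?V = "V \<union> Sep a b"
    obtain p c r where p: "b # q = p @ c # r" "crs (p @ [c]) = ind (greedy ?V (b # q) - ?V)"
      "r = [] \<or> meets (greedy ?V (b # q)) (c # r)" using 1 True by blast
    have g: "greedy V (a # b # q) = greedy ?V (b # q)" using True by simp
    have "crs ((a # p) @ [c]) = ind (Sep a b) + crs (p @ [c])" using p(1) by (cases p) auto
    also have "\<dots> = ind (greedy ?V (b # q) - V)"
      unfolding p(2) using greedy_increasing[of ?V "b # q"] True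
      by (subst ind_add) (auto intro!: arg_cong[where f = ind])
    finally have "a # b # q = (a # p) @ c # r \<and> crs ((a # p) @ [c]) = ind (greedy V (a # b # q) - V) \<and>
      (r = [] \<or> meets (greedy V (a # b # q)) (c # r))" unfolding g using p by simp
    then show ?thesis by blast
  qed
next
  case ("2_2" V a)
  have "[a] = [] @ a # [] \<and> crs ([] @ [a]) = ind (greedy V [a] - V)" by simp
  then show ?case by blast
qed auto

lemma greedy_eq:
  "crs (p @ [b]) = ind (W - V) \<Longrightarrow> V \<subseteq> W \<Longrightarrow> q = [] \<or> meets W (b # q) \<Longrightarrow> greedy V (p @ b # q) = W"
proof (induction p arbitrary: V rule: induct_list012)
  case 1
  have "W \<subseteq> V"
  proof
    fix e assume "e \<in> W"
    then show "e \<in> V" using fun_cong[OF 1(1), of e] by (cases "e \<in> V") auto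
  qed
  then have "W = V" using 1(2) by auto
  then show ?case using 1 by (cases q) auto
next
  case (2 a)
  then have "Sep a b = W - V" by simp
  then show ?case using 2 by (cases q) (auto simp: Un_absorb1 insert_absorb sup.absorb2)
next
  case (3 a a' p)
  have e: "ind (Sep a a') + crs ((a' # p) @ [b]) = ind (W - V)"
    using 3(3) by (simp add: plus_fun_def)
  have "Sep a a' \<subseteq> W - V" "crs ((a' # p) @ [b]) = ind (W - V - Sep a a')"
    using ind_plus_eq[OF e[symmetric]] by auto
  then show ?case using 3(2)[of "V \<union> Sep a a'"] 3(4,5) by (auto simp: Diff_Diff_Int set_diff_eq Un_def conj_assoc)
qed

lemma initial_sub_greedy:
  "ind S \<in> initials x \<Longrightarrow> S \<inter> V = {} \<Longrightarrow> S \<subseteq> greedy V x"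
proof (induction V x arbitrary: S rule: greedy.induct)
  case (1 V a b q)
  show ?case
  proof (cases "S = {}")
    case False
    then obtain \<beta> where \<beta>: "ind S = ind (Sep a b) + \<beta>" "\<beta> \<in> initials (b # q)" using 1(2) by auto
    note s = ind_plus_eq[OF \<beta>(1)]
    have d: "Sep a b \<inter> V = {}" using s(1) 1(3) by auto
    have "S - Sep a b \<subseteq> greedy (V \<union> Sep a b) (b # q)"
      using 1(1)[OF d, of "S - Sep a b"] \<beta>(2) s 1(3) by auto
    then show ?thesis using d greedy_increasing[of "V \<union> Sep a b" "b # q"] by auto
  qed simp
qed auto

text \<open>
  Every chain starts with a longest segment that crosses no hyperplane twice. The chains for which
  this segment crosses the set \<open>W\<close> form a tensor product. If \<open>W\<close> is not
  facial for \<open>A\<close>, the first factor is exact by \<open>geodesic_cohomology\<close>.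
  Otherwise the second factor consists of chains whose first step crosses a hyperplane of
  \<open>W\<close>, which is facial for their start, too; it is exact by \<open>exact_meeting\<close>,
  unless all crossings are in \<open>W\<close>, that is, unless \<open>W\<close> is the whole support.
\<close>

theorem exact_uncut_support:
  assumes A: "A \<in> T" and S: "S = {e. \<gamma> e \<noteq> 0}" and SE: "S \<subseteq> E"
  shows "exact faces (uncut A \<gamma> (ind S))"
proof (rule exact_filtration[where p = "greedy {}" and r = "\<lambda>W. int (card W)"])
  let ?J = "uncut A \<gamma> (ind S)"
  show cJ: "is_complex faces ?J" by (rule is_complex_closed[OF complex_chains_from closed_uncut])
  show "finite ?J" using finite_chains_from by (simp add: uncut_def)
  have split: "\<exists>p b q. x = p @ b # q \<and> crs (p @ [b]) = ind (greedy {} x) \<and>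
    (q = [] \<or> meets (greedy {} x) (b # q))" if "x \<in> ?J" for x
    using greedy_split[of x "{}"] that by (auto simp: uncut_def chains_from_def)
  have sub: "greedy {} x \<subseteq> S" if x: "x \<in> ?J" for x
  proof -
    obtain p b q where p: "x = p @ b # q" "crs (p @ [b]) = ind (greedy {} x)" using split[OF x] by blast
    then have "\<gamma> = ind (greedy {} x) + crs (b # q)"
      using x crs_append[of p b q] by (auto simp: uncut_def chains_from_def)
    then show ?thesis by (auto simp: S indicator_def)
  qed
  show "greedy {} y = greedy {} x \<or> int (card (greedy {} y)) < int (card (greedy {} x))"
    if "x \<in> ?J" "y \<in> faces x \<inter> ?J" for x y
  proof -
    have "finite (greedy {} x)" using sub[OF that(1)] finite_sub[OF SE] finite_subset by auto
    moreover have "greedy {} y \<subseteq> greedy {} x" using greedy_faces that by blast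
    ultimately show ?thesis using psubset_card_mono[of "greedy {} x" "greedy {} y"] by auto
  qed
  fix W
  show "exact faces {x \<in> ?J. greedy {} x = W}"
  proof (cases "{x \<in> ?J. greedy {} x = W} = {}")
    case False
    then obtain x where x: "x \<in> ?J" "greedy {} x = W" by blast
    then obtain p b q where p: "x = p @ b # q" "crs (p @ [b]) = ind W" "q = [] \<or> meets W (b # q)"
      using split by blast
    define \<delta> where "\<delta> = crs (b # q)"
    have \<gamma>: "\<gamma> = ind W + \<delta>"
      using x crs_append[of p b q] p by (auto simp: uncut_def chains_from_def \<delta>_def)
    have WS: "W \<subseteq> S" using sub[OF x(1)] x by simp
    have "W \<noteq> S"
    proof
      assume "W = S"
      then have "ind S \<in> initials x" using p by (auto simp: initials_iff)
      then show False using x by (simp add: uncut_def)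
    qed
    then obtain e0 where e0: "e0 \<in> S" "e0 \<notin> W" using WS by auto
    have \<delta>e0: "\<delta> e0 \<noteq> 0" using e0 by (auto simp: S \<gamma>)
    let ?B = "flip (ind W) A"
    have m: "p @ [b] \<in> chains_from A (ind W)" "b # q \<in> chains_from b \<delta>"
      using chains_from_split[of p b q A "ind W" \<delta>] x p \<gamma> by (auto simp: uncut_def)
    have B: "?B \<in> T" using chains_from_last[OF m(1)] by simp
    have fiber: "{x \<in> ?J. greedy {} x = W} = join ` (chains_from A (ind W) \<times> meeting ?B \<delta> W)"
    proof (intro set_eqI iffI)
      fix z assume "z \<in> {x \<in> ?J. greedy {} x = W}"
      then have z: "z \<in> ?J" "greedy {} z = W" by auto
      obtain p b q where p: "z = p @ b # q" "crs (p @ [b]) = ind W" "q = [] \<or> meets W (b # q)"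
        using split[OF z(1)] z(2) by blast
      have m: "p @ [b] \<in> chains_from A (ind W)" "b # q \<in> chains_from b \<delta>"
        using chains_from_split[of p b q A "ind W" \<delta>] z p \<gamma> by (auto simp: uncut_def)
      have b: "b = ?B" using chains_from_last[OF m(1)] by simp
      have "q \<noteq> []" using m(2) \<delta>e0 by auto
      then have "b # q \<in> meeting ?B \<delta> W" using m p(3) b by (simp add: meeting_def)
      moreover have "z = join (p @ [b], b # q)" using p by simp
      ultimately show "z \<in> join ` (chains_from A (ind W) \<times> meeting ?B \<delta> W)" using m(1) by blast
    next
      fix z assume "z \<in> join ` (chains_from A (ind W) \<times> meeting ?B \<delta> W)"
      then obtain u v where uv: "z = u @ tl v" "u \<in> chains_from A (ind W)" "v \<in> chains_from ?B \<delta>" "meets W v"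
        by (auto simp: meeting_def)
      obtain p b q where b: "u = p @ [b]" "v = b # q" "u @ tl v = p @ b # q"
        using join_cases[OF uv(2,3)] by blast
      have "greedy {} z = W"
        using greedy_eq[of p b W "{}" q] uv b by (auto simp: chains_from_def)
      moreover have "z \<in> chains_from A \<gamma>" using join_mem(1)[OF uv(2,3)] uv \<gamma> by simp
      moreover have "ind S \<notin> initials z"
        using initial_sub_greedy[of S z "{}"] \<open>greedy {} z = W\<close> WS \<open>W \<noteq> S\<close> by auto
      ultimately show "z \<in> {x \<in> ?J. greedy {} x = W}" by (simp add: uncut_def)
    qed
    have cm: "is_complex faces (meeting ?B \<delta> W)"
      by (rule is_complex_closed[OF complex_chains_from closed_meeting])
    have msub: "meeting ?B \<delta> W \<subseteq> chains_from ?B \<delta>" by (auto simp: meeting_def)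
    show ?thesis
    proof (cases "facial A W")
      case True
      then have "facial ?B W" by (rule facial_cong) (simp add: reorient_def)
      then have "exact faces (meeting ?B \<delta> W)" using exact_meeting[of ?B W e0 \<delta>] B e0(2) \<delta>e0 by blast
      then show ?thesis
        unfolding fiber by (intro exact_join_right[OF _ msub] complex_chains_from cm) auto
    next
      case False
      then have "exact faces (chains_from A (ind W))" using geodesic_cohomology[OF A, of W] WS SE by auto
      then show ?thesis
        unfolding fiber by (intro exact_join_left[OF _ msub] complex_chains_from cm) auto
    qed
  qed (metis exact_empty)
qed

section \<open>Admissible exponents\<close>

abbreviation "lev \<equiv> level E"
abbreviation "kap \<equiv> kappa E \<phi>"

text \<open>
  Levels of large index are empty, and the empty set is facial for every tope, so \<open>j\<close> is
  not bounded.
\<close>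

definition adm :: "('e \<Rightarrow> nat) \<Rightarrow> 'e sign_vector \<Rightarrow> bool"
  where "adm \<gamma> A \<longleftrightarrow> (\<forall>j\<ge>1. facial A (lev j \<gamma>))"

definition supp :: "('e \<Rightarrow> nat) \<Rightarrow> 'e set"
  where "supp \<gamma> = {e. \<gamma> e \<noteq> 0}"

lemma lev_sub_E: "lev j \<gamma> \<subseteq> E"
  by (auto simp: level_def)

lemma lev_0: "lev 0 \<gamma> = E"
  by (auto simp: level_def)

lemma lev_mono: "i \<le> j \<Longrightarrow> lev j \<gamma> \<subseteq> lev i \<gamma>"
  by (auto simp: level_def)

lemma lev_1: "\<gamma> \<in> exponents E \<Longrightarrow> lev 1 \<gamma> = supp \<gamma>"
  by (auto simp: level_def supp_def exponents_def)

lemma supp_sub_E: "\<gamma> \<in> exponents E \<Longrightarrow> supp \<gamma> \<subseteq> E"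
  by (auto simp: supp_def exponents_def)

lemma supp_empty_iff [simp]: "supp \<gamma> = {} \<longleftrightarrow> \<gamma> = 0"
  by (auto simp: supp_def fun_eq_iff)

lemma supp_add: "supp (\<alpha> + \<beta>) = supp \<alpha> \<union> supp \<beta>"
  by (auto simp: supp_def)

lemma supp_ind [simp]: "supp (ind S) = S"
  by (auto simp: supp_def indicator_def)

lemma exponents_add [simp]: "\<alpha> + \<beta> \<in> exponents E \<longleftrightarrow> \<alpha> \<in> exponents E \<and> \<beta> \<in> exponents E"
  by (auto simp: exponents_def)

lemma exponents_ind [simp]: "ind S \<in> exponents E \<longleftrightarrow> S \<subseteq> E"
  by (auto simp: exponents_def indicator_def)

lemma max_exp_ge: "e \<in> E \<Longrightarrow> \<gamma> e \<le> max_exp E \<gamma>"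
  using finite_E by (simp add: max_exp_def)

lemma lev_large: "max_exp E \<gamma> < j \<Longrightarrow> lev j \<gamma> = {}"
  using max_exp_ge[of _ \<gamma>] by (force simp: level_def)

lemma kap_sum: "max_exp E \<gamma> \<le> N \<Longrightarrow> kap \<gamma> = (\<Sum>j = 1..N. rk \<phi> (lev j \<gamma>))"
  unfolding kappa_def by (rule sum.mono_neutral_left) (auto simp: lev_large)

lemma split_support:
  obtains \<delta> where "\<gamma> = ind (supp \<gamma>) + \<delta>" "supp \<delta> \<subseteq> supp \<gamma>"
proof -
  have "\<gamma> = ind (supp \<gamma>) + (\<lambda>e. \<gamma> e - 1)" by (auto simp: fun_eq_iff supp_def indicator_def)
  moreover have "supp (\<lambda>e. \<gamma> e - 1) \<subseteq> supp \<gamma>" by (auto simp: supp_def)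
  ultimately show ?thesis using that by blast
qed

lemma lev_shift:
  assumes "supp \<delta> \<subseteq> S" "j \<ge> 1"
  shows "lev (Suc j) (ind S + \<delta>) = lev j \<delta>"
proof -
  have "j \<le> \<delta> e \<Longrightarrow> e \<in> S" for e using assms by (auto simp: supp_def)
  then show ?thesis by (auto simp: level_def indicator_def split: if_splits)
qed

lemma lev_1_ind: "supp \<delta> \<subseteq> S \<Longrightarrow> S \<subseteq> E \<Longrightarrow> lev 1 (ind S + \<delta>) = S"
  by (auto simp: level_def supp_def indicator_def Suc_le_eq split: if_splits)

lemma kap_shift:
  assumes "supp \<delta> \<subseteq> S" "S \<subseteq> E"
  shows "kap (ind S + \<delta>) = rk \<phi> S + kap \<delta>"
proof -
  define N where "N = max (max_exp E (ind S + \<delta>)) (max_exp E \<delta>)"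
  have "kap (ind S + \<delta>) = (\<Sum>j = 1..Suc N. rk \<phi> (lev j (ind S + \<delta>)))"
    by (rule kap_sum) (simp add: N_def)
  also have "\<dots> = rk \<phi> (lev 1 (ind S + \<delta>)) + (\<Sum>j = Suc 1..Suc N. rk \<phi> (lev j (ind S + \<delta>)))"
    by (rule sum.atLeast_Suc_atMost) simp
  also have "(\<Sum>j = Suc 1..Suc N. rk \<phi> (lev j (ind S + \<delta>))) = (\<Sum>j = 1..N. rk \<phi> (lev (Suc j) (ind S + \<delta>)))"
    by (rule sum.shift_bounds_cl_Suc_ivl)
  also have "\<dots> = (\<Sum>j = 1..N. rk \<phi> (lev j \<delta>))"
    by (rule sum.cong) (use lev_shift[OF assms(1)] in auto)
  also have "\<dots> = kap \<delta>" by (rule kap_sum[symmetric]) (simp add: N_def)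
  finally show ?thesis unfolding lev_1_ind[OF assms] .
qed

lemma kap_0 [simp]: "kap 0 = 0"
proof -
  have "lev j 0 = {}" if "j \<ge> 1" for j using that by (auto simp: level_def)
  then show ?thesis by (simp add: kappa_def)
qed

lemma adm_supp: "\<gamma> \<in> exponents E \<Longrightarrow> adm \<gamma> A \<Longrightarrow> facial A (supp \<gamma>)"
  using lev_1[of \<gamma>] by (auto simp: adm_def)

lemma reorient_reorient [simp]: "reorient S (reorient S A) = A"
  by (auto simp: reorient_def)

lemma facial_reorient:
  assumes "facial A S" "V \<subseteq> S" "facial A V"
  shows "facial (reorient S A) V"
  by (rule facial_sub[OF _ assms(2,3)])
     (use assms(1) in \<open>auto simp: reorient_def intro: facial_cong\<close>)

lemma adm_reorient:
  assumes "facial A S" "supp \<delta> \<subseteq> S"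
  shows "adm \<delta> (reorient S A) \<longleftrightarrow> adm \<delta> A"
proof -
  have levS: "lev j \<delta> \<subseteq> S" if "j \<ge> 1" for j using assms that by (auto simp: level_def supp_def)
  have "facial (reorient S A) S" using assms(1) by (rule facial_cong) (auto simp: reorient_def)
  then have "facial A (lev j \<delta>) \<longleftrightarrow> facial (reorient S A) (lev j \<delta>)" if "j \<ge> 1" for j
    using facial_reorient[of A S "lev j \<delta>"] facial_reorient[of "reorient S A" S "lev j \<delta>"]
      levS that assms(1) by auto
  then show ?thesis unfolding adm_def by blast
qed

lemma adm_shift:
  assumes "supp \<delta> \<subseteq> S" "S \<subseteq> E"
  shows "adm (ind S + \<delta>) A \<longleftrightarrow> facial A S \<and> adm \<delta> (reorient S A)"
proof -
  have "adm (ind S + \<delta>) A \<longleftrightarrow> facial A (lev 1 (ind S + \<delta>)) \<and> (\<forall>j\<ge>1. facial A (lev (Suc j) (ind S + \<delta>)))"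
  proof -
    have "(\<forall>j\<ge>1. P j) \<longleftrightarrow> P 1 \<and> (\<forall>j\<ge>1. P (Suc j))" for P :: "nat \<Rightarrow> bool"
    proof (intro iffI allI impI)
      fix j :: nat assume P: "P 1 \<and> (\<forall>j\<ge>1. P (Suc j))" "j \<ge> 1"
      then obtain m where "j = Suc m" by (cases j) auto
      then show "P j" using P by (cases "m = 0") auto
    qed auto
    then show ?thesis unfolding adm_def .
  qed
  also have "\<dots> \<longleftrightarrow> facial A S \<and> (\<forall>j\<ge>1. facial A (lev j \<delta>))"
    using lev_1_ind[OF assms] lev_shift[OF assms(1)] by simp
  also have "\<dots> \<longleftrightarrow> facial A S \<and> adm \<delta> (reorient S A)"
    using adm_reorient[OF _ assms(1), of A] by (auto simp: adm_def)
  finally show ?thesis .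
qed

lemma adm_0: "A \<in> T \<Longrightarrow> adm 0 A"
proof -
  assume "A \<in> T"
  moreover have "lev j 0 = {}" if "j \<ge> 1" for j using that by (auto simp: level_def)
  ultimately show ?thesis using facial_empty by (simp add: adm_def)
qed

text \<open>
  A set that is facial for a tope is a flat: a point of the face annihilates its span but no
  functional outside.
\<close>

lemma tope_admissible_iff:
  assumes "A \<in> T"
  shows "tope_admissible E \<phi> \<gamma> A \<longleftrightarrow> adm \<gamma> A"
proof -
  have flat: "flat E \<phi> U" if "facial A U" for U
    unfolding flat_def using that rank_insert_facial[OF that order_refl] facial_sub_E[OF that] by auto
  have "(\<forall>j\<in>{1..max_exp E \<gamma>}. facial A (lev j \<gamma>)) \<longleftrightarrow> adm \<gamma> A"
    unfolding adm_def using lev_large[of \<gamma>] facial_empty[OF assms] by (metis atLeastAtMost_iff not_le)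
  then show ?thesis
    unfolding tope_admissible_def admissible_def
    using facial_iff[OF assms lev_sub_E] flat by auto
qed

section \<open>Cohomology of all chains\<close>

text \<open>
  On the quotient by the chains that cannot be cut the cup product is the tensor product of cochains,
  and an exact subcomplex can be divided out.
\<close>

lemma generates_cup:
  assumes f: "generates faces length (chains_from A \<beta>) (Suc p) f"
    and g: "generates faces length (chains_from (flip \<beta> A) \<alpha>) (Suc q) g"
    and ex: "exact faces (uncut A (\<beta> + \<alpha>) \<beta>)"
  shows "generates faces length (chains_from A (\<beta> + \<alpha>)) (Suc (p + q)) (cup_cochain p f g)"
proof (rule generates_quotient[OF complex_chains_from closed_uncut ex])
  let ?I = "chains_from A \<beta>" and ?L = "chains_from (flip \<beta> A) \<alpha>"
  have len: "length (x @ tl y) = length x + length y - 1" if "y \<noteq> []" for x y :: "'e sign_vector list"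
    using that by (cases y) auto
  have J: "chains_from A (\<beta> + \<alpha>) - uncut A (\<beta> + \<alpha>) \<beta> = join ` (?I \<times> ?L)"
    by (rule chains_minus_uncut)
  have pieces: "take (Suc p) z \<in> ?I \<and> length (take (Suc p) z) = Suc p \<and> drop p z \<in> ?L \<and>
      z = take (Suc p) z @ tl (drop p z)" if "cup_cochain p f g z \<noteq> 0" for z
  proof -
    have "f (take (Suc p) z) \<noteq> 0" "g (drop p z) \<noteq> 0" using that by (auto simp: cup_cochain_def)
    from generates_supp[OF f this(1)] generates_supp[OF g this(2)]
    have "take (Suc p) z \<in> ?I \<and> length (take (Suc p) z) = Suc p" "drop p z \<in> ?L" by blast+
    moreover have "z = take (Suc p) z @ tl (drop p z)" by (metis append_take_drop_id drop_Suc tl_drop)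
    ultimately show ?thesis by blast
  qed
  show "generates faces length (chains_from A (\<beta> + \<alpha>) - uncut A (\<beta> + \<alpha>) \<beta>) (Suc (p + q)) (cup_cochain p f g)"
    unfolding J
  proof (rule generates_iso[OF join_iso_sub[OF order_refl order_refl]])
    show "generates (prod_faces faces faces) (\<lambda>(x, y). length x + length y) (?I \<times> ?L)
        (Suc p + Suc q) (\<lambda>(x, y). f x * g y)"
      by (rule generates_prod[OF complex_chains_from finite_chains_from complex_chains_from
          finite_chains_from f g]) (rule faces_basic(1))
  next
    fix z assume "z \<in> ?I \<times> ?L" "(\<lambda>(x, y). length x + length y) z = Suc p + Suc q"
    then show "length (join z) = Suc (p + q)" using len by (auto simp: chains_from_def)
  next
    fix z assume "z \<in> ?I \<times> ?L"
    then obtain x y where z: "z = (x, y)" and x: "x \<in> ?I" and y: "y \<in> ?L" by auto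
    have "cup_cochain p f g (x @ tl y) = f x * g y"
    proof (cases "f x = 0")
      case False
      then have l: "length x = Suc p" using generates_supp[OF f] by auto
      obtain p' b r where b: "x = p' @ [b]" "y = b # r" "b = flip \<beta> A" "x @ tl y = p' @ b # r"
        by (rule join_cases[OF x y])
      then have "take (Suc p) (x @ tl y) = x" "drop p (x @ tl y) = y" using l by auto
      then show ?thesis by (simp add: cup_cochain_def)
    next
      case True
      have "cup_cochain p f g (x @ tl y) = 0"
      proof (rule ccontr)
        assume nz: "cup_cochain p f g (x @ tl y) \<noteq> 0"
        then have "take (Suc p) (x @ tl y) = x"
          using join_inj[OF _ _ x y] pieces[OF nz] by metis
        then show False using nz True by (simp add: cup_cochain_def)
      qed
      then show ?thesis using True by simp
    qed
    then show "cup_cochain p f g (join z) = (\<lambda>(x, y). f x * g y) z" using z by simp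
  next
    fix z assume "z \<notin> join ` (?I \<times> ?L)"
    then show "cup_cochain p f g z = 0" using pieces[of z] by force
  qed
qed

lemma exact_chains_from_tensor:
  assumes ex: "exact faces (uncut A (\<beta> + \<alpha>) \<beta>)"
    and "exact faces (chains_from A \<beta>) \<or> exact faces (chains_from (flip \<beta> A) \<alpha>)"
  shows "exact faces (chains_from A (\<beta> + \<alpha>))"
proof (rule exact_extension[OF complex_chains_from closed_uncut ex])
  show "exact faces (chains_from A (\<beta> + \<alpha>) - uncut A (\<beta> + \<alpha>) \<beta>)"
    unfolding chains_minus_uncut using assms(2)
      exact_join_left[OF order_refl order_refl complex_chains_from complex_chains_from]
      exact_join_right[OF order_refl order_refl complex_chains_from complex_chains_from] by metis
qed

text \<open>
  By \<open>exact_uncut_support\<close> the complex is, up to an exact subcomplex, a tensor product of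
  a complex of geodesics that cross the support with the complex of chains for the exponent whose
  levels are the other levels of \<open>\<gamma>\<close>. So one after another the levels contribute a
  sphere, of degree their rank, or make the complex exact.
\<close>

theorem cohomology_of_chains:
  assumes "A \<in> T" "\<gamma> \<in> exponents E"
  shows "(adm \<gamma> A \<longrightarrow> (\<exists>f. generates faces length (chains_from A \<gamma>) (Suc (kap \<gamma>)) f)) \<and>
    (\<not> adm \<gamma> A \<longrightarrow> exact faces (chains_from A \<gamma>))"
  using assms
proof (induction "\<Sum>e\<in>E. \<gamma> e" arbitrary: A \<gamma> rule: less_induct)
  case less
  note A = less.prems(1)
  show ?case
  proof (cases "\<gamma> = 0")
    case True
    then show ?thesis using generates_point[OF A] adm_0[OF A] by auto
  next
    case False
    define S where "S = supp \<gamma>"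
    obtain \<delta> where \<gamma>: "\<gamma> = ind S + \<delta>" "supp \<delta> \<subseteq> S" using split_support[of \<gamma>] by (auto simp: S_def)
    have SE: "S \<subseteq> E" "S \<noteq> {}" "\<delta> \<in> exponents E"
    proof -
      show "S \<subseteq> E" "S \<noteq> {}" using supp_sub_E[OF less.prems(2)] False by (simp_all add: S_def)
      show "\<delta> \<in> exponents E" using less.prems(2) \<gamma>(1) exponents_add[of "ind S" \<delta>] by metis
    qed
    obtain e where "e \<in> S" using SE by auto
    then have "(0::nat) < (\<Sum>e\<in>E. indicator S e)"
      using SE finite_E member_le_sum[of e E "indicator S :: _ \<Rightarrow> nat"] by auto
    then have small: "(\<Sum>e\<in>E. \<delta> e) < (\<Sum>e\<in>E. \<gamma> e)" by (simp add: \<gamma>(1) sum.distrib)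
    have "S = {e. \<gamma> e \<noteq> 0}" by (simp add: S_def supp_def)
    from exact_uncut_support[OF A this SE(1)]
    have ex: "exact faces (uncut A (ind S + \<delta>) (ind S))" using \<gamma>(1) by metis
    have adm: "adm \<gamma> A \<longleftrightarrow> facial A S \<and> adm \<delta> (reorient S A)" using adm_shift[OF \<gamma>(2) SE(1)] \<gamma> by simp
    show ?thesis
    proof (cases "facial A S")
      case False
      then have "exact faces (chains_from A (ind S))" using geodesic_cohomology[OF A SE(1)] by auto
      then have "exact faces (chains_from A \<gamma>)" using exact_chains_from_tensor[OF ex] \<gamma> by simp
      then show ?thesis using False adm by auto
    next
      case True
      have B: "reorient S A \<in> T" using facial_opposite(1)[OF A True facial_empty[OF A]] by simp
      note IH = less.hyps[OF small B SE(3)]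
      show ?thesis
      proof (cases "adm \<delta> (reorient S A)")
        case ad: False
        then have "exact faces (chains_from A \<gamma>)" using IH exact_chains_from_tensor[OF ex] \<gamma> by simp
        then show ?thesis using ad adm by auto
      next
        case ad: True
        obtain f g where "generates faces length (chains_from A (ind S)) (Suc (rk \<phi> S)) f"
          "generates faces length (chains_from (flip (ind S) A) \<delta>) (Suc (kap \<delta>)) g"
          using IH ad geodesic_cohomology[OF A SE(1)] True by auto
        then have "generates faces length (chains_from A (ind S + \<delta>)) (Suc (rk \<phi> S + kap \<delta>))
            (cup_cochain (rk \<phi> S) f g)"
          by (rule generates_cup[OF _ _ ex])
        moreover have "kap \<gamma> = rk \<phi> S + kap \<delta>" using kap_shift[OF \<gamma>(2) SE(1)] \<gamma> by simp
        ultimately show ?thesis using ad True adm \<gamma>(1) by auto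
      qed
    qed
  qed
qed

section \<open>Modular pairs of exponents\<close>

lemma lev_add_ind:
  assumes "Q \<subseteq> E" "j \<ge> 1"
  shows "lev j (ind Q + \<delta>) = lev j \<delta> \<union> (Q \<inter> lev (j - 1) \<delta>)"
  using assms by (auto simp: level_def indicator_def split: if_splits)

text \<open>
  Level \<open>j\<close> of the sum is the union of \<open>lev j \<delta>\<close> and \<open>Q
  \<inter> lev (j - 1) \<delta>\<close>, whose intersection is \<open>Q \<inter> lev j
  \<delta>\<close>. The inequality is the sum over \<open>j\<close> of submodularity for these pairs,
  in which the ranks of the sets \<open>Q \<inter> lev j \<delta>\<close> telescope to the rank of
  \<open>Q\<close>. Equality of the sums forces equality for each \<open>j\<close>.
\<close>

lemma kap_add_ind:
  assumes Q: "Q \<subseteq> E"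
  shows "kap (ind Q + \<delta>) \<le> rk \<phi> Q + kap \<delta>"
    and "kap (ind Q + \<delta>) = rk \<phi> Q + kap \<delta> \<Longrightarrow> j \<ge> 1 \<Longrightarrow>
      rk \<phi> (lev j (ind Q + \<delta>)) + rk \<phi> (Q \<inter> lev j \<delta>) = rk \<phi> (lev j \<delta>) + rk \<phi> (Q \<inter> lev (j - 1) \<delta>)"
proof -
  define N where "N = Suc (max j (max (max_exp E (ind Q + \<delta>)) (max_exp E \<delta>)))"
  define u where "u i = rk \<phi> (lev i (ind Q + \<delta>)) + rk \<phi> (Q \<inter> lev i \<delta>)" for i
  define v where "v i = rk \<phi> (lev i \<delta>) + rk \<phi> (Q \<inter> lev (i - 1) \<delta>)" for i
  have le: "u i \<le> v i" if "i \<in> {1..N}" for i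
  proof -
    have "rk \<phi> (lev i \<delta> \<union> (Q \<inter> lev (i - 1) \<delta>)) + rk \<phi> (lev i \<delta> \<inter> (Q \<inter> lev (i - 1) \<delta>)) \<le> v i"
      unfolding v_def using Q lev_sub_E by (intro rank_submodular) auto
    moreover have "lev i \<delta> \<inter> (Q \<inter> lev (i - 1) \<delta>) = Q \<inter> lev i \<delta>" using lev_mono[of "i - 1" i \<delta>] by auto
    ultimately show ?thesis using that lev_add_ind[OF Q, of i \<delta>] by (simp add: u_def)
  qed
  have NE: "Q \<inter> lev N \<delta> = {}" using lev_large[of \<delta> N] by (simp add: N_def)
  have tel: "(\<Sum>i = 1..N. rk \<phi> (Q \<inter> lev (i - 1) \<delta>)) = rk \<phi> Q + (\<Sum>i = 1..N. rk \<phi> (Q \<inter> lev i \<delta>))"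
  proof -
    have "(\<Sum>i = 1..N. rk \<phi> (Q \<inter> lev (i - 1) \<delta>)) = (\<Sum>i = 0..N - 1. rk \<phi> (Q \<inter> lev i \<delta>))"
      using sum.shift_bounds_cl_Suc_ivl[of "\<lambda>i. rk \<phi> (Q \<inter> lev (i - 1) \<delta>)" 0 "N - 1"] by (simp add: N_def)
    also have "\<dots> = (\<Sum>i = 0..N. rk \<phi> (Q \<inter> lev i \<delta>))" using NE by (simp add: N_def)
    also have "\<dots> = rk \<phi> (Q \<inter> lev 0 \<delta>) + (\<Sum>i = 1..N. rk \<phi> (Q \<inter> lev i \<delta>))"
      by (simp add: sum.atLeast_Suc_atMost)
    finally show ?thesis using Q by (simp add: lev_0 Int_absorb2)
  qed
  have su: "(\<Sum>i = 1..N. u i) = kap (ind Q + \<delta>) + (\<Sum>i = 1..N. rk \<phi> (Q \<inter> lev i \<delta>))"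
    unfolding u_def sum.distrib by (subst kap_sum[of _ N]) (auto simp: N_def)
  have sv: "(\<Sum>i = 1..N. v i) = kap \<delta> + (rk \<phi> Q + (\<Sum>i = 1..N. rk \<phi> (Q \<inter> lev i \<delta>)))"
    unfolding v_def sum.distrib tel by (subst kap_sum[of _ N]) (auto simp: N_def)
  have "(\<Sum>i = 1..N. u i) \<le> (\<Sum>i = 1..N. v i)" using le by (rule sum_mono)
  then show "kap (ind Q + \<delta>) \<le> rk \<phi> Q + kap \<delta>" unfolding su sv by simp
  assume "kap (ind Q + \<delta>) = rk \<phi> Q + kap \<delta>" "j \<ge> 1"
  then have eq: "(\<Sum>i = 1..N. u i) = (\<Sum>i = 1..N. v i)" unfolding su sv by simp
  have "u j = v j"
  proof (rule ccontr)
    assume "u j \<noteq> v j"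
    moreover have j: "j \<in> {1..N}" using \<open>j \<ge> 1\<close> by (simp add: N_def)
    ultimately have "u j < v j" using le by (simp add: le_neq_implies_less)
    then have "(\<Sum>i = 1..N. u i) < (\<Sum>i = 1..N. v i)" using le j by (intro sum_strict_mono_ex1) auto
    then show False using eq by simp
  qed
  then show "rk \<phi> (lev j (ind Q + \<delta>)) + rk \<phi> (Q \<inter> lev j \<delta>) = rk \<phi> (lev j \<delta>) + rk \<phi> (Q \<inter> lev (j - 1) \<delta>)"
    by (simp add: u_def v_def)
qed

text \<open>Induction along the levels: the support is split off in each step.\<close>

lemma exponents_induct [consumes 1, case_names zero step]:
  assumes "\<alpha> \<in> exponents E"
    and "P 0"
    and "\<And>Q \<delta>. Q \<subseteq> E \<Longrightarrow> Q \<noteq> {} \<Longrightarrow> supp \<delta> \<subseteq> Q \<Longrightarrow> \<delta> \<in> exponents E \<Longrightarrow> P \<delta> \<Longrightarrow> P (ind Q + \<delta>)"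
  shows "P \<alpha>"
  using assms(1)
proof (induction "\<Sum>e\<in>E. \<alpha> e" arbitrary: \<alpha> rule: less_induct)
  case less
  show ?case
  proof (cases "\<alpha> = 0")
    case False
    obtain \<delta> where \<alpha>: "\<alpha> = ind (supp \<alpha>) + \<delta>" "supp \<delta> \<subseteq> supp \<alpha>" by (rule split_support)
    define S where "S = supp \<alpha>"
    have S: "S \<subseteq> E" "S \<noteq> {}" "\<alpha> = ind S + \<delta>"
      using supp_sub_E[OF less.prems] False \<alpha>(1) unfolding S_def supp_empty_iff by blast+
    have \<delta>E: "\<delta> \<in> exponents E" using less.prems S(3) exponents_add[of "ind S" \<delta>] by metis
    obtain e where "e \<in> S" using S by auto
    then have "(0::nat) < (\<Sum>e\<in>E. indicator S e)"
      using S finite_E member_le_sum[of e E "indicator S :: _ \<Rightarrow> nat"] by auto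
    then have "(\<Sum>e\<in>E. \<delta> e) < (\<Sum>e\<in>E. \<alpha> e)" by (simp add: S(3) sum.distrib)
    then have "P \<delta>" using less.hyps \<delta>E by blast
    moreover have "supp \<delta> \<subseteq> S" using \<alpha>(2) by (simp add: S_def)
    ultimately have "P (ind S + \<delta>)" using assms(3) S \<delta>E by blast
    then show ?thesis using S(3) by metis
  qed (use assms(2) in simp)
qed

lemma kap_subadditive:
  assumes "\<alpha> \<in> exponents E"
  shows "kap (\<alpha> + \<beta>) \<le> kap \<alpha> + kap \<beta>"
  using assms
proof (induction rule: exponents_induct)
  case (step Q \<delta>)
  have "kap (ind Q + \<delta> + \<beta>) \<le> rk \<phi> Q + kap (\<delta> + \<beta>)"
    unfolding add.assoc by (rule kap_add_ind(1)[OF step(1)])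
  moreover have "kap (ind Q + \<delta>) = rk \<phi> Q + kap \<delta>" by (rule kap_shift[OF step(3,1)])
  ultimately show ?case using step(5) by linarith
next
  case zero
  show ?case by (simp only: add_0 kap_0)
qed

text \<open>
  The levels of \<open>\<delta>\<close> are shown to be facial one after the other, beginning with
  \<open>lev 0 \<delta> = E\<close>. To pass from level \<open>j\<close> to the next one by
  \<open>facial_refine\<close>, one needs a displacement that vanishes on \<open>lev (j + 1)
  \<delta>\<close> and is on the side of \<open>reorient Q A\<close> on the rest of level
  \<open>j\<close>. Outside \<open>Q\<close> a point \<open>w\<close> of the face of \<open>A\<close>
  cut out by level \<open>j + 1\<close> of the sum does this, and inside \<open>Q\<close> the negative
  of a point \<open>y\<close> of the face cut out by level \<open>j + 2\<close>. The two prescriptions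
  can be combined because the sets \<open>lev (j + 1) \<delta>\<close> and \<open>Q \<inter> lev j
  \<delta>\<close> form a modular pair.
\<close>

lemma adm_summand:
  assumes A: "A \<in> T" and Q: "Q \<subseteq> E" "facial A Q" and \<gamma>: "adm (ind Q + \<delta>) A"
    and eq: "kap (ind Q + \<delta>) = rk \<phi> Q + kap \<delta>"
  shows "adm \<delta> (reorient Q A)"
proof -
  let ?B = "reorient Q A" and ?U = "\<lambda>j. lev j (ind Q + \<delta>)"
  have "facial ?B (lev j \<delta>)" for j
  proof (induction j)
    case 0
    show ?case unfolding lev_0 by (auto simp: facial_def face_point_def phi_zero intro!: exI[of _ 0])
  next
    case (Suc j)
    let ?X = "lev (Suc j) \<delta>" and ?Y = "Q \<inter> lev j \<delta>" and ?Z = "Q \<inter> lev (Suc j) \<delta>"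
    have U: "?U (Suc j) = ?X \<union> ?Y" using lev_add_ind[OF Q(1), of "Suc j" \<delta>] by simp
    have ZU: "?Z \<subseteq> ?U (Suc (Suc j))" using lev_add_ind[OF Q(1), of "Suc (Suc j)" \<delta>] by auto
    have Zeq: "Q \<inter> ?U (Suc (Suc j)) \<subseteq> ?Z"
      using lev_add_ind[OF Q(1), of "Suc (Suc j)" \<delta>] lev_mono[of "Suc j" "Suc (Suc j)" \<delta>] by auto
    have XY: "?X \<subseteq> lev j \<delta>" by (rule lev_mono) simp
    obtain y where y: "face_point A (?U (Suc (Suc j))) y" using \<gamma> by (auto simp: adm_def facial_def)
    obtain w where w: "face_point A (?U (Suc j)) w" using \<gamma> by (auto simp: adm_def facial_def)
    have mod: "rk \<phi> (?X \<union> ?Y) + rk \<phi> ?Z = rk \<phi> ?X + rk \<phi> ?Y"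
      using kap_add_ind(2)[OF Q(1) eq, of "Suc j"] U by simp
    obtain v where v: "\<And>e. e \<in> ?X \<Longrightarrow> \<phi> e v = 0" "\<And>e. e \<in> ?Y \<Longrightarrow> \<phi> e v = - \<phi> e y"
    proof (rule modular_pair_patch[of "\<phi> ` ?X" "\<phi> ` ?Y" "\<phi> ` ?Z" y])
      show "dim (\<phi> ` ?X \<union> \<phi> ` ?Y) + dim (\<phi> ` ?Z) = dim (\<phi> ` ?X) + dim (\<phi> ` ?Y)"
        using mod by (simp add: rank_dim image_Un)
      show "f y = 0" if "f \<in> \<phi> ` ?Z" for f using that ZU y by (auto simp: face_point_def)
      show "linear f" if "f \<in> \<phi> ` ?X \<union> \<phi> ` ?Y" for f
        using that linear_phi lev_sub_E Q(1) by blast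
    qed (use finite_sub[OF lev_sub_E] finite_sub[OF Q(1)] XY in auto)
    let ?D = "lev j \<delta> - ?X - ?Y"
    have Dw: "A e * \<phi> e w > 0" if "e \<in> ?D" for e
    proof -
      have "e \<in> E - ?U (Suc j)" using that U lev_sub_E[of j \<delta>] by auto
      then show ?thesis using w by (simp add: face_point_def)
    qed
    obtain M where M: "M > 0" "\<forall>e\<in>?D. M * (A e * \<phi> e w) + A e * \<phi> e v > 0"
      using dominate[of ?D "\<lambda>e. A e * \<phi> e w" "\<lambda>e. A e * \<phi> e v"] Dw finite_sub[OF lev_sub_E] by auto
    show ?case
    proof (rule facial_refine[OF Suc XY, of "M *\<^sub>R w + v"])
      fix e assume "e \<in> ?X"
      moreover from this have "e \<in> E" "\<phi> e w = 0" using lev_sub_E w U by (auto simp: face_point_def)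
      ultimately show "\<phi> e (M *\<^sub>R w + v) = 0" using v by (simp add: phi_simps)
    next
      fix e assume e: "e \<in> lev j \<delta> - ?X"
      then have eE: "e \<in> E" using lev_sub_E by auto
      show "?B e * \<phi> e (M *\<^sub>R w + v) > 0"
      proof (cases "e \<in> Q")
        case True
        then have Y: "e \<in> ?Y" using e by auto
        then have "\<phi> e w = 0" using w U by (auto simp: face_point_def)
        moreover have "e \<notin> ?U (Suc (Suc j))" using Zeq True e by auto
        then have "A e * \<phi> e y > 0" using y eE by (auto simp: face_point_def)
        ultimately show ?thesis using v(2)[OF Y] True eE by (simp add: reorient_def phi_simps)
      next
        case False
        then have "e \<in> ?D" using e by auto
        then show ?thesis using M(2) False eE by (auto simp: reorient_def phi_simps algebra_simps)
      qed
    qed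
  qed
  then show ?thesis by (simp add: adm_def)
qed

section \<open>Cutting off a flat\<close>

lemma initials_split:
  "\<beta> \<in> initials (p @ b # q) \<longleftrightarrow>
    \<beta> \<in> initials (p @ [b]) \<or> (\<exists>\<beta>'\<in>initials (b # q). \<beta> = crs (p @ [b]) + \<beta>')"
proof (induction p arbitrary: \<beta>)
  case Nil
  have "0 \<in> initials (b # q)" by (cases q) auto
  then show ?case by auto
next
  case (Cons a p)
  define h where "h = ind (Sep a (hd (p @ [b])))"
  have I: "initials (a # y) = insert 0 ((+) h ` initials y)" and C: "crs (a # y) = h + crs y"
    if "y \<noteq> []" "hd y = hd (p @ [b])" for y
    using that by (cases y; simp only: initials.simps crs.simps list.sel h_def; simp)+
  have y: "p @ b # q \<noteq> []" "hd (p @ b # q) = hd (p @ [b])" by (cases p; simp)+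
  have "\<beta> \<in> initials ((a # p) @ b # q) \<longleftrightarrow> \<beta> = 0 \<or> (\<exists>\<beta>''\<in>initials (p @ b # q). \<beta> = h + \<beta>'')"
    unfolding append_Cons I[OF y] by blast
  also have "\<dots> \<longleftrightarrow> (\<beta> = 0 \<or> (\<exists>\<beta>''\<in>initials (p @ [b]). \<beta> = h + \<beta>'')) \<or>
      (\<exists>\<beta>'\<in>initials (b # q). \<beta> = (h + crs (p @ [b])) + \<beta>')"
    unfolding Cons.IH Bex_def by (auto simp only: add.assoc)
  also have "(\<beta> = 0 \<or> (\<exists>\<beta>''\<in>initials (p @ [b]). \<beta> = h + \<beta>'')) \<longleftrightarrow> \<beta> \<in> initials ((a # p) @ [b])"
    unfolding append_Cons using I[of "p @ [b]"] by blast
  finally show ?case unfolding append_Cons using C[of "p @ [b]"] by simp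
qed

lemma initials_join:
  assumes "x \<in> chains_from A \<beta>" "y \<in> chains_from (flip \<beta> A) \<alpha>"
  shows "\<gamma> \<in> initials (x @ tl y) \<longleftrightarrow> \<gamma> \<in> initials x \<or> (\<exists>\<beta>'\<in>initials y. \<gamma> = \<beta> + \<beta>')"
proof -
  obtain p b q where b: "x = p @ [b]" "y = b # q" "b = flip \<beta> A" "x @ tl y = p @ b # q"
    by (rule join_cases[OF assms])
  have "crs (p @ [b]) = \<beta>" using assms(1) b(1) by (simp add: chains_from_def)
  then show ?thesis using initials_split[of \<gamma> p b q] unfolding b(4) b(1,2) by simp
qed

lemma zero_in_initials: "x \<noteq> [] \<Longrightarrow> 0 \<in> initials x"
  by (cases x rule: initials.cases) auto

lemma crs_in_initials: "x \<noteq> [] \<Longrightarrow> crs x \<in> initials x"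
  by (induction x rule: induct_list012) auto

lemma initials_le:
  assumes "\<beta> \<in> initials x"
  shows "\<exists>\<beta>'. crs x = \<beta> + \<beta>'"
  using assms crs_append by (auto simp: initials_iff)

text \<open>
  Reversal of chains turns the cut before the last crossing of the support into the cut after the
  first one.
\<close>

lemma exact_uncut_support_back:
  assumes \<alpha>: "supp \<alpha> \<subseteq> S" and S: "S \<subseteq> E"
  shows "exact faces (uncut A (\<alpha> + ind S) \<alpha>)"
proof (cases "chains_from A (\<alpha> + ind S) = {}")
  case True
  then show ?thesis by (simp add: uncut_def)
next
  case False
  let ?\<gamma> = "\<alpha> + ind S" and ?C = "flip (\<alpha> + ind S) A"
  have C: "?C \<in> T" using False chains_from_last by blast
  have rev_mem: "rev x \<in> chains_from (flip ?\<gamma> A) ?\<gamma>" if "x \<in> chains_from A ?\<gamma>" for x A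
    using that chains_from_last[OF that] by (auto simp: chains_from_def hd_rev crs_rev)
  have unc: "rev x \<in> uncut (flip ?\<gamma> A) ?\<gamma> \<beta>'"
    if "x \<in> uncut A ?\<gamma> \<beta>" "\<beta> + \<beta>' = ?\<gamma>" for x A \<beta> \<beta>'
  proof -
    have x: "x \<in> chains_from A ?\<gamma>" "\<beta> \<notin> initials x" using that by (auto simp: uncut_def)
    have "\<beta>' \<notin> initials (rev x)"
    proof
      assume "\<beta>' \<in> initials (rev x)"
      then obtain \<beta>'' where "\<beta>'' \<in> initials x" "\<beta>'' + \<beta>' = crs x" by (auto simp: initials_rev)
      moreover have "crs x = \<beta> + \<beta>'" using x that by (simp add: chains_from_def)
      ultimately show False using x by simp
    qed
    then show ?thesis using rev_mem[OF x(1)] by (simp add: uncut_def)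
  qed
  have "uncut A ?\<gamma> \<alpha> = rev ` uncut ?C ?\<gamma> (ind S)"
  proof (intro set_eqI iffI)
    fix x assume "x \<in> uncut A ?\<gamma> \<alpha>"
    then have "rev x \<in> uncut ?C ?\<gamma> (ind S)" by (rule unc) simp
    then show "x \<in> rev ` uncut ?C ?\<gamma> (ind S)" by (metis image_eqI rev_rev_ident)
  next
    fix x assume "x \<in> rev ` uncut ?C ?\<gamma> (ind S)"
    then show "x \<in> uncut A ?\<gamma> \<alpha>" using unc[of _ ?C "ind S" \<alpha>] by (auto simp: add.commute)
  qed
  moreover have "face_iso faces (uncut ?C ?\<gamma> (ind S)) faces (rev ` uncut ?C ?\<gamma> (ind S)) rev"
    by (auto simp: face_iso_def bij_betw_def inj_on_def faces_rev)
  moreover have "exact faces (uncut ?C ?\<gamma> (ind S))"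
  proof (rule exact_uncut_support[OF C _ S])
    have "supp ?\<gamma> = S" using \<alpha> by (auto simp: supp_add)
    then show "S = {e. ?\<gamma> e \<noteq> 0}" by (simp only: supp_def)
  qed
  ultimately show ?thesis using exact_iso by metis
qed

lemma complex_uncut: "is_complex faces (uncut A \<gamma> \<beta>)"
  by (rule is_complex_closed[OF complex_chains_from closed_uncut])

lemma closed_in_Int:
  assumes "closed_in faces (chains_from A \<gamma>) J" "closed_in faces (chains_from A \<gamma>) N"
  shows "closed_in faces J (J \<inter> N)"
  using assms unfolding closed_in_def by blast

lemma uncut_sub: "uncut A \<gamma> \<beta> \<subseteq> chains_from A \<gamma>"
  by (auto simp: uncut_def)

text \<open>
  Let \<open>J\<close> be the set of chains that cannot be cut after crossing \<open>Q\<close>, and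
  \<open>N\<close> the set of those that cannot be cut before a final crossing of \<open>S\<close>.
  The complex \<open>N\<close> is exact by \<open>exact_uncut_support_back\<close>. The chains of
  \<open>N\<close> that can be cut after \<open>Q\<close> form a tensor product whose second factor is
  exact by the same result, so \<open>N \<inter> J\<close> is exact. The chains of \<open>J\<close>
  that can be cut before \<open>S\<close> form a tensor product whose first factor is exact by
  hypothesis, and hence \<open>J\<close> is exact.
\<close>

lemma exact_uncut_flat_inside:
  assumes Q: "Q \<subseteq> S" "S \<subseteq> E" and \<delta>: "supp \<delta> \<subseteq> S"
    and IH: "exact faces (uncut A (ind Q + \<delta>) (ind Q))"
  shows "exact faces (uncut A (ind Q + (\<delta> + ind S)) (ind Q))"
proof -
  let ?g = "ind Q + \<delta>" and ?d = "\<delta> + ind S"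
  let ?\<gamma> = "ind Q + (\<delta> + ind S)" and ?B = "flip (ind Q) A"
  have \<gamma>: "?\<gamma> = ?g + ind S" by (simp only: add.assoc)
  let ?J = "uncut A ?\<gamma> (ind Q)" and ?N = "uncut A ?\<gamma> ?g"
  have supg: "supp ?g \<subseteq> S" using Q \<delta> by (auto simp: supp_add)
  have exN: "exact faces ?N" unfolding \<gamma> by (rule exact_uncut_support_back[OF supg Q(2)])
  have iQ: "ind Q \<in> initials x" if "x \<in> chains_from A ?g" "\<beta>' \<in> initials y" "ind Q = ?g + \<beta>'" for x y \<beta>'
  proof -
    have "ind Q + 0 = ind Q + (\<delta> + \<beta>')" using that(3) by (simp only: add.assoc add_0_right)
    then have "\<delta> + \<beta>' = 0" by (simp only: add_left_cancel)
    then have "\<delta> = 0" by (simp only: fun_add_eq_0_iff)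
    then have "crs x = ind Q" "x \<noteq> []" using that(1) by (auto simp: chains_from_def)
    then show ?thesis using crs_in_initials by metis
  qed
  have JN: "?J - ?N = join ` (uncut A ?g (ind Q) \<times> chains_from (flip ?g A) (ind S))"
  proof (intro set_eqI iffI)
    fix z assume "z \<in> ?J - ?N"
    then have z: "z \<in> chains_from A (?g + ind S)" "?g \<in> initials z" "ind Q \<notin> initials z"
      using \<gamma> by (auto simp: uncut_def)
    then have "z \<in> join ` (chains_from A ?g \<times> chains_from (flip ?g A) (ind S))"
      using chains_minus_uncut[of A ?g "ind S"] by (auto simp: uncut_def)
    then obtain x y where xy: "z = x @ tl y" "x \<in> chains_from A ?g" "y \<in> chains_from (flip ?g A) (ind S)" by auto
    then have "x \<in> uncut A ?g (ind Q)" using z(3) initials_join[OF xy(2,3)] by (auto simp: uncut_def)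
    then show "z \<in> join ` (uncut A ?g (ind Q) \<times> chains_from (flip ?g A) (ind S))" using xy by auto
  next
    fix z assume "z \<in> join ` (uncut A ?g (ind Q) \<times> chains_from (flip ?g A) (ind S))"
    then obtain x y where xy: "z = x @ tl y" "x \<in> chains_from A ?g" "y \<in> chains_from (flip ?g A) (ind S)"
      "ind Q \<notin> initials x" by (auto simp: uncut_def)
    have "ind Q \<notin> initials z" using initials_join[OF xy(2,3)] xy(1,4) iQ[OF xy(2)] by auto
    then show "z \<in> ?J - ?N" using join_mem[OF xy(2,3)] xy(1) \<gamma> by (auto simp: uncut_def)
  qed
  have NJ: "?N - (?N \<inter> ?J) = join ` (chains_from A (ind Q) \<times> uncut ?B ?d \<delta>)"
  proof (intro set_eqI iffI)
    fix z assume "z \<in> ?N - (?N \<inter> ?J)"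
    then have z: "z \<in> chains_from A ?\<gamma>" "?g \<notin> initials z" "ind Q \<in> initials z" by (auto simp: uncut_def)
    then have "z \<in> join ` (chains_from A (ind Q) \<times> chains_from ?B ?d)"
      using chains_minus_uncut[of A "ind Q" ?d] by (auto simp: uncut_def)
    then obtain x y where xy: "z = x @ tl y" "x \<in> chains_from A (ind Q)" "y \<in> chains_from ?B ?d" by auto
    then have "y \<in> uncut ?B ?d \<delta>" using z(2) initials_join[OF xy(2,3)] by (auto simp: uncut_def)
    then show "z \<in> join ` (chains_from A (ind Q) \<times> uncut ?B ?d \<delta>)" using xy by auto
  next
    fix z assume "z \<in> join ` (chains_from A (ind Q) \<times> uncut ?B ?d \<delta>)"
    then obtain x y where xy: "z = x @ tl y" "x \<in> chains_from A (ind Q)" "y \<in> chains_from ?B ?d"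
      "\<delta> \<notin> initials y" by (auto simp: uncut_def)
    have "?g \<notin> initials x"
    proof
      assume "?g \<in> initials x"
      then obtain \<beta>' where "crs x = ?g + \<beta>'" using initials_le by blast
      then have "ind Q + 0 = ind Q + (\<delta> + \<beta>')"
        using xy(2) by (simp only: chains_from_def mem_Collect_eq add.assoc add_0_right)
      then have "\<delta> + \<beta>' = 0" by (simp only: add_left_cancel)
      then have "\<delta> = 0" by (simp only: fun_add_eq_0_iff)
      then show False using xy(3,4) zero_in_initials by (auto simp: chains_from_def)
    qed
    then have "?g \<notin> initials z"
      using initials_join[OF xy(2,3)] xy(1,4) by (auto simp only: add_left_cancel)
    then show "z \<in> ?N - (?N \<inter> ?J)" using join_mem[OF xy(2,3)] xy(1) by (auto simp: uncut_def)
  qed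
  have "exact faces (uncut ?B ?d \<delta>)" by (rule exact_uncut_support_back[OF \<delta> Q(2)])
  then have exNJ: "exact faces (?N - (?N \<inter> ?J))"
    unfolding NJ by (rule exact_join_right[OF order_refl uncut_sub complex_chains_from complex_uncut])
  have "exact faces (?N \<inter> ?J)"
    by (rule exact_sub[OF complex_uncut closed_in_Int[OF closed_uncut closed_uncut] exN exNJ])
  then have ex1: "exact faces (?J \<inter> ?N)" by (simp add: Int_commute)
  have "exact faces (?J - ?N)"
    unfolding JN by (rule exact_join_left[OF uncut_sub order_refl complex_uncut complex_chains_from IH])
  moreover have "?J - (?J \<inter> ?N) = ?J - ?N" by blast
  ultimately have ex2: "exact faces (?J - (?J \<inter> ?N))" by (simp only:)
  show ?thesis
    by (rule exact_extension[OF complex_uncut closed_in_Int[OF closed_uncut closed_uncut] ex1 ex2])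
qed

lemma reorient_comp: "reorient S (reorient R A) = reorient ((S - R) \<union> (R - S)) A"
  by (auto simp: reorient_def)

text \<open>
  Let \<open>P\<close> be the support of \<open>\<delta>\<close> and \<open>S\<close> that of the sum.
  If \<open>Q\<close> is contained in \<open>P\<close>, then \<open>P\<close> can be split off at the
  end of the chains (\<open>exact_uncut_flat_inside\<close>), which makes \<open>\<delta>\<close>
  smaller.

  Otherwise \<open>P\<close>, which is facial by \<open>adm_summand\<close>, is a proper subset of
  \<open>S = Q \<union> P\<close>. Let \<open>U\<close> be a maximal facial set with \<open>P
  \<subseteq> U \<subset> S\<close>. The chains whose first step crosses \<open>U\<close> are exact by
  \<open>exact_meeting\<close>, and so are those among them that can be cut. If the first step crosses
  a set \<open>D\<close> outside \<open>U\<close>, then \<open>D \<subseteq> S - U \<subseteq>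
  Q\<close>, and what follows is a chain that cannot be cut after crossing \<open>Q - D\<close>. For
  \<open>D = S - U\<close> one has \<open>Q - D = Q \<inter> U\<close>. The rank of \<open>U\<close>
  is one less than that of \<open>S\<close>, and as \<open>P\<close> and \<open>Q\<close> are a
  modular pair, the rank of \<open>Q \<inter> U\<close> is one less than that of \<open>Q\<close>.
  Hence \<open>kappa\<close> is additive again and the induction hypothesis applies.

  If \<open>D\<close> is smaller, then all chains that may follow form an exact complex, since by
  \<open>facial_exchange\<close> their support is not facial; and so do those that can be cut, since a
  facial \<open>Q - D\<close> would have a rank strictly between those of \<open>Q \<inter> U\<close>
  and \<open>Q\<close>.
\<close>

theorem exact_uncut_flat:
  assumes "A \<in> T" "Q \<subseteq> E" "facial A Q" "\<delta> \<in> exponents E" "adm (ind Q + \<delta>) A"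
    and "kap (ind Q + \<delta>) = rk \<phi> Q + kap \<delta>"
  shows "exact faces (uncut A (ind Q + \<delta>) (ind Q))"
  using assms
proof (induction "card Q + (\<Sum>e\<in>E. \<delta> e)" arbitrary: A Q \<delta> rule: less_induct)
  case less
  note A = less.prems(1) and Q = less.prems(2,3) and \<delta>E = less.prems(4)
    and adm = less.prems(5) and eq = less.prems(6)
  define P where "P = supp \<delta>"
  define S where "S = Q \<union> P"
  let ?\<gamma> = "ind Q + \<delta>" and ?B = "reorient Q A"
  have PE: "P \<subseteq> E" using supp_sub_E[OF \<delta>E] by (simp add: P_def)
  have SE: "S \<subseteq> E" using PE Q by (simp add: S_def)
  have suppS: "supp ?\<gamma> = S" by (simp add: supp_add S_def P_def)
  have \<gamma>E: "?\<gamma> \<in> exponents E" using Q \<delta>E by simp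
  have fS: "facial A S" using adm_supp[OF \<gamma>E adm] suppS by simp
  have admB: "adm \<delta> ?B" by (rule adm_summand[OF A Q adm eq])
  show ?case
  proof (cases "Q = {}")
    case True
    then have "uncut A ?\<gamma> (ind Q) = {}"
      using zero_in_initials by (auto simp: uncut_def chains_from_def)
    then show ?thesis by simp
  next
    case Qne: False
    show ?thesis
    proof (cases "Q \<subseteq> P")
      case True
      then have SP: "S = P" by (auto simp: S_def)
      obtain \<delta>' where \<delta>': "\<delta> = ind P + \<delta>'" "supp \<delta>' \<subseteq> P"
        using split_support[of \<delta>] unfolding P_def by blast
      have \<delta>'E: "\<delta>' \<in> exponents E" using \<delta>E \<delta>'(1) by simp
      have \<gamma>': "?\<gamma> = ind P + (ind Q + \<delta>')" unfolding \<delta>'(1) by (simp only: add.left_commute)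
      have sup: "supp (ind Q + \<delta>') \<subseteq> P" using True \<delta>' by (auto simp: supp_add)
      have fP: "facial A P" using fS SP by simp
      have "adm (ind Q + \<delta>') (reorient P A)" using adm adm_shift[OF sup PE, of A] unfolding \<gamma>' by blast
      then have adm': "adm (ind Q + \<delta>') A" using adm_reorient[OF fP sup] by simp
      have "kap ?\<gamma> = rk \<phi> P + kap (ind Q + \<delta>')" unfolding \<gamma>' by (rule kap_shift[OF sup PE])
      moreover have "kap \<delta> = rk \<phi> P + kap \<delta>'" unfolding \<delta>'(1) by (rule kap_shift[OF \<delta>'(2) PE])
      ultimately have eq': "kap (ind Q + \<delta>') = rk \<phi> Q + kap \<delta>'" using eq by linarith
      have Pne: "P \<noteq> {}" using Qne True by auto
      then obtain e where "e \<in> P" by auto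
      then have "(0::nat) < (\<Sum>e\<in>E. indicator P e)"
        using PE finite_E member_le_sum[of e E "indicator P :: _ \<Rightarrow> nat"] by auto
      then have "(\<Sum>e\<in>E. \<delta>' e) < (\<Sum>e\<in>E. \<delta> e)" by (simp add: \<delta>'(1) sum.distrib)
      then have "exact faces (uncut A (ind Q + \<delta>') (ind Q))"
        by (intro less.hyps[OF _ A Q \<delta>'E adm' eq']) simp
      then have "exact faces (uncut A (ind Q + (\<delta>' + ind P)) (ind Q))"
        by (rule exact_uncut_flat_inside[OF True PE \<delta>'(2)])
      then show ?thesis unfolding \<delta>'(1) by (simp only: add.commute)
    next
      case False
      then have PS: "P \<subset> S" by (auto simp: S_def)
      have BT: "?B \<in> T" using facial_opposite(1)[OF A Q(2) facial_empty[OF A]] by simp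
      have fP: "facial A P"
      proof -
        \<comment> \<open>The set \<open>P\<close> is facial for \<open>?B\<close>, and reflecting in \<open>S -
          P\<close> leads back to \<open>A\<close> up to signs in \<open>P\<close>.\<close>
        have "facial ?B S" using fS by (rule facial_cong) (auto simp: reorient_def S_def)
        moreover have "facial ?B P" using adm_supp[OF \<delta>E admB] by (simp add: P_def)
        ultimately have "facial (reorient (S - P) ?B) P" using facial_opposite(2)[OF BT _ _ ] PS by blast
        then show ?thesis by (rule facial_cong) (auto simp: reorient_def S_def)
      qed
      let ?C = "{U. facial A U \<and> P \<subseteq> U \<and> U \<subset> S}"
      have "\<exists>U. U \<in> ?C \<and> (\<forall>U'. U' \<in> ?C \<longrightarrow> card U' \<le> card U)"
      proof (rule ex_has_greatest_nat[where b = "Suc (card S)"])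
        show "P \<in> ?C" using fP PS by simp
        show "\<forall>U. U \<in> ?C \<longrightarrow> card U < Suc (card S)"
          using finite_sub[OF SE] by (auto simp: less_Suc_eq_le intro: card_mono)
      qed
      then obtain U where U: "facial A U" "P \<subseteq> U" "U \<subset> S"
        and U_max: "\<And>U'. facial A U' \<Longrightarrow> P \<subseteq> U' \<Longrightarrow> U' \<subset> S \<Longrightarrow> card U' \<le> card U" by blast
      have max: "U' = S" if "facial A U'" "U \<subset> U'" "U' \<subseteq> S" for U'
      proof (rule ccontr)
        assume "U' \<noteq> S"
        then have "card U' \<le> card U" using U_max[of U'] that U(2) by auto
        moreover have "card U < card U'"
          using that finite_sub[OF SE] finite_subset by (intro psubset_card_mono) auto
        ultimately show False by simp
      qed
      define Q' where "Q' = Q \<inter> U"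
      define Xs where "Xs = reorient (S - U) A"
      have D: "S - U \<subseteq> Q" "S - U = Q - Q'" "S - U \<noteq> {}" using U by (auto simp: S_def Q'_def)
      have Upq: "P \<union> Q' = U" "P \<inter> Q' = P \<inter> Q" using U by (auto simp: S_def Q'_def)
      have Q'E: "Q' \<subseteq> E" "Q' \<subset> Q" using Q D by (auto simp: Q'_def)
      have fQ': "facial A Q'" using facial_Int[OF Q(2) U(1)] by (simp add: Q'_def)
      have Xs: "Xs \<in> T" "facial Xs U" "facial Xs Q'"
        using facial_opposite[OF A fS U(1)] facial_opposite(2)[OF A Q(2) fQ'] U(3) Q'E D(2)
        by (auto simp: Xs_def)
      have rkS: "rk \<phi> S = Suc (rk \<phi> U)" by (rule rank_maximal_face[OF A fS U(1,3) max])
      have rkQ: "rk \<phi> Q = Suc (rk \<phi> Q')"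
      proof (rule antisym)
        have "lev 1 ?\<gamma> = S" "lev 1 \<delta> = P" using lev_1[OF \<gamma>E] lev_1[OF \<delta>E] suppS by (auto simp: P_def)
        then have "rk \<phi> S + rk \<phi> (Q \<inter> P) = rk \<phi> P + rk \<phi> Q"
          using kap_add_ind(2)[OF Q(1) eq, of 1] Q(1) by (simp add: lev_0 Int_absorb2)
        moreover have "rk \<phi> U + rk \<phi> (P \<inter> Q) \<le> rk \<phi> P + rk \<phi> Q'"
          using rank_submodular[OF PE Q'E(1)] Upq by simp
        ultimately show "rk \<phi> Q \<le> Suc (rk \<phi> Q')" using rkS by (simp add: Int_commute)
        obtain e where e: "e \<in> Q - Q'" using D by auto
        then have "rk \<phi> (insert e Q') = Suc (rk \<phi> Q')"
          using rank_insert_facial[OF fQ' order_refl, of e] Q by auto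
        moreover have "rk \<phi> (insert e Q') \<le> rk \<phi> Q" using e Q'E Q by (intro rank_mono) auto
        ultimately show "Suc (rk \<phi> Q') \<le> rk \<phi> Q" by simp
      qed
      define \<gamma>' where "\<gamma>' = ind Q' + \<delta>"
      have \<gamma>\<gamma>': "?\<gamma> = ind (S - U) + \<gamma>'"
      proof -
        have "ind Q = ind (S - U) + ind Q'" using D Q'E by (subst ind_add) (auto intro!: arg_cong[where f = ind])
        then show ?thesis by (simp only: \<gamma>'_def add.assoc)
      qed
      obtain \<epsilon> where \<epsilon>: "?\<gamma> = ind S + \<epsilon>" "supp \<epsilon> \<subseteq> S" using split_support[of ?\<gamma>] suppS by metis
      have \<gamma>'\<epsilon>: "\<gamma>' = ind U + \<epsilon>"
      proof -
        have "ind (S - U) + \<gamma>' = ind (S - U) + (ind U + \<epsilon>)"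
          using \<gamma>\<gamma>' \<epsilon>(1) ind_plus_Diff[of U S] U(3) by (simp add: ac_simps)
        then show ?thesis by (simp only: add_left_cancel)
      qed
      have \<epsilon>U: "supp \<epsilon> \<subseteq> U"
      proof
        fix e assume "e \<in> supp \<epsilon>"
        then have "\<gamma>' e \<noteq> 0" unfolding \<gamma>'\<epsilon> by (simp add: supp_def)
        then show "e \<in> U" using U(2) by (auto simp: \<gamma>'_def Q'_def P_def supp_def indicator_def split: if_splits)
      qed
      have UE: "U \<subseteq> E" using U SE by auto
      have adm': "adm \<gamma>' Xs"
      proof -
        have "adm \<epsilon> (reorient S A)" using adm adm_shift[OF \<epsilon>(2) SE] unfolding \<epsilon>(1) by blast
        moreover have "reorient U Xs = reorient S A"
          unfolding Xs_def reorient_comp using U(3) by (intro arg_cong2[where f = reorient]) auto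
        ultimately show ?thesis unfolding \<gamma>'\<epsilon> using adm_shift[OF \<epsilon>U UE] Xs(2) by simp
      qed
      have "kap ?\<gamma> = rk \<phi> S + kap \<epsilon>" unfolding \<epsilon>(1) by (rule kap_shift[OF \<epsilon>(2) SE])
      moreover have "kap \<gamma>' = rk \<phi> U + kap \<epsilon>" unfolding \<gamma>'\<epsilon> by (rule kap_shift[OF \<epsilon>U UE])
      ultimately have eq': "kap \<gamma>' = rk \<phi> Q' + kap \<delta>" using eq rkS rkQ by linarith
      have "card Q' < card Q" using Q'E finite_sub[OF Q(1)] by (intro psubset_card_mono)
      then have IH: "exact faces (uncut Xs \<gamma>' (ind Q'))"
        using less.hyps[of Q' \<delta> Xs] Xs Q'E \<delta>E adm' eq' by (simp add: \<gamma>'_def)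
      obtain e0 where e0: "e0 \<in> S" "e0 \<notin> U" "e0 \<in> Q" using D by auto
      define J where "J = uncut A ?\<gamma> (ind Q)"
      define W where "W = meeting A ?\<gamma> U"
      have cW: "closed_in faces (chains_from A ?\<gamma>) W" unfolding W_def by (rule closed_meeting)
      have cJ: "closed_in faces (chains_from A ?\<gamma>) J" unfolding J_def by (rule closed_uncut)
      have KW: "is_complex faces W" by (rule is_complex_closed[OF complex_chains_from cW])
      have KJ: "is_complex faces J" by (rule is_complex_closed[OF complex_chains_from cJ])
      have exW: "exact faces W"
        unfolding W_def by (rule exact_meeting[OF A U(1) e0(2)]) (use e0(3) in simp)
      have "exact faces (W - W \<inter> J)"
      proof -
        have split: "W - W \<inter> J = join ` (meeting A (ind Q) U \<times> chains_from (flip (ind Q) A) \<delta>)"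
        proof -
          have mt: "meets U (x @ tl y) \<longleftrightarrow> meets U x" if "x \<in> chains_from A (ind Q)" for x y
            using chains_from_nonzero[OF that] Qne by auto
          have "W - W \<inter> J = {z \<in> chains_from A ?\<gamma> - uncut A ?\<gamma> (ind Q). meets U z}"
            by (auto simp: W_def J_def meeting_def uncut_def)
          also have "\<dots> = join ` (meeting A (ind Q) U \<times> chains_from (flip (ind Q) A) \<delta>)"
            unfolding chains_minus_uncut using mt by (fastforce simp: meeting_def)
          finally show ?thesis .
        qed
        have "exact faces (meeting A (ind Q) U)"
          by (rule exact_meeting[OF A U(1) e0(2)]) (use e0(3) in simp)
        moreover have "meeting A (ind Q) U \<subseteq> chains_from A (ind Q)" by (auto simp: meeting_def)
        moreover have "is_complex faces (meeting A (ind Q) U)"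
          by (rule is_complex_closed[OF complex_chains_from closed_meeting])
        ultimately show ?thesis
          unfolding split
          using exact_join_left[OF _ order_refl _ complex_chains_from, of "meeting A (ind Q) U" A "ind Q" \<delta>]
          by blast
      qed
      then have "exact faces (W \<inter> J)" by (rule exact_sub[OF KW closed_in_Int[OF cW cJ] exW])
      then have exJW: "exact faces (J \<inter> W)" by (simp add: Int_commute)
      have "exact faces (J - J \<inter> W)"
      proof (rule exact_first_steps)
        show "J - J \<inter> W \<subseteq> chains_from A ?\<gamma>" using cJ by (auto simp: closed_in_def)
        show "is_complex faces (J - J \<inter> W)" by (rule is_complex_Diff_closed[OF KJ closed_in_Int[OF cJ cW]])
        have "ind Q \<noteq> 0" using Qne by simp
        then show "?\<gamma> \<noteq> 0" by (simp only: fun_add_eq_0_iff) simp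
      next
        fix X
        show "exact faces {x \<in> J - J \<inter> W. second x = X}"
        proof (cases "{x \<in> J - J \<inter> W. second x = X} = {}")
          case False
          then obtain x where x: "x \<in> chains_from A ?\<gamma>" "\<not> meets U x" "second x = X"
            by (auto simp: J_def W_def uncut_def meeting_def)
          have "?\<gamma> \<noteq> 0" using suppS e0 by (metis empty_iff supp_empty_iff)
          then obtain X' q where "x = A # X' # q" using chains_from_nonzero[OF x(1)] by blast
          then have q: "x = A # X # q" using x(3) by simp
          obtain \<gamma>X where \<gamma>X: "?\<gamma> = ind (Sep A X) + \<gamma>X" "A \<noteq> X" "X # q \<in> chains_from X \<gamma>X"
            using x(1) unfolding q chains_from_Cons by blast
          have XT: "X \<in> T" using chains_from_tope[OF \<gamma>X(3)] .
          let ?D = "Sep A X"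
          have "?D \<subseteq> S" using \<gamma>X(1) suppS by (metis Un_upper1 supp_add supp_ind)
          then have DS: "?D \<subseteq> S - U" using x(2) q by auto
          have Dne: "?D \<noteq> {}" using \<gamma>X(2) by simp
          have DQ: "?D \<subseteq> Q" using DS D by auto
          have \<gamma>X': "\<gamma>X = ind (Q - ?D) + \<delta>"
          proof -
            have "ind ?D + \<gamma>X = ind ?D + (ind (Q - ?D) + \<delta>)"
              using \<gamma>X(1) ind_plus_Diff[OF DQ] by (simp only: add.assoc[symmetric])
            then show ?thesis by (simp only: add_left_cancel)
          qed
          have fib: "{x \<in> J - J \<inter> W. second x = X} = Cons A ` uncut X \<gamma>X (ind (Q - ?D))"
          proof -
            have iso: "{x \<in> chains_from A ?\<gamma>. second x = X} = Cons A ` chains_from X \<gamma>X"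
              using Cons_iso[OF A \<gamma>X(2), of \<gamma>X] \<gamma>X(1) by (auto simp: face_iso_def bij_betw_def)
            have "{x \<in> J - J \<inter> W. second x = X} =
                {x \<in> {x \<in> chains_from A ?\<gamma>. second x = X}. \<not> meets U x \<and> ind Q \<notin> initials x}"
              by (auto simp: J_def W_def uncut_def meeting_def)
            also have "\<dots> = {x \<in> Cons A ` chains_from X \<gamma>X. \<not> meets U x \<and> ind Q \<notin> initials x}"
              unfolding iso ..
            also have "\<dots> = Cons A ` uncut X \<gamma>X (ind (Q - ?D))"
            proof -
              have "\<not> meets U (A # y) \<and> ind Q \<notin> initials (A # y) \<longleftrightarrow> ind (Q - ?D) \<notin> initials y"
                if y: "y \<in> chains_from X \<gamma>X" for y
              proof -
                obtain r where r: "y = X # r" using y by (cases y) (auto simp: chains_from_def)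
                have "ind Q \<in> initials (A # y) \<longleftrightarrow> (\<exists>\<beta>\<in>initials y. ind Q = ind ?D + \<beta>)"
                  using r Qne by auto
                also have "\<dots> \<longleftrightarrow> ind (Q - ?D) \<in> initials y"
                  using ind_plus_eq(2)[of Q ?D] ind_plus_Diff[OF DQ] by metis
                finally show ?thesis using r DS by auto
              qed
              then show ?thesis by (auto simp: uncut_def)
            qed
            finally show ?thesis .
          qed
          have "face_iso faces (uncut X \<gamma>X (ind (Q - ?D))) faces (Cons A ` uncut X \<gamma>X (ind (Q - ?D))) (Cons A)"
            by (rule face_iso_restrict[OF Cons_iso[OF A \<gamma>X(2)] uncut_sub])
          moreover have "exact faces (uncut X \<gamma>X (ind (Q - ?D)))"
          proof (cases "?D = S - U")
            case True
            then have "X = Xs" using reorient_Sep[OF A XT] by (simp add: Xs_def)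
            moreover have "Q - ?D = Q'" using True D Q'E by auto
            ultimately show ?thesis using IH \<gamma>X' by (simp add: \<gamma>'_def)
          next
            case ne: False
            have "\<not> adm \<gamma>X X"
            proof
              assume "adm \<gamma>X X"
              moreover have "\<gamma>X \<in> exponents E" using \<gamma>E \<gamma>X(1) by simp
              ultimately have "facial X (supp \<gamma>X)" by (rule adm_supp[rotated])
              moreover have "supp \<gamma>X = S - ?D"
                unfolding \<gamma>X' using DS U(2) by (auto simp: supp_add P_def S_def)
              ultimately obtain U' where "facial A U'" "U \<inter> S \<subset> U'" "U' \<subseteq> S" "U' \<subseteq> U \<union> ?D"
                using facial_exchange[OF A XT U(1) SE DS Dne] by metis
              moreover have "U \<inter> S = U" using U by auto
              ultimately have "S \<subseteq> U \<union> ?D" using max by metis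
              then show False using ne DS by auto
            qed
            moreover have "\<gamma>X \<in> exponents E" using \<gamma>E \<gamma>X(1) by simp
            ultimately have exX: "exact faces (chains_from X \<gamma>X)" using cohomology_of_chains[OF XT] by blast
            have "\<not> facial X (Q - ?D)"
            proof
              assume f: "facial X (Q - ?D)"
              obtain t where t: "t \<in> ?D" using Dne by blast
              obtain e where e: "e \<in> Q - U" "e \<notin> ?D" using ne DS D by (auto simp: Q'_def)
              have "rk \<phi> (insert t (Q - ?D)) = Suc (rk \<phi> (Q - ?D))"
                using rank_insert_facial[OF f order_refl, of t] t DQ Q(1) by auto
              moreover have "rk \<phi> (insert t (Q - ?D)) \<le> rk \<phi> Q" using t DQ Q(1) by (intro rank_mono) auto
              moreover have "rk \<phi> (insert e Q') = Suc (rk \<phi> Q')"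
                using rank_insert_facial[OF U(1), of Q' e] e Q(1) by (auto simp: Q'_def)
              moreover have "rk \<phi> (insert e Q') \<le> rk \<phi> (Q - ?D)"
                using e DS Q(1) by (intro rank_mono) (auto simp: Q'_def)
              ultimately show False using rkQ by linarith
            qed
            then have "exact faces (chains_from X (ind (Q - ?D)))"
              using geodesic_cohomology[OF XT, of "Q - ?D"] Q(1) by blast
            then have "exact faces (chains_from X \<gamma>X - uncut X \<gamma>X (ind (Q - ?D)))"
              unfolding \<gamma>X' chains_minus_uncut
              by (rule exact_join_left[OF order_refl order_refl complex_chains_from complex_chains_from])
            then show ?thesis by (rule exact_sub[OF complex_chains_from closed_uncut exX])
          qed
          ultimately show ?thesis unfolding fib by (rule exact_iso)
        qed (metis exact_empty)
      qed
      then have "exact faces J" by (rule exact_extension[OF KJ closed_in_Int[OF cJ cW] exJW])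
      then show ?thesis by (simp add: J_def)
    qed
  qed
qed

section \<open>Products of generators\<close>

lemma cup_cochain_assoc:
  fixes f g h :: "'b sign_vector list \<Rightarrow> bit"
  shows "cup_cochain (a + b) (cup_cochain a f g) h = cup_cochain a f (cup_cochain b g h)"
proof
  fix z :: "'b sign_vector list"
  have "take (a + 1) (take (a + b + 1) z) = take (a + 1) z" by (simp add: min_def)
  moreover have "drop a (take (a + b + 1) z) = take (b + 1) (drop a z)" by (simp add: drop_take)
  moreover have "drop b (drop a z) = drop (a + b) z" by (simp add: add.commute)
  ultimately show "cup_cochain (a + b) (cup_cochain a f g) h z = cup_cochain a f (cup_cochain b g h) z"
    unfolding cup_cochain_def by (simp only: mult.assoc)
qed

text \<open>
  Write \<open>\<alpha> = ind Q + \<delta>\<close> with \<open>Q\<close> the support of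
  \<open>\<alpha>\<close>. Subadditivity of \<open>kappa\<close> turns the additivity for
  \<open>\<alpha>\<close> and \<open>\<beta>\<close> into additivity for \<open>Q\<close> and
  \<open>\<delta> + \<beta>\<close> and for \<open>\<delta>\<close> and \<open>\<beta>\<close>. So by
  induction the product of generators for \<open>\<delta>\<close> and \<open>\<beta>\<close> is a
  generator for \<open>\<delta> + \<beta>\<close>, and multiplying it by a generator for
  \<open>Q\<close> gives one for \<open>\<alpha> + \<beta>\<close> by \<open>exact_uncut_flat\<close>.
  A generator for \<open>Q\<close> times one for \<open>\<delta>\<close> is a generator for
  \<open>\<alpha>\<close> by \<open>exact_uncut_support\<close>; it remains to use associativity.
\<close>

theorem product_of_generators:
  assumes "\<alpha> \<in> exponents E" "\<beta> \<in> exponents E" "A \<in> T"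
    and "adm \<alpha> A" "adm \<beta> (flip \<alpha> A)" "adm (\<alpha> + \<beta>) A" "kap (\<alpha> + \<beta>) = kap \<alpha> + kap \<beta>"
    and "flip \<alpha> A \<in> T"
  shows "\<exists>f g. generates faces length (chains_from A \<alpha>) (Suc (kap \<alpha>)) f \<and>
    generates faces length (chains_from (flip \<alpha> A) \<beta>) (Suc (kap \<beta>)) g \<and>
    generates faces length (chains_from A (\<alpha> + \<beta>)) (Suc (kap \<alpha> + kap \<beta>)) (cup_cochain (kap \<alpha>) f g)"
  using assms
proof (induction arbitrary: A rule: exponents_induct)
  case zero
  let ?f = "\<lambda>x. if x = [A] then 1 else 0 :: bit"
  have A: "A \<in> T" by fact
  have "adm \<beta> A" using zero by simp
  then obtain g where g: "generates faces length (chains_from A \<beta>) (Suc (kap \<beta>)) g"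
    using cohomology_of_chains[OF A zero(1)] by blast
  have "cup_cochain 0 ?f g = g"
  proof
    fix z
    show "cup_cochain 0 ?f g z = g z"
    proof (cases "g z = 0")
      case False
      then have "z \<in> chains_from A \<beta>" using generates_supp[OF g] by blast
      then have "take 1 z = [A]" by (cases z) (auto simp: chains_from_def)
      then show ?thesis by (simp add: cup_cochain_def)
    qed (simp add: cup_cochain_def)
  qed
  then have "generates faces length (chains_from A \<beta>) (Suc (0 + kap \<beta>)) (cup_cochain 0 ?f g)"
    using g by simp
  moreover have "generates faces length (chains_from A 0) (Suc 0) ?f" using generates_point[OF A] by simp
  ultimately show ?case using g unfolding flip_0 kap_0 add_0 by blast
next
  case (step Q \<delta>)
  note Q = step(1) and \<delta>Q = step(3) and \<delta>E = step(4) and \<beta>E = step(6) and A = step(7)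
    and adm\<alpha> = step(8) and adm\<beta> = step(9) and adm\<gamma> = step(10) and eq = step(11) and C = step(12)
  let ?A' = "reorient Q A"
  have f: "facial A Q" "adm \<delta> ?A'" using adm\<alpha> adm_shift[OF \<delta>Q Q, of A] by blast+
  have A': "?A' \<in> T" using facial_opposite(1)[OF A f(1) facial_empty[OF A]] by simp
  have \<gamma>: "ind Q + \<delta> + \<beta> = ind Q + (\<delta> + \<beta>)" by (simp only: add.assoc)
  have k: "kap (ind Q + \<delta>) = rk \<phi> Q + kap \<delta>" by (rule kap_shift[OF \<delta>Q Q])
  have "kap (ind Q + (\<delta> + \<beta>)) \<le> rk \<phi> Q + kap (\<delta> + \<beta>)" by (rule kap_add_ind(1)[OF Q])
  moreover have "kap (\<delta> + \<beta>) \<le> kap \<delta> + kap \<beta>" by (rule kap_subadditive[OF \<delta>E])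
  ultimately have k1: "kap (ind Q + (\<delta> + \<beta>)) = rk \<phi> Q + kap (\<delta> + \<beta>)" and k2: "kap (\<delta> + \<beta>) = kap \<delta> + kap \<beta>"
    using eq k unfolding \<gamma> by linarith+
  have adm\<gamma>': "adm (ind Q + (\<delta> + \<beta>)) A" using adm\<gamma> unfolding \<gamma> .
  have flipA: "flip \<delta> ?A' = flip (ind Q + \<delta>) A" by (simp only: flip_add flip_ind)
  have "adm (\<delta> + \<beta>) ?A'" by (rule adm_summand[OF A Q f(1) adm\<gamma>' k1])
  then obtain f2 g where f2: "generates faces length (chains_from ?A' \<delta>) (Suc (kap \<delta>)) f2"
    and g: "generates faces length (chains_from (flip \<delta> ?A') \<beta>) (Suc (kap \<beta>)) g"
    and f2g: "generates faces length (chains_from ?A' (\<delta> + \<beta>)) (Suc (kap \<delta> + kap \<beta>)) (cup_cochain (kap \<delta>) f2 g)"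
    using step(5)[OF \<beta>E A' f(2)] adm\<beta> k2 C unfolding flipA by blast
  obtain f1 where f1: "generates faces length (chains_from A (ind Q)) (Suc (rk \<phi> Q)) f1"
    using geodesic_cohomology[OF A Q] f(1) by blast
  have "supp (ind Q + \<delta>) = Q" using \<delta>Q by (auto simp: supp_add)
  then have "Q = {e. (ind Q + \<delta>) e \<noteq> 0}" by (simp only: supp_def)
  then have ex1: "exact faces (uncut A (ind Q + \<delta>) (ind Q))" by (rule exact_uncut_support[OF A _ Q])
  have "generates faces length (chains_from A (ind Q + \<delta>)) (Suc (rk \<phi> Q + kap \<delta>)) (cup_cochain (rk \<phi> Q) f1 f2)"
    using generates_cup[OF f1 _ ex1, of "kap \<delta>" f2] f2 by simp
  moreover have "exact faces (uncut A (ind Q + (\<delta> + \<beta>)) (ind Q))"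
    using exact_uncut_flat[OF A Q f(1) _ adm\<gamma>' k1] \<delta>E \<beta>E by simp
  then have "generates faces length (chains_from A (ind Q + (\<delta> + \<beta>))) (Suc (rk \<phi> Q + (kap \<delta> + kap \<beta>)))
      (cup_cochain (rk \<phi> Q) f1 (cup_cochain (kap \<delta>) f2 g))"
    using generates_cup[OF f1, of "\<delta> + \<beta>" "kap \<delta> + kap \<beta>"] f2g by simp
  ultimately have "generates faces length (chains_from A (ind Q + \<delta>)) (Suc (kap (ind Q + \<delta>)))
      (cup_cochain (rk \<phi> Q) f1 f2)"
    "generates faces length (chains_from A (ind Q + \<delta> + \<beta>)) (Suc (kap (ind Q + \<delta>) + kap \<beta>))
      (cup_cochain (kap (ind Q + \<delta>)) (cup_cochain (rk \<phi> Q) f1 f2) g)"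
    unfolding k \<gamma> cup_cochain_assoc by (simp_all only: add.assoc)
  then show ?case using g unfolding flipA by blast
qed

end

section \<open>The magnitude complex of the tope graph\<close>

lemma crossing_crs: "crossing x = crs x"
proof (induction x rule: induct_list012)
  case (3 a b q)
  have "crossing (a # b # q) e = crs (a # b # q) e" for e
  proof -
    let ?t = "\<lambda>x i. indicator (Sep (x ! (i - 1)) (x ! i)) e :: nat"
    have "crossing (a # b # q) e = (\<Sum>i = 1..<Suc (length (b # q)). ?t (a # b # q) i)"
      by (simp add: crossing_def)
    also have "\<dots> = ?t (a # b # q) 1 + (\<Sum>i = Suc 1..<Suc (length (b # q)). ?t (a # b # q) i)"
      by (rule sum.atLeast_Suc_lessThan) simp
    also have "(\<Sum>i = Suc 1..<Suc (length (b # q)). ?t (a # b # q) i) =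
        (\<Sum>i = 1..<length (b # q). ?t (a # b # q) (Suc i))"
      by (rule sum.shift_bounds_Suc_ivl)
    also have "\<dots> = crossing (b # q) e"
      unfolding crossing_def by (rule sum.cong) (auto simp: nth_Cons')
    also have "\<dots> = crs (b # q) e" using 3(2) by simp
    finally show ?thesis by simp
  qed
  then show ?case by (rule ext)
qed (auto simp: crossing_def fun_eq_iff)

abbreviation del :: "nat \<Rightarrow> 'a list \<Rightarrow> 'a list"
  where "del i x \<equiv> take i x @ drop (i + 1) x"

definition smooth :: "'e sign_vector list \<Rightarrow> nat \<Rightarrow> bool"
  where "smooth x i \<longleftrightarrow> Sep (x ! (i - 1)) (x ! i) \<inter> Sep (x ! i) (x ! (i + 1)) = {}"

lemma faces_del: "faces x = (\<lambda>i. del i x) ` {i \<in> {1..<length x - 1}. smooth x i}"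
proof (intro set_eqI iffI)
  fix y assume "y \<in> faces x"
  then obtain u b v where u: "x = u @ b # v" "y = u @ v" "u \<noteq> []" "v \<noteq> []"
    "Sep (last u) b \<inter> Sep b (hd v) = {}" by (rule faces_delete)
  have "smooth x (length u)"
    using u by (simp add: smooth_def nth_append last_conv_nth hd_conv_nth)
  moreover have "length u \<in> {1..<length x - 1}" using u by (cases u; cases v) auto
  moreover have "y = del (length u) x" using u by simp
  ultimately show "y \<in> (\<lambda>i. del i x) ` {i \<in> {1..<length x - 1}. smooth x i}" by blast
next
  fix y assume "y \<in> (\<lambda>i. del i x) ` {i \<in> {1..<length x - 1}. smooth x i}"
  then obtain i where i: "1 \<le> i" "i < length x - 1" "smooth x i" "y = del i x" by auto
  have x: "x = take i x @ x ! i # drop (Suc i) x" using i by (intro id_take_nth_drop) simp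
  have l: "last (take i x) = x ! (i - 1)" using i by (subst last_conv_nth) auto
  have h: "hd (drop (Suc i) x) = x ! (i + 1)" using i by (simp add: hd_drop_conv_nth)
  have "take i x @ drop (Suc i) x \<in> faces (take i x @ x ! i # drop (Suc i) x)"
    by (rule faces_deleteI) (use i l h in \<open>auto simp: smooth_def\<close>)
  then show "y \<in> faces x" using x i(4) by simp
qed

text \<open>
  If deleting either of two vertices has the same result, the first of them agrees with its successor.
\<close>

lemma inj_on_del: "distinct_adj x \<Longrightarrow> inj_on (\<lambda>i. del i x) {i \<in> {1..<length x - 1}. smooth x i}"
proof -
  assume d: "distinct_adj x"
  have False if ij: "i < j" "j < length x - 1" "del i x = del j x" for i j
  proof -
    have "del i x ! i = x ! (i + 1)" "del j x ! i = x ! i"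
      using ij(1,2) by (simp_all add: nth_append)
    then have "x ! i = x ! Suc i" using ij(3) by (metis Suc_eq_plus1)
    then show False using d ij by (auto simp: distinct_adj_conv_nth)
  qed
  then show ?thesis by (intro inj_onI) (metis (lifting) atLeastLessThan_iff linorder_neqE_nat mem_Collect_eq)
qed

text \<open>The coboundary in all degrees and for all crossing vectors at once.\<close>

definition df :: "('e sign_vector list \<Rightarrow> bit) \<Rightarrow> 'e sign_vector list \<Rightarrow> bit"
  where "df f x = (\<Sum>y\<in>faces x. f y)"

lemma df_del:
  assumes "distinct_adj x"
  shows "df f x = (\<Sum>i = 1..<length x - 1. if smooth x i then f (del i x) else 0)"
proof -
  have "df f x = (\<Sum>i\<in>{i \<in> {1..<length x - 1}. smooth x i}. f (del i x))"
    unfolding df_def faces_del by (subst sum.reindex[OF inj_on_del[OF assms]]) simp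
  also have "\<dots> = (\<Sum>i = 1..<length x - 1. if smooth x i then f (del i x) else 0)"
    by (rule sum.inter_filter) simp
  finally show ?thesis .
qed

text \<open>
  Deleting a vertex of index at most \<open>p\<close> does not affect the second factor, deleting one
  of larger index does not affect the first.
\<close>

lemma df_cup:
  assumes x: "distinct_adj x" and len: "length x = p + q + 2"
  shows "df (cup_cochain p f g) x =
    df f (take (p + 2) x) * g (drop (p + 1) x) + f (take (p + 1) x) * df g (drop p x)"
proof -
  let ?t = "\<lambda>i. if smooth x i then cup_cochain p f g (del i x) else 0"
  have d: "distinct_adj (take (p + 2) x)" "distinct_adj (drop p x)"
    using x distinct_adj_appendD1 distinct_adj_appendD2 by (metis append_take_drop_id)+
  have "df (cup_cochain p f g) x = (\<Sum>i = 1..<p + q + 1. ?t i)"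
    using df_del[OF x, of "cup_cochain p f g"] len by simp
  also have "\<dots> = (\<Sum>i = 1..<p + 1. ?t i) + (\<Sum>i = p + 1..<p + q + 1. ?t i)"
    by (rule sum.atLeastLessThan_concat[symmetric]) auto
  also have "(\<Sum>i = 1..<p + 1. ?t i) = df f (take (p + 2) x) * g (drop (p + 1) x)"
  proof -
    have "?t i = (if smooth (take (p + 2) x) i then f (del i (take (p + 2) x)) else 0) * g (drop (p + 1) x)"
      if i: "i \<in> {1..<p + 1}" for i
    proof -
      have "i - 1 < p + 2" "i < p + 2" "i + 1 < p + 2" using i by auto
      then have "smooth (take (p + 2) x) i = smooth x i" unfolding smooth_def by (simp only: nth_take)
      moreover have "take (p + 1) (del i x) = del i (take (p + 2) x)"
        using i len by (simp add: take_append take_drop min_def)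
      moreover have "drop p (del i x) = drop (p + 1) x"
        using i len by (simp add: drop_append min_def)
      ultimately show ?thesis unfolding cup_cochain_def by simp
    qed
    then have "(\<Sum>i = 1..<p + 1. ?t i) =
      (\<Sum>i = 1..<p + 1. (if smooth (take (p + 2) x) i then f (del i (take (p + 2) x)) else 0) * g (drop (p + 1) x))"
      by (intro sum.cong) auto
    also have "\<dots> = df f (take (p + 2) x) * g (drop (p + 1) x)"
      unfolding sum_distrib_right[symmetric] df_del[OF d(1)] using len by (simp add: min_def)
    finally show ?thesis .
  qed
  also have "(\<Sum>i = p + 1..<p + q + 1. ?t i) = f (take (p + 1) x) * df g (drop p x)"
  proof -
    have "(\<Sum>i = p + 1..<p + q + 1. ?t i) = (\<Sum>i = 1..<q + 1. ?t (i + p))"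
      using sum.shift_bounds_nat_ivl[of ?t 1 p "q + 1"] by (simp add: ac_simps)
    also have "\<dots> = (\<Sum>i = 1..<q + 1. f (take (p + 1) x) * (if smooth (drop p x) i then g (del i (drop p x)) else 0))"
    proof (rule sum.cong[OF refl])
      fix i assume i: "i \<in> {1..<q + 1}"
      have "smooth (drop p x) i = smooth x (i + p)"
        using i len by (simp add: smooth_def add.commute)
      moreover have "take (p + 1) (del (i + p) x) = take (p + 1) x"
        using i len by (simp add: take_append min_def)
      moreover have "drop p (del (i + p) x) = del i (drop p x)"
      proof -
        have "drop p (take (i + p) x) = take i (drop p x)" by (simp add: drop_take)
        moreover have "drop (i + p + 1) x = drop (i + 1) (drop p x)" by (simp add: ac_simps)
        moreover have "p - length (take (i + p) x) = 0" using i len by simp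
        ultimately show ?thesis by (simp only: drop_append drop_0)
      qed
      ultimately show "?t (i + p) = f (take (p + 1) x) * (if smooth (drop p x) i then g (del i (drop p x)) else 0)"
        unfolding cup_cochain_def by simp
    qed
    also have "\<dots> = f (take (p + 1) x) * df g (drop p x)"
      unfolding sum_distrib_left[symmetric] df_del[OF d(2)] using len by simp
    finally show ?thesis .
  qed
  finally show ?thesis .
qed

context hyperplanes
begin

subsection \<open>The path metric\<close>

text \<open>
  Moving from a point \<open>a\<close> of \<open>A\<close> in the direction of a point
  \<open>z\<close> of \<open>Z\<close>, one crosses the hyperplane of \<open>e\<close> at the time
  \<open>r e\<close>. As the hyperplanes of \<open>e1\<close> and \<open>e2\<close> are different,
  \<open>a\<close> can be chosen such that \<open>r e1 \<noteq> r e2\<close>, which is the condition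
  \<open>c a \<noteq> 0\<close>. At a time between these two one is in a tope \<open>Y\<close>
  strictly between \<open>A\<close> and \<open>Z\<close>.
\<close>

lemma tope_between:
  assumes A: "A \<in> T" and Z: "Z \<in> T" and e: "e1 \<in> Sep A Z" "e2 \<in> Sep A Z" "e1 \<noteq> e2"
  obtains Y where "Y \<in> T" "Y \<noteq> A" "Sep A Y \<subset> Sep A Z"
proof -
  have SE: "Sep A Z \<subseteq> E" by (rule Sep_sub_E[OF A Z])
  obtain z where z: "face_point Z {} z" using facial_empty[OF Z] by (auto simp: facial_def)
  obtain a0 where a0: "face_point A {} a0" using facial_empty[OF A] by (auto simp: facial_def)
  have ZA: "Z e = - A e" if "e \<in> Sep A Z" for e
  proof -
    have "e \<in> E" "A e \<noteq> Z e" using that SE by (auto simp: Sep_def)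
    then show ?thesis using tope_values[OF A, of e] tope_values[OF Z, of e] by auto
  qed
  have zneg: "A e * \<phi> e z < 0" if "e \<in> Sep A Z" for e
  proof -
    have "e \<in> E" using that SE by blast
    then have "Z e * \<phi> e z > 0" using z by (simp add: face_point_def)
    then show ?thesis unfolding ZA[OF that] by simp
  qed
  have zne: "\<phi> e z \<noteq> 0" if "e \<in> Sep A Z" for e using zneg[OF that] by auto
  have eE: "e1 \<in> E" "e2 \<in> E" using e SE by auto
  define c where "c h = \<phi> e1 h * \<phi> e2 z - \<phi> e2 h * \<phi> e1 z" for h
  have "\<exists>a. face_point A {} a \<and> c a \<noteq> 0"
  proof (cases "c a0 = 0")
    case True
    have "\<exists>h. c h \<noteq> 0"
    proof (rule ccontr)
      assume "\<nexists>h. c h \<noteq> 0"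
      then have "\<phi> e1 h * \<phi> e2 z = \<phi> e2 h * \<phi> e1 z" for h by (simp add: c_def)
      then have "\<phi> e1 h = 0 \<longleftrightarrow> \<phi> e2 h = 0" for h
        using zne e(1,2) by (metis mult_eq_0_iff)
      then have "{x. \<phi> e1 x = 0} = {x. \<phi> e2 x = 0}" by auto
      then show False using arr e(3) eE by (auto simp: arrangement_def inj_on_def)
    qed
    then obtain h where h: "c h \<noteq> 0" by auto
    obtain M where M: "M > 0" "\<forall>e\<in>E. M * (A e * \<phi> e a0) + A e * \<phi> e h > 0"
      using dominate[OF finite_E, of "\<lambda>e. A e * \<phi> e a0" "\<lambda>e. A e * \<phi> e h"] a0
      by (auto simp: face_point_def)
    have "face_point A {} (M *\<^sub>R a0 + h)"
      using M by (auto simp: face_point_def phi_simps algebra_simps)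
    moreover have "c (M *\<^sub>R a0 + h) = M * c a0 + c h"
      using eE by (simp add: c_def phi_simps algebra_simps)
    ultimately show ?thesis using True h by (metis add_0 mult_zero_right)
  qed (use a0 in blast)
  then obtain a where a: "face_point A {} a" "c a \<noteq> 0" by blast
  define r where "r e = (A e * \<phi> e a) / (- (A e * \<phi> e z))" for e
  have apos: "A e * \<phi> e a > 0" if "e \<in> E" for e using a that by (auto simp: face_point_def)
  have rpos: "r e > 0" if "e \<in> Sep A Z" for e
    unfolding r_def using apos[of e] zneg[OF that] that SE by (intro divide_pos_pos) auto
  have r_alt: "r e = - (\<phi> e a / \<phi> e z)" if "e \<in> Sep A Z" for e
    using tope_values[OF A, of e] that SE by (auto simp: r_def)
  have "r e1 \<noteq> r e2"
    using a(2) zne e(1,2) by (auto simp: r_alt c_def field_simps)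
  then obtain f1 f2 where f: "f1 \<in> Sep A Z" "f2 \<in> Sep A Z" "r f1 < r f2"
    using e by (metis linorder_neqE_linordered_idom)
  have "infinite {r f1<..<r f2}" using f(3) by simp
  moreover have "finite (r ` Sep A Z)" using finite_sub[OF SE] by simp
  ultimately obtain s where s: "r f1 < s" "s < r f2" "s \<notin> r ` Sep A Z"
    by (metis DiffE Diff_infinite_finite ex_in_conv finite.emptyI greaterThanLessThan_iff)
  have spos: "s > 0" using s(1) rpos[OF f(1)] by simp
  define y where "y = a + s *\<^sub>R z"
  have yS: "A e * \<phi> e y > 0 \<longleftrightarrow> s < r e" "A e * \<phi> e y < 0 \<longleftrightarrow> r e < s" if "e \<in> Sep A Z" for e
  proof -
    have p: "- (A e * \<phi> e z) > 0" using zneg[OF that] by simp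
    have v: "A e * \<phi> e y = A e * \<phi> e a - s * (- (A e * \<phi> e z))"
      using that SE by (auto simp: y_def phi_simps algebra_simps)
    show "A e * \<phi> e y > 0 \<longleftrightarrow> s < r e" unfolding r_def pos_less_divide_eq[OF p] v by linarith
    show "A e * \<phi> e y < 0 \<longleftrightarrow> r e < s" unfolding r_def pos_divide_less_eq[OF p] v by linarith
  qed
  have yO: "A e * \<phi> e y > 0" if "e \<in> E - Sep A Z" for e
  proof -
    have "Z e = A e" using that by (auto simp: Sep_def)
    then have "A e * \<phi> e z > 0" using z that by (auto simp: face_point_def)
    moreover have "A e * \<phi> e y = A e * \<phi> e a + s * (A e * \<phi> e z)"
      using that by (auto simp: y_def phi_simps algebra_simps)
    ultimately show ?thesis using apos[of e] spos that by (auto intro: add_pos_pos)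
  qed
  define Y where "Y = (\<lambda>e. if e \<in> E then sgn (\<phi> e y) else 0)"
  have ynz: "\<phi> e y \<noteq> 0" if "e \<in> E" for e
  proof (cases "e \<in> Sep A Z")
    case True
    then have "s \<noteq> r e" using s(3) by auto
    then show ?thesis using yS[OF True] by (metis linorder_neqE_linordered_idom mult_zero_right less_irrefl)
  next
    case False then show ?thesis using yO[of e] that by auto
  qed
  have "Y \<in> T" using ynz by (auto simp: topes_def covectors_def Y_def sgn_if)
  have YA: "Y e = A e \<longleftrightarrow> A e * \<phi> e y > 0" if "e \<in> E" for e
    using signs_pos[OF topes_signs[OF A] that, of "\<phi> e y"] that by (auto simp: Y_def)
  have sub: "Sep A Y \<subseteq> Sep A Z"
  proof
    fix e assume e': "e \<in> Sep A Y"
    then have "e \<in> E" using Sep_sub_E[OF A \<open>Y \<in> T\<close>] by auto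
    then show "e \<in> Sep A Z" using e' YA[of e] yO[of e] by (auto simp: Sep_def)
  qed
  have "f2 \<notin> Sep A Y" using YA[of f2] yS[OF f(2)] s f SE by (auto simp: Sep_def)
  then have "Sep A Y \<subset> Sep A Z" using sub f by auto
  moreover have "f1 \<in> Sep A Y" using YA[of f1] yS[OF f(1)] s f SE by (auto simp: Sep_def)
  then have "Y \<noteq> A" by (auto simp: Sep_def)
  ultimately show ?thesis using that \<open>Y \<in> T\<close> by blast
qed

lemma tope_neighbour:
  assumes A: "A \<in> T" and X: "X \<in> T" "X \<noteq> A"
  obtains Y where "Y \<in> T" "card (Sep A Y) = 1" "Sep A Y \<subseteq> Sep A X"
proof -
  have "\<exists>Y\<in>T. card (Sep A Y) = 1 \<and> Sep A Y \<subseteq> Sep A X"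
    using X
  proof (induction "card (Sep A X)" arbitrary: X rule: less_induct)
    case less
    have fin: "finite (Sep A X)" using Sep_sub_E[OF A less.prems(1)] by (rule finite_sub)
    show ?case
    proof (cases "card (Sep A X) = 1")
      case False
      have "Sep A X \<noteq> {}" using less.prems(2) Sep_empty_iff[of A X] by blast
      then obtain e1 where "e1 \<in> Sep A X" by blast
      moreover have "Sep A X \<noteq> {e1}" using False by auto
      ultimately obtain e2 where "e1 \<in> Sep A X" "e2 \<in> Sep A X" "e1 \<noteq> e2" by blast
      then obtain Y where Y: "Y \<in> T" "Y \<noteq> A" "Sep A Y \<subset> Sep A X"
        using tope_between[OF A less.prems(1)] by metis
      then have "card (Sep A Y) < card (Sep A X)" using fin by (intro psubset_card_mono)
      then show ?thesis using less.hyps[OF _ Y(1,2)] Y(3) by blast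
    qed (use less.prems in blast)
  qed
  then show ?thesis using that by blast
qed

text \<open>
  By \<open>tope_neighbour\<close> one can always approach \<open>X\<close> by crossing a single
  hyperplane of \<open>Sep A X\<close>.
\<close>

lemma tope_dist_eq:
  assumes A: "A \<in> T" and X: "X \<in> T"
  shows "tope_dist T A X = card (Sep A X)"
  unfolding tope_dist_def
proof (rule Least_equality)
  show "(A, X) \<in> tope_adj T ^^ card (Sep A X)"
    using A
  proof (induction "card (Sep A X)" arbitrary: A rule: less_induct)
    case less
    have fin: "finite (Sep A X)" using Sep_sub_E[OF less.prems X] by (rule finite_sub)
    show ?case
    proof (cases "X = A")
      case False
      obtain Y where Y: "Y \<in> T" "card (Sep A Y) = 1" "Sep A Y \<subseteq> Sep A X"
        using tope_neighbour[OF less.prems X False] by blast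
      have "Sep Y X = Sep A X - Sep A Y"
      proof (intro set_eqI iffI)
        fix e assume e: "e \<in> Sep Y X"
        then have "e \<in> E" using Sep_sub_E[OF Y(1) X] by auto
        moreover have "e \<in> Sep A Y \<longrightarrow> e \<in> Sep A X" using Y(3) by blast
        ultimately show "e \<in> Sep A X - Sep A Y"
          using e tope_values[OF less.prems, of e] tope_values[OF Y(1), of e] tope_values[OF X, of e]
          by (auto simp: Sep_def)
      qed (auto simp: Sep_def)
      then have c: "card (Sep A X) = Suc (card (Sep Y X))"
        using Y(2,3) fin card_Diff_subset[of "Sep A Y" "Sep A X"] card_mono[OF fin Y(3)]
          finite_subset[OF Y(3) fin] by simp
      then have "(Y, X) \<in> tope_adj T ^^ card (Sep Y X)" using less.hyps[OF _ Y(1)] by simp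
      moreover have "(A, Y) \<in> tope_adj T" using less.prems Y by (auto simp: tope_adj_def)
      ultimately show ?thesis unfolding c by (metis relpow_Suc_I2)
    qed simp
  qed
next
  fix n assume "(A, X) \<in> tope_adj T ^^ n"
  then show "card (Sep A X) \<le> n"
    using X
  proof (induction n arbitrary: X)
    case (Suc n)
    then obtain Y where Y: "(A, Y) \<in> tope_adj T ^^ n" "(Y, X) \<in> tope_adj T" by auto
    then have YX: "Y \<in> T" "X \<in> T" "card (Sep Y X) = 1" by (auto simp: tope_adj_def)
    have "Sep A X \<subseteq> Sep A Y \<union> Sep Y X" by (auto simp: Sep_def)
    then have "card (Sep A X) \<le> card (Sep A Y \<union> Sep Y X)"
      using finite_sub[OF Sep_sub_E[OF A YX(1)]] finite_sub[OF Sep_sub_E[OF YX(1,2)]] by (intro card_mono) auto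
    also have "\<dots> \<le> card (Sep A Y) + card (Sep Y X)" by (rule card_Un_le)
    also have "\<dots> \<le> Suc n" using Suc.IH[OF Y(1) YX(1)] YX(3) by simp
    finally show ?case .
  qed simp
qed

lemma smooth_at_iff:
  assumes "set x \<subseteq> T" "1 \<le> i" "i + 1 < length x"
  shows "smooth_at T x i \<longleftrightarrow> smooth x i"
proof -
  define a b c where "a = x ! (i - 1)" "b = x ! i" "c = x ! (i + 1)"
  have T: "a \<in> T" "b \<in> T" "c \<in> T" using assms by (auto simp: a_b_c_def)
  have fin: "finite (Sep a b)" "finite (Sep b c)" using T Sep_sub_E finite_sub by blast+
  have "card (Sep a c) = card (Sep a b) + card (Sep b c) \<longleftrightarrow> Sep a b \<inter> Sep b c = {}"
  proof
    assume eq: "card (Sep a c) = card (Sep a b) + card (Sep b c)"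
    have "Sep a c \<subseteq> Sep a b \<union> Sep b c" by (auto simp: Sep_def)
    then have "card (Sep a c) \<le> card (Sep a b \<union> Sep b c)" using fin by (intro card_mono) auto
    then have "card (Sep a b \<inter> Sep b c) = 0" using eq card_Un_Int[OF fin] by simp
    then show "Sep a b \<inter> Sep b c = {}" using fin by simp
  next
    assume "Sep a b \<inter> Sep b c = {}"
    then show "card (Sep a c) = card (Sep a b) + card (Sep b c)"
      using Sep_smooth[of a b c] fin by (simp add: card_Un_disjoint)
  qed
  moreover have e: "x ! (i - 1) = a" "x ! i = b" "x ! (i + 1) = c" by (simp_all add: a_b_c_def)
  ultimately show ?thesis
    unfolding smooth_at_def smooth_def e using T by (simp only: tope_dist_eq)
qed

subsection \<open>Cochains\<close>

lemma chains_iff: "x \<in> chains T k \<gamma> \<longleftrightarrow> length x = k + 1 \<and> x \<in> chains_from (hd x) \<gamma>"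
proof -
  have "(\<forall>i\<in>{1..k}. x ! (i - 1) \<noteq> x ! i) \<longleftrightarrow> distinct_adj x" if "length x = k + 1"
  proof -
    have "(\<forall>i\<in>{1..k}. x ! (i - 1) \<noteq> x ! i) \<longleftrightarrow> (\<forall>i<k. x ! i \<noteq> x ! Suc i)"
    proof (intro iffI ballI allI impI)
      fix i assume "\<forall>i\<in>{1..k}. x ! (i - 1) \<noteq> x ! i" "i < k"
      then show "x ! i \<noteq> x ! Suc i" by (auto dest: bspec[of _ _ "Suc i"])
    next
      fix i assume "\<forall>i<k. x ! i \<noteq> x ! Suc i" "i \<in> {1..k}"
      then show "x ! (i - 1) \<noteq> x ! i" by (cases i) auto
    qed
    then show ?thesis using that by (simp add: distinct_adj_conv_nth)
  qed
  then show ?thesis by (auto simp: chains_def chains_from_def crossing_crs)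
qed

lemma finite_chains: "finite (chains T k \<gamma>)"
proof -
  have "chains T k \<gamma> \<subseteq> {x. set x \<subseteq> T \<and> length x = k + 1}" by (auto simp: chains_def)
  then show ?thesis using finite_lists_length_eq[OF finite_T] finite_subset by blast
qed

definition proper :: "'e sign_vector list \<Rightarrow> bool"
  where "proper x \<longleftrightarrow> x \<noteq> [] \<and> set x \<subseteq> T \<and> distinct_adj x"

lemma proper_chains: "proper x \<Longrightarrow> x \<in> chains T k \<gamma> \<longleftrightarrow> length x = k + 1 \<and> crs x = \<gamma>"
  unfolding chains_iff by (auto simp: chains_from_def proper_def)

lemma chains_proper: "x \<in> chains T k \<gamma> \<Longrightarrow> proper x"
  by (auto simp: chains_iff chains_from_def proper_def)

lemma proper_faces: "proper x \<Longrightarrow> y \<in> faces x \<Longrightarrow> proper y"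
  using faces_basic[of y x] faces_proper[of y x] by (auto simp: proper_def)

lemma faces_chains:
  "proper x \<Longrightarrow> y \<in> faces x \<Longrightarrow> y \<in> chains T k \<gamma> \<longleftrightarrow> x \<in> chains T (k + 1) \<gamma>"
  using faces_basic[of y x] proper_faces by (auto simp: proper_chains)

text \<open>
  Modulo two the signs disappear, and every face arises by deleting exactly one vertex.
\<close>

lemma codiff_df:
  assumes f: "f \<in> cochains T k \<gamma>" and x: "proper x"
  shows "codiff T k \<gamma> f x = df f x"
proof (cases "x \<in> chains T (k + 1) \<gamma>")
  case False
  then have "df f x = 0"
    unfolding df_def using f faces_chains[OF x] by (intro sum.neutral) (auto simp: cochains_def)
  then show ?thesis using False by (simp add: codiff_def)
next
  case True
  have dx: "distinct_adj x" using x by (simp add: proper_def)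
  let ?R = "{1..<length x - 1}"
  have sm: "smooth_at T x i \<longleftrightarrow> smooth x i" if "i \<in> ?R" for i
    using that x by (intro smooth_at_iff) (auto simp: proper_def)
  have one: "(- 1 :: bit) ^ i = 1" for i by simp
  have "codiff T k \<gamma> f x = (\<Sum>y\<in>chains T k \<gamma>. \<Sum>i\<in>?R. (if smooth x i \<and> y = del i x then 1 else 0) * f y)"
    using True unfolding codiff_def boundary_def sum_distrib_right one
    by (auto intro!: sum.cong simp: sm)
  also have "\<dots> = (\<Sum>i\<in>?R. \<Sum>y\<in>chains T k \<gamma>. (if smooth x i \<and> y = del i x then 1 else 0) * f y)"
    by (rule sum.swap)
  also have "\<dots> = (\<Sum>i\<in>?R. if smooth x i then f (del i x) else 0)"
  proof (rule sum.cong[OF refl])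
    fix i assume i: "i \<in> ?R"
    show "(\<Sum>y\<in>chains T k \<gamma>. (if smooth x i \<and> y = del i x then 1 else 0) * f y) =
      (if smooth x i then f (del i x) else 0)"
    proof (cases "smooth x i")
      case sx: True
      then have "del i x \<in> faces x" using i faces_del[of x] by blast
      then have m: "del i x \<in> chains T k \<gamma>" using faces_chains[OF x] True by blast
      have "(\<Sum>y\<in>chains T k \<gamma>. (if smooth x i \<and> y = del i x then 1 else 0) * f y) =
        (\<Sum>y\<in>chains T k \<gamma>. if y = del i x then f y else 0)"
        using sx by (intro sum.cong) auto
      then show ?thesis using m sx finite_chains by simp
    qed simp
  qed
  also have "\<dots> = df f x" by (rule df_del[OF dx, symmetric])
  finally show ?thesis .
qed

lemma codiff_cochain: "codiff T k \<gamma> f \<in> cochains T (k + 1) \<gamma>"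
  by (simp add: cochains_def codiff_def)

lemma cocycles_iff: "f \<in> cocycles T k \<gamma> \<longleftrightarrow> f \<in> cochains T k \<gamma> \<and> (\<forall>x. proper x \<longrightarrow> df f x = 0)"
proof -
  have "codiff T k \<gamma> f = 0 \<longleftrightarrow> (\<forall>x. proper x \<longrightarrow> df f x = 0)" if f: "f \<in> cochains T k \<gamma>"
  proof
    assume "codiff T k \<gamma> f = 0"
    then show "\<forall>x. proper x \<longrightarrow> df f x = 0" using codiff_df[OF f] by (metis zero_fun_apply)
  next
    assume 0: "\<forall>x. proper x \<longrightarrow> df f x = 0"
    show "codiff T k \<gamma> f = 0"
    proof
      fix x
      show "codiff T k \<gamma> f x = 0 x"
      proof (cases "x \<in> chains T (k + 1) \<gamma>")
        case True
        then show ?thesis using 0 chains_proper codiff_df[OF f] by simp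
      qed (simp add: codiff_def)
    qed
  qed
  then show ?thesis by (auto simp: cocycles_def)
qed

lemma codiff_add: "f \<in> cochains T k \<gamma> \<Longrightarrow> g \<in> cochains T k \<gamma> \<Longrightarrow>
    codiff T k \<gamma> (\<lambda>x. f x + g x) x = codiff T k \<gamma> f x + codiff T k \<gamma> g x"
  by (simp add: codiff_def distrib_left sum.distrib)

lemma coboundaries_0: "(\<lambda>x. 0) \<in> coboundaries T k \<gamma>"
proof (cases k)
  case (Suc j)
  have "(\<lambda>x. 0) \<in> cochains T j \<gamma>" by (simp add: cochains_def)
  moreover have "codiff T j \<gamma> (\<lambda>x. 0) = (\<lambda>x. 0)" by (auto simp: codiff_def)
  ultimately have "(\<lambda>x. 0) \<in> codiff T j \<gamma> ` cochains T j \<gamma>" by (metis imageI)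
  then show ?thesis using Suc by (simp add: coboundaries_def)
qed (simp add: coboundaries_def zero_fun_def)

lemma coboundaries_add:
  assumes "f \<in> coboundaries T k \<gamma>" "g \<in> coboundaries T k \<gamma>"
  shows "(\<lambda>x. f x + g x) \<in> coboundaries T k \<gamma>"
proof (cases k)
  case (Suc j)
  then obtain a b where ab: "f = codiff T j \<gamma> a" "g = codiff T j \<gamma> b" "a \<in> cochains T j \<gamma>" "b \<in> cochains T j \<gamma>"
    using assms by (auto simp: coboundaries_def)
  have "(\<lambda>x. f x + g x) = codiff T j \<gamma> (\<lambda>x. a x + b x)" using codiff_add[OF ab(3,4)] ab(1,2) by (auto simp: fun_eq_iff)
  moreover have "(\<lambda>x. a x + b x) \<in> cochains T j \<gamma>" using ab by (auto simp: cochains_def)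
  ultimately show ?thesis using Suc by (auto simp: coboundaries_def)
qed (use assms in \<open>auto simp: coboundaries_def zero_fun_def\<close>)

lemma coh_class_mem: "g \<in> coh_class T k \<gamma> f \<longleftrightarrow>
    f \<in> cocycles T k \<gamma> \<and> g \<in> cocycles T k \<gamma> \<and> (\<lambda>x. f x + g x) \<in> coboundaries T k \<gamma>"
proof -
  have "f - g = (\<lambda>x. f x + g x)" by (auto simp: fun_eq_iff bit_diff)
  then show ?thesis by (simp add: coh_class_def cohomologous_def Image_def)
qed

lemma coh_class_refl: "f \<in> cocycles T k \<gamma> \<Longrightarrow> f \<in> coh_class T k \<gamma> f"
  using coboundaries_0 by (simp add: coh_class_mem)

lemma coh_class_eq_iff:
  assumes f: "f \<in> cocycles T k \<gamma>" and g: "g \<in> cocycles T k \<gamma>"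
  shows "coh_class T k \<gamma> f = coh_class T k \<gamma> g \<longleftrightarrow> (\<lambda>x. f x + g x) \<in> coboundaries T k \<gamma>"
proof
  assume "coh_class T k \<gamma> f = coh_class T k \<gamma> g"
  then have "g \<in> coh_class T k \<gamma> f" using coh_class_refl[OF g] by simp
  then show "(\<lambda>x. f x + g x) \<in> coboundaries T k \<gamma>" by (simp add: coh_class_mem)
next
  assume fg: "(\<lambda>x. f x + g x) \<in> coboundaries T k \<gamma>"
  have "(\<lambda>x. g x + h x) \<in> coboundaries T k \<gamma>" if "(\<lambda>x. f x + h x) \<in> coboundaries T k \<gamma>"
    and fg: "(\<lambda>x. f x + g x) \<in> coboundaries T k \<gamma>" for f g h
  proof -
    have "(\<lambda>x. (f x + g x) + (f x + h x)) \<in> coboundaries T k \<gamma>" by (rule coboundaries_add[OF fg that(1)])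
    then show ?thesis by (simp add: ac_simps)
  qed
  from this[of f _ g] this[of g _ f] show "coh_class T k \<gamma> f = coh_class T k \<gamma> g"
    using fg f g by (auto simp: coh_class_mem add.commute)
qed

subsection \<open>Fixed starting tope\<close>

lemma cobd_df: "x \<in> chains_from A \<gamma> \<Longrightarrow> cobd faces (chains_from A \<gamma>) g x = df g x"
  using chains_from_faces[of x A \<gamma>] by (auto simp: cobd_def df_def intro!: arg_cong[where f = "sum g"])

lemma chains_from_proper: "x \<in> chains_from A \<gamma> \<longleftrightarrow> proper x \<and> hd x = A \<and> crs x = \<gamma>"
  by (auto simp: chains_from_def proper_def)

lemma cocycles_imp_cocycle: "g \<in> cocycles T k \<gamma> \<Longrightarrow> cocycle faces (chains_from A \<gamma>) g"
  by (auto simp: cocycles_iff cocycle_def cobd_df chains_from_proper)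

lemma coboundaries_imp_coboundary:
  assumes "g \<in> coboundaries T k \<gamma>"
  shows "coboundary faces (chains_from A \<gamma>) g"
proof (cases k)
  case 0
  then have "g = (\<lambda>x. 0)" using assms by (simp add: coboundaries_def zero_fun_def)
  then show ?thesis unfolding coboundary_def by (intro exI[of _ "\<lambda>x. 0"]) (simp add: cobd_def)
next
  case (Suc j)
  then obtain h where h: "g = codiff T j \<gamma> h" "h \<in> cochains T j \<gamma>" using assms by (auto simp: coboundaries_def)
  have "g x = cobd faces (chains_from A \<gamma>) h x" if "x \<in> chains_from A \<gamma>" for x
    using codiff_df[OF h(2), of x] that by (simp add: h(1) cobd_df chains_from_proper)
  then show ?thesis unfolding coboundary_def by blast
qed

text \<open>
  Faces keep the start and are shorter by one. So a cochain that bounds \<open>g\<close> can be cut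
  down to the chains of length \<open>k\<close> that start at \<open>A\<close>.
\<close>

lemma coboundary_imp_coboundaries:
  assumes g: "g \<in> cochains T k \<gamma>" and A: "\<And>x. g x \<noteq> 0 \<Longrightarrow> hd x = A"
    and cob: "coboundary faces (chains_from A \<gamma>) g"
  shows "g \<in> coboundaries T k \<gamma>"
proof -
  obtain h where h: "\<And>x. x \<in> chains_from A \<gamma> \<Longrightarrow> g x = df h x"
    using cob by (auto simp: coboundary_def cobd_df)
  have supp: "x \<in> chains T k \<gamma> \<and> x \<in> chains_from A \<gamma>" if "g x \<noteq> 0" for x
  proof -
    have "x \<in> chains T k \<gamma>" using g that by (auto simp: cochains_def)
    then show ?thesis using A[OF that] by (simp add: chains_iff)
  qed
  show ?thesis
  proof (cases k)
    case 0
    have "g x = 0" for x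
    proof (rule ccontr)
      assume nz: "g x \<noteq> 0"
      then have "length x = 1" using supp 0 by (auto simp: chains_iff)
      then have "faces x = {}" by (cases x rule: faces.cases) auto
      then show False using h[of x] supp[OF nz] nz by (simp add: df_def)
    qed
    then have "g = (\<lambda>x. 0)" by auto
    then show ?thesis using coboundaries_0 by simp
  next
    case (Suc j)
    define h' where "h' x = (if x \<in> chains_from A \<gamma> \<and> length x = k then h x else 0)" for x
    have h': "h' \<in> cochains T j \<gamma>" by (auto simp: cochains_def h'_def chains_iff Suc chains_from_proper)
    have "g x = codiff T j \<gamma> h' x" for x
    proof (cases "x \<in> chains T k \<gamma>")
      case False
      then show ?thesis using g Suc by (simp add: cochains_def codiff_def)
    next
      case True
      then have x: "proper x" "length x = k + 1" "crs x = \<gamma>" using chains_proper proper_chains by blast+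
      have "g x = df h' x"
      proof (cases "hd x = A")
        case True
        then have xA: "x \<in> chains_from A \<gamma>" using x by (simp add: chains_from_proper)
        have "df h' x = df h x"
          unfolding df_def using chains_from_faces[OF xA] faces_basic(1)[of _ x] x(2)
          by (intro sum.cong) (auto simp: h'_def)
        then show ?thesis using h[OF xA] by simp
      next
        case False
        then have "df h' x = 0"
          unfolding df_def using faces_basic(2)[of _ x] by (intro sum.neutral) (auto simp: h'_def chains_from_proper)
        moreover have "g x = 0" using A False by blast
        ultimately show ?thesis by simp
      qed
      then show ?thesis using codiff_df[OF h' x(1)] by simp
    qed
    then have "g = codiff T j \<gamma> h'" by auto
    then show ?thesis using h' Suc by (auto simp: coboundaries_def)
  qed
qed

lemma generator_cocycles:
  assumes "generates faces length (chains_from A \<gamma>) (Suc k) f"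
  shows "f \<in> cocycles T k \<gamma>"
proof -
  have "df f x = 0" if x: "proper x" for x
  proof (cases "x \<in> chains_from A \<gamma>")
    case True
    then show ?thesis using assms by (simp add: generates_def cocycle_def cobd_df)
  next
    case False
    have "f y = 0" if "y \<in> faces x" for y
    proof (rule ccontr)
      assume "f y \<noteq> 0"
      then have "y \<in> chains_from A \<gamma>" using generates_supp[OF assms] by blast
      then show False using False x faces_basic[OF that] by (simp add: chains_from_proper)
    qed
    then show ?thesis by (simp add: df_def)
  qed
  moreover have "f \<in> cochains T k \<gamma>"
    using generates_supp[OF assms] by (force simp: cochains_def chains_iff chains_from_proper)
  ultimately show ?thesis by (simp add: cocycles_iff)
qed

subsection \<open>Canonical classes\<close>

text \<open>
  Admissibility can be tested at either end of the chains: the two topes differ only inside the first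
  level, and splitting off this level leads to a smaller exponent.
\<close>

lemma adm_flip:
  assumes "\<gamma> \<in> exponents E" "A \<in> T" "adm \<gamma> A"
  shows "flip \<gamma> A \<in> T \<and> adm \<gamma> (flip \<gamma> A)"
  using assms
proof (induction arbitrary: A rule: exponents_induct)
  case zero
  then show ?case unfolding flip_0 by blast
next
  case (step Q \<delta>)
  let ?A = "reorient Q A" and ?C = "flip (ind Q + \<delta>) A"
  have f: "facial A Q" "adm \<delta> ?A" using step(7) unfolding adm_shift[OF step(3,1)] by auto
  have A': "?A \<in> T" using facial_opposite(1)[OF step(6) f(1) facial_empty[OF step(6)]] by simp
  have C: "?C = flip \<delta> ?A" by (simp only: flip_add flip_ind)
  have IH: "?C \<in> T" "adm \<delta> ?C" unfolding C using step(5)[OF A' f(2)] by auto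
  have "?C e = A e" if "e \<notin> Q" for e
  proof -
    have "\<delta> e = 0" using that step(3) by (auto simp: supp_def)
    then show ?thesis unfolding C using that by (simp add: flip_def reorient_def)
  qed
  then have fC: "facial ?C Q" using f(1) by (intro facial_cong[OF f(1)]) auto
  then have "adm \<delta> (reorient Q ?C)" using adm_reorient[OF fC step(3)] IH by simp
  then show ?case using IH(1) fC adm_shift[OF step(3,1)] by blast
qed

text \<open>
  The chains that start at \<open>flip \<gamma> C\<close> and have crossing vector
  \<open>\<gamma>\<close> end at \<open>C\<close>, so the part of the cohomology with these endpoints
  is that of \<open>chains_from\<close>.
\<close>

lemma canonical_class_generator:
  assumes C: "C \<in> T" and \<gamma>: "\<gamma> \<in> exponents E"
    and f: "generates faces length (chains_from (flip \<gamma> C) \<gamma>) (Suc (kap \<gamma>)) f"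
  shows "canonical_class E \<phi> \<gamma> C = coh_class T (kap \<gamma>) \<gamma> f"
  unfolding canonical_class_def
proof (rule the_equality)
  let ?k = "kap \<gamma>" and ?A = "flip \<gamma> C"
  let ?I = "chains_from ?A \<gamma>"
  have fz: "f \<in> cocycles T ?k \<gamma>" using generator_cocycles[OF f] .
  have z: "0 \<in> cocycles T ?k \<gamma>" by (auto simp: cocycles_iff cochains_def df_def)
  have ends: "hd x = ?A \<and> last x = C" if "x \<in> ?I" for x
    using chains_from_last[OF that] that by (simp add: chains_from_proper)
  have "coh_class T ?k \<gamma> f \<in> MH_between T ?k \<gamma> ?A C"
    unfolding MH_between_def using fz ends generates_supp[OF f] by blast
  moreover have "coh_class T ?k \<gamma> f \<noteq> MH_zero T ?k \<gamma>"
  proof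
    assume "coh_class T ?k \<gamma> f = MH_zero T ?k \<gamma>"
    then have "(\<lambda>x. f x + 0 x) \<in> coboundaries T ?k \<gamma>" using coh_class_eq_iff[OF fz z] by simp
    then have "coboundary faces ?I f" using coboundaries_imp_coboundary[of f ?k \<gamma> ?A] by simp
    then show False using f by (simp add: generates_def)
  qed
  ultimately show "coh_class T ?k \<gamma> f \<in> MH_between T ?k \<gamma> ?A C \<and> coh_class T ?k \<gamma> f \<noteq> MH_zero T ?k \<gamma>" ..
  fix u assume u: "u \<in> MH_between T ?k \<gamma> ?A C \<and> u \<noteq> MH_zero T ?k \<gamma>"
  then obtain g where g: "g \<in> cocycles T ?k \<gamma>" "\<forall>x. g x \<noteq> 0 \<longrightarrow> hd x = ?A \<and> last x = C"
    "u = coh_class T ?k \<gamma> g" unfolding MH_between_def by blast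
  obtain c where c: "coboundary faces ?I (\<lambda>x. g x + c * f x)"
    using f cocycles_imp_cocycle[OF g(1)] unfolding generates_def by blast
  have "(\<lambda>x. g x + c * f x) \<in> coboundaries T ?k \<gamma>"
  proof (rule coboundary_imp_coboundaries[OF _ _ c])
    show "(\<lambda>x. g x + c * f x) \<in> cochains T ?k \<gamma>" using g(1) fz by (auto simp: cocycles_iff cochains_def)
    show "hd x = ?A" if "g x + c * f x \<noteq> 0" for x
      using that g(2) ends generates_supp[OF f, of x] by (cases "g x = 0") auto
  qed
  moreover have "c \<noteq> 0"
  proof
    assume "c = 0"
    then have "(\<lambda>x. g x + 0 x) \<in> coboundaries T ?k \<gamma>" using calculation by simp
    then show False using u g(3) coh_class_eq_iff[OF g(1) z] by simp
  qed
  ultimately have "(\<lambda>x. g x + f x) \<in> coboundaries T ?k \<gamma>" by simp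
  then show "u = coh_class T ?k \<gamma> f" unfolding g(3) using coh_class_eq_iff[OF g(1) fz] by simp
qed

subsection \<open>The cup product on classes\<close>

lemma cup_supp:
  assumes f: "f \<in> cochains T p \<alpha>" and g: "g \<in> cochains T q \<beta>" and nz: "cup_cochain p f g x \<noteq> 0"
  shows "x \<in> chains T (p + q) (\<alpha> + \<beta>)" "hd x = hd (take (p + 1) x)"
    "last (take (p + 1) x) = hd (drop p x)" "f (take (p + 1) x) \<noteq> 0" "g (drop p x) \<noteq> 0"
proof -
  show nz': "f (take (p + 1) x) \<noteq> 0" "g (drop p x) \<noteq> 0" using nz by (auto simp: cup_cochain_def)
  have t: "take (p + 1) x \<in> chains T p \<alpha>" and d: "drop p x \<in> chains T q \<beta>"
    using nz' f g by (auto simp: cochains_def)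
  then have len: "length x = p + q + 1" by (auto simp: chains_iff)
  let ?b = "x ! p"
  have x: "x = take p x @ ?b # drop (p + 1) x" using len by (simp add: id_take_nth_drop)
  have tp: "take (p + 1) x = take p x @ [?b]" using len by (simp add: take_Suc_conv_app_nth)
  have dp: "drop p x = ?b # drop (p + 1) x" using len by (simp add: Cons_nth_drop_Suc)
  show "hd x = hd (take (p + 1) x)" using len by (cases x) auto
  show "last (take (p + 1) x) = hd (drop p x)" unfolding tp dp by simp
  have "take p x @ [?b] \<in> chains_from (hd x) \<alpha>"
    unfolding tp[symmetric] \<open>hd x = hd (take (p + 1) x)\<close> using t unfolding chains_iff by blast
  moreover have "?b # drop (p + 1) x \<in> chains_from ?b \<beta>" using d unfolding chains_iff dp by simp
  ultimately have "x \<in> chains_from (hd x) (\<alpha> + \<beta>)"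
    using chains_from_split[of "take p x" ?b "drop (p + 1) x" "hd x" \<alpha> \<beta>] x by metis
  then show "x \<in> chains T (p + q) (\<alpha> + \<beta>)" using len by (simp add: chains_iff)
qed

lemma cup_cochains:
  "f \<in> cochains T p \<alpha> \<Longrightarrow> g \<in> cochains T q \<beta> \<Longrightarrow> cup_cochain p f g \<in> cochains T (p + q) (\<alpha> + \<beta>)"
  using cup_supp(1) unfolding cochains_def by blast

lemma proper_take_drop:
  assumes "proper x"
  shows "0 < n \<Longrightarrow> proper (take n x)" "n < length x \<Longrightarrow> proper (drop n x)"
proof -
  have "distinct_adj (take n x)" "distinct_adj (drop n x)"
    using assms distinct_adj_appendD1 distinct_adj_appendD2 unfolding proper_def by (metis append_take_drop_id)+
  then show "0 < n \<Longrightarrow> proper (take n x)" "n < length x \<Longrightarrow> proper (drop n x)"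
    using assms set_take_subset[of n x] set_drop_subset[of n x] by (auto simp: proper_def)
qed

lemma codiff_cup:
  assumes f: "f \<in> cochains T p \<alpha>" and g: "g \<in> cochains T q \<beta>"
    and x: "proper x" "length x = p + q + 2"
  shows "codiff T (p + q) (\<alpha> + \<beta>) (cup_cochain p f g) x =
    cup_cochain (p + 1) (codiff T p \<alpha> f) g x + cup_cochain p f (codiff T q \<beta> g) x"
proof -
  have "codiff T (p + q) (\<alpha> + \<beta>) (cup_cochain p f g) x = df (cup_cochain p f g) x"
    by (rule codiff_df[OF cup_cochains[OF f g] x(1)])
  also have "\<dots> = df f (take (p + 2) x) * g (drop (p + 1) x) + f (take (p + 1) x) * df g (drop p x)"
    using x by (intro df_cup) (auto simp: proper_def)
  also have "df f (take (p + 2) x) = codiff T p \<alpha> f (take (p + 2) x)"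
    using proper_take_drop(1)[OF x(1)] by (intro codiff_df[OF f, symmetric]) simp
  also have "df g (drop p x) = codiff T q \<beta> g (drop p x)"
    using proper_take_drop(2)[OF x(1)] x(2) by (intro codiff_df[OF g, symmetric]) simp
  also have "codiff T p \<alpha> f (take (p + 2) x) * g (drop (p + 1) x) =
      cup_cochain (p + 1) (codiff T p \<alpha> f) g x" by (simp add: cup_cochain_def)
  also have "f (take (p + 1) x) * codiff T q \<beta> g (drop p x) = cup_cochain p f (codiff T q \<beta> g) x"
    by (simp add: cup_cochain_def)
  finally show ?thesis .
qed

text \<open>
  The Leibniz rule, by which products of cocycles are cocycles and become coboundaries if one factor
  is a coboundary.
\<close>

lemma codiff_cup_eq:
  assumes "f \<in> cochains T p \<alpha>" "g \<in> cochains T q \<beta>"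
  shows "codiff T (p + q) (\<alpha> + \<beta>) (cup_cochain p f g) =
    (\<lambda>x. cup_cochain (p + 1) (codiff T p \<alpha> f) g x + cup_cochain p f (codiff T q \<beta> g) x)"
proof
  fix x
  show "codiff T (p + q) (\<alpha> + \<beta>) (cup_cochain p f g) x =
    cup_cochain (p + 1) (codiff T p \<alpha> f) g x + cup_cochain p f (codiff T q \<beta> g) x"
  proof (cases "x \<in> chains T (p + q + 1) (\<alpha> + \<beta>)")
    case True
    then show ?thesis using chains_proper by (intro codiff_cup[OF assms]) (auto simp: chains_iff)
  next
    case False
    have e: "p + 1 + q = p + q + 1" "p + (q + 1) = p + q + 1" by simp_all
    have "cup_cochain (p + 1) (codiff T p \<alpha> f) g x = 0"
      using cup_supp(1)[OF codiff_cochain assms(2), of p \<alpha> f x] False unfolding e by blast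
    moreover have "cup_cochain p f (codiff T q \<beta> g) x = 0"
      using cup_supp(1)[OF assms(1) codiff_cochain, of q \<beta> g x] False unfolding e by blast
    ultimately show ?thesis using False by (simp add: codiff_def)
  qed
qed

lemma cup_cocycles:
  assumes "f \<in> cocycles T p \<alpha>" "g \<in> cocycles T q \<beta>"
  shows "cup_cochain p f g \<in> cocycles T (p + q) (\<alpha> + \<beta>)"
proof -
  have fg: "f \<in> cochains T p \<alpha>" "g \<in> cochains T q \<beta>" "codiff T p \<alpha> f = 0" "codiff T q \<beta> g = 0"
    using assms by (auto simp: cocycles_def)
  have "codiff T (p + q) (\<alpha> + \<beta>) (cup_cochain p f g) = 0"
    unfolding codiff_cup_eq[OF fg(1,2)] fg(3,4) by (auto simp: cup_cochain_def)
  then show ?thesis using cup_cochains[OF fg(1,2)] by (simp add: cocycles_def)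
qed

lemma cup_coboundary_left:
  assumes "f \<in> coboundaries T p \<alpha>" "g \<in> cocycles T q \<beta>"
  shows "cup_cochain p f g \<in> coboundaries T (p + q) (\<alpha> + \<beta>)"
proof (cases p)
  case 0
  then have "f = (\<lambda>x. 0)" using assms(1) by (simp add: coboundaries_def zero_fun_def)
  then have "cup_cochain p f g = (\<lambda>x. 0)" by (auto simp: cup_cochain_def)
  then show ?thesis using coboundaries_0 by simp
next
  case (Suc j)
  then obtain h where h: "f = codiff T j \<alpha> h" "h \<in> cochains T j \<alpha>" using assms(1) by (auto simp: coboundaries_def)
  have g: "g \<in> cochains T q \<beta>" "codiff T q \<beta> g = 0" using assms(2) by (auto simp: cocycles_def)
  have "codiff T (j + q) (\<alpha> + \<beta>) (cup_cochain j h g) = cup_cochain p f g"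
    unfolding codiff_cup_eq[OF h(2) g(1)] g(2) h(1) Suc by (auto simp: cup_cochain_def)
  then have "cup_cochain p f g \<in> codiff T (j + q) (\<alpha> + \<beta>) ` cochains T (j + q) (\<alpha> + \<beta>)"
    using cup_cochains[OF h(2) g(1)] by (metis imageI)
  then show ?thesis using Suc by (simp add: coboundaries_def)
qed

lemma cup_coboundary_right:
  assumes "f \<in> cocycles T p \<alpha>" "g \<in> coboundaries T q \<beta>"
  shows "cup_cochain p f g \<in> coboundaries T (p + q) (\<alpha> + \<beta>)"
proof (cases q)
  case 0
  then have "g = (\<lambda>x. 0)" using assms(2) by (simp add: coboundaries_def zero_fun_def)
  then have "cup_cochain p f g = (\<lambda>x. 0)" by (auto simp: cup_cochain_def)
  then show ?thesis using coboundaries_0 by simp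
next
  case (Suc j)
  then obtain h where h: "g = codiff T j \<beta> h" "h \<in> cochains T j \<beta>" using assms(2) by (auto simp: coboundaries_def)
  have f: "f \<in> cochains T p \<alpha>" "codiff T p \<alpha> f = 0" using assms(1) by (auto simp: cocycles_def)
  have "codiff T (p + j) (\<alpha> + \<beta>) (cup_cochain p f h) = cup_cochain p f g"
    unfolding codiff_cup_eq[OF f(1) h(2)] f(2) h(1) by (auto simp: cup_cochain_def)
  then have "cup_cochain p f g \<in> codiff T (p + j) (\<alpha> + \<beta>) ` cochains T (p + j) (\<alpha> + \<beta>)"
    using cup_cochains[OF f(1) h(2)] by (metis imageI)
  then show ?thesis using Suc by (simp add: coboundaries_def)
qed

text \<open>By the Leibniz rule all representatives of the factors lead to the same class.\<close>

lemma cup_coh_class: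
  assumes f: "f \<in> cocycles T p \<alpha>" and g: "g \<in> cocycles T q \<beta>"
  shows "cup T p \<alpha> q \<beta> (coh_class T p \<alpha> f) (coh_class T q \<beta> g) =
    coh_class T (p + q) (\<alpha> + \<beta>) (cup_cochain p f g)"
proof -
  have "coh_class T (p + q) (\<alpha> + \<beta>) (cup_cochain p f' g') = coh_class T (p + q) (\<alpha> + \<beta>) (cup_cochain p f g)"
    if "f' \<in> coh_class T p \<alpha> f" "g' \<in> coh_class T q \<beta> g" for f' g'
  proof -
    have f': "f' \<in> cocycles T p \<alpha>" "(\<lambda>x. f x + f' x) \<in> coboundaries T p \<alpha>"
      and g': "g' \<in> cocycles T q \<beta>" "(\<lambda>x. g x + g' x) \<in> coboundaries T q \<beta>"
      using that by (auto simp: coh_class_mem)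
    have "(\<lambda>x. cup_cochain p (\<lambda>x. f x + f' x) g' x + cup_cochain p f (\<lambda>x. g x + g' x) x)
        \<in> coboundaries T (p + q) (\<alpha> + \<beta>)"
      by (rule coboundaries_add[OF cup_coboundary_left[OF f'(2) g'(1)] cup_coboundary_right[OF f g'(2)]])
    moreover have "(\<lambda>x. cup_cochain p (\<lambda>x. f x + f' x) g' x + cup_cochain p f (\<lambda>x. g x + g' x) x) =
        (\<lambda>x. cup_cochain p f' g' x + cup_cochain p f g x)"
      by (auto simp: cup_cochain_def distrib_left distrib_right ac_simps)
    ultimately show ?thesis
      using coh_class_eq_iff[OF cup_cocycles[OF f'(1) g'(1)] cup_cocycles[OF f g]] by simp
  qed
  then show ?thesis unfolding cup_def using coh_class_refl[OF f] coh_class_refl[OF g] by blast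
qed

text \<open>
  The generator vanishes on the chains of length \<open>Suc k\<close>, so that in this degree a
  cocycle is bounded without correction by a multiple of it.
\<close>

lemma coboundary_of_other_degree:
  assumes f: "generates faces length (chains_from A \<gamma>) n f" and k: "n \<noteq> Suc k"
    and g: "g \<in> cocycles T k \<gamma>" "\<And>x. g x \<noteq> 0 \<Longrightarrow> hd x = A"
  shows "g \<in> coboundaries T k \<gamma>"
proof (rule coboundary_imp_coboundaries[OF _ g(2)])
  show gc: "g \<in> cochains T k \<gamma>" using g(1) by (simp add: cocycles_def)
  obtain c h where h: "\<And>x. x \<in> chains_from A \<gamma> \<Longrightarrow> g x + c * f x = df h x"
    using generates_spans[OF f cocycles_imp_cocycle[OF g(1)]] by (metis cobd_df)
  define h' where "h' x = (if length x = k then h x else 0)" for x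
  have "g x = df h' x" if x: "x \<in> chains_from A \<gamma>" for x
  proof (cases "length x = Suc k")
    case True
    then have "df h' x = df h x"
      unfolding df_def using faces_basic(1)[of _ x] by (intro sum.cong) (auto simp: h'_def)
    moreover have "f x = 0" using generates_supp[OF f, of x] True k by blast
    ultimately show ?thesis using h[OF x] by simp
  next
    case False
    then have "df h' x = 0"
      unfolding df_def using faces_basic(1)[of _ x] by (intro sum.neutral) (auto simp: h'_def)
    moreover have "g x = 0" using gc False by (auto simp: cochains_def chains_iff)
    ultimately show ?thesis by simp
  qed
  then show "coboundary faces (chains_from A \<gamma>) g"
    unfolding coboundary_def by (auto simp: cobd_df)
qed

text \<open>
  The product \<open>u\<close> of two generators can only be nonzero on chains from \<open>flip
  \<alpha> B\<close> that visit, after crossing \<open>\<alpha>\<close>, both \<open>B\<close> and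
  \<open>flip \<beta> C\<close>. If these topes agree, \<open>u\<close> is a cocycle on the chains
  from \<open>flip \<alpha> B\<close> with crossing vector \<open>\<alpha> + \<beta>\<close>. Their
  cohomology is zero if the sum is not admissible, and lives in degree \<open>kap (\<alpha> +
  \<beta>)\<close> otherwise.
\<close>

theorem cup_canonical:
  assumes \<alpha>: "\<alpha> \<in> exponents E" and \<beta>: "\<beta> \<in> exponents E" and B: "B \<in> T" and C: "C \<in> T"
    and admB: "adm \<alpha> B" and admC: "adm \<beta> C"
  shows "cup T (kap \<alpha>) \<alpha> (kap \<beta>) \<beta> (canonical_class E \<phi> \<alpha> B) (canonical_class E \<phi> \<beta> C) =
    (if B = flip \<beta> C \<and> adm (\<alpha> + \<beta>) C \<and> kap (\<alpha> + \<beta>) = kap \<alpha> + kap \<beta>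
     then canonical_class E \<phi> (\<alpha> + \<beta>) C
     else MH_zero T (kap \<alpha> + kap \<beta>) (\<alpha> + \<beta>))"
proof -
  let ?A = "flip \<alpha> B" and ?B = "flip \<beta> C" and ?k = "kap \<alpha> + kap \<beta>"
  have A: "?A \<in> T" "adm \<alpha> ?A" using adm_flip[OF \<alpha> B admB] by auto
  have B': "?B \<in> T" "adm \<beta> ?B" using adm_flip[OF \<beta> C admC] by auto
  have cup: "cup T (kap \<alpha>) \<alpha> (kap \<beta>) \<beta> (canonical_class E \<phi> \<alpha> B) (canonical_class E \<phi> \<beta> C) =
      coh_class T ?k (\<alpha> + \<beta>) (cup_cochain (kap \<alpha>) f g)"
    if "generates faces length (chains_from ?A \<alpha>) (Suc (kap \<alpha>)) f"
      "generates faces length (chains_from ?B \<beta>) (Suc (kap \<beta>)) g" for f g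
    using that canonical_class_generator[OF B \<alpha>] canonical_class_generator[OF C \<beta>]
    by (simp add: cup_coh_class generator_cocycles)
  show ?thesis
  proof (cases "B = ?B \<and> adm (\<alpha> + \<beta>) C \<and> kap (\<alpha> + \<beta>) = ?k")
    case True
    have flipC: "flip (\<alpha> + \<beta>) C = ?A" using True by (metis add.commute flip_add)
    have "adm (\<alpha> + \<beta>) ?A"
      using adm_flip[of "\<alpha> + \<beta>" C] \<alpha> \<beta> C True unfolding flipC by simp
    then obtain f g where fg: "generates faces length (chains_from ?A \<alpha>) (Suc (kap \<alpha>)) f"
      "generates faces length (chains_from (flip \<alpha> ?A) \<beta>) (Suc (kap \<beta>)) g"
      "generates faces length (chains_from ?A (\<alpha> + \<beta>)) (Suc ?k) (cup_cochain (kap \<alpha>) f g)"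
      using product_of_generators[OF \<alpha> \<beta> A] B' B True by auto
    have "generates faces length (chains_from ?B \<beta>) (Suc (kap \<beta>)) g" using fg(2) True by simp
    moreover have "canonical_class E \<phi> (\<alpha> + \<beta>) C = coh_class T ?k (\<alpha> + \<beta>) (cup_cochain (kap \<alpha>) f g)"
      using canonical_class_generator[OF C, of "\<alpha> + \<beta>"] fg(3) \<alpha> \<beta> True unfolding flipC by simp
    ultimately show ?thesis using cup[OF fg(1)] True by simp
  next
    case False
    obtain f g where f: "generates faces length (chains_from ?A \<alpha>) (Suc (kap \<alpha>)) f"
      and g: "generates faces length (chains_from ?B \<beta>) (Suc (kap \<beta>)) g"
      using cohomology_of_chains[OF A(1) \<alpha>] cohomology_of_chains[OF B'(1) \<beta>] A B' by blast
    define u where "u = cup_cochain (kap \<alpha>) f g"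
    have fz: "f \<in> cocycles T (kap \<alpha>) \<alpha>" and gz: "g \<in> cocycles T (kap \<beta>) \<beta>"
      using generator_cocycles f g by auto
    have u: "u \<in> cocycles T ?k (\<alpha> + \<beta>)" unfolding u_def by (rule cup_cocycles[OF fz gz])
    have ends: "hd x = ?A \<and> B = ?B" if nz: "u x \<noteq> 0" for x
    proof -
      have fc: "f \<in> cochains T (kap \<alpha>) \<alpha>" "g \<in> cochains T (kap \<beta>) \<beta>" using fz gz by (auto simp: cocycles_def)
      note s = cup_supp[OF fc nz[unfolded u_def]]
      have m: "take (kap \<alpha> + 1) x \<in> chains_from ?A \<alpha>" "drop (kap \<alpha>) x \<in> chains_from ?B \<beta>"
        using s(4,5) generates_supp[OF f] generates_supp[OF g] by blast+
      have "hd (take (kap \<alpha> + 1) x) = ?A" "hd (drop (kap \<alpha>) x) = ?B"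
        using m unfolding chains_from_proper by blast+
      moreover have "last (take (kap \<alpha> + 1) x) = flip \<alpha> ?A" using chains_from_last[OF m(1)] by blast
      ultimately show ?thesis using s(2,3) by (simp only: flip_flip)
    qed
    have "u \<in> coboundaries T ?k (\<alpha> + \<beta>)"
    proof (cases "B = ?B")
      case False
      then have "u = (\<lambda>x. 0)" using ends by blast
      then show ?thesis using coboundaries_0 by simp
    next
      case BB: True
      have flipC: "flip (\<alpha> + \<beta>) C = ?A" using BB by (metis add.commute flip_add)
      have flipA: "flip (\<alpha> + \<beta>) ?A = C" unfolding flipC[symmetric] by simp
      have sumE: "\<alpha> + \<beta> \<in> exponents E" using \<alpha> \<beta> by simp
      show ?thesis
      proof (cases "adm (\<alpha> + \<beta>) ?A")
        case True
        then have "adm (\<alpha> + \<beta>) C" using adm_flip[OF sumE A(1)] flipA by simp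
        then have "kap (\<alpha> + \<beta>) \<noteq> ?k" using False BB by blast
        moreover obtain w where "generates faces length (chains_from ?A (\<alpha> + \<beta>)) (Suc (kap (\<alpha> + \<beta>))) w"
          using cohomology_of_chains[OF A(1) sumE] True by blast
        ultimately show ?thesis using coboundary_of_other_degree[OF _ _ u] ends by blast
      next
        case nadm: False
        then have "coboundary faces (chains_from ?A (\<alpha> + \<beta>)) u"
          using cohomology_of_chains[OF A(1) sumE] cocycles_imp_cocycle[OF u] by (auto simp: exact_def)
        then show ?thesis using u ends by (intro coboundary_imp_coboundaries[where A = ?A]) (auto simp: cocycles_def)
      qed
    qed
    moreover have "0 \<in> cocycles T ?k (\<alpha> + \<beta>)" by (auto simp: cocycles_iff cochains_def df_def)
    ultimately have "coh_class T ?k (\<alpha> + \<beta>) u = MH_zero T ?k (\<alpha> + \<beta>)" using coh_class_eq_iff[OF u] by simp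
    then show ?thesis using cup[OF f g] False by (auto simp: u_def)
  qed
qed

end

theorem theorem7p3:
  fixes E :: "'e set" and \<phi> :: "'e \<Rightarrow> 'v::real_vector \<Rightarrow> real"
    and \<alpha> \<beta> :: "'e \<Rightarrow> nat" and B C :: "'e sign_vector"
  assumes "arrangement E \<phi>"
    and "\<alpha> \<in> exponents E" and "\<beta> \<in> exponents E"
    and "B \<in> topes E \<phi>" and "C \<in> topes E \<phi>"
    and "tope_admissible E \<phi> \<alpha> B" and "tope_admissible E \<phi> \<beta> C"
  shows "cup (topes E \<phi>) (kappa E \<phi> \<alpha>) \<alpha> (kappa E \<phi> \<beta>) \<beta>
      (canonical_class E \<phi> \<alpha> B) (canonical_class E \<phi> \<beta> C) =
    (if B = flip \<beta> C \<and> tope_admissible E \<phi> (\<alpha> + \<beta>) C \<and>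
        kappa E \<phi> (\<alpha> + \<beta>) = kappa E \<phi> \<alpha> + kappa E \<phi> \<beta>
     then canonical_class E \<phi> (\<alpha> + \<beta>) C
     else MH_zero (topes E \<phi>) (kappa E \<phi> \<alpha> + kappa E \<phi> \<beta>) (\<alpha> + \<beta>))"
proof -
  interpret hyperplanes E \<phi> by unfold_locales fact
  show ?thesis
    using cup_canonical[OF assms(2-5)] assms(4-7) by (simp only: tope_admissible_iff)
qed

end
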